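(* Work in the setting of the context ($T=\infty$, $q(\mathrm{d}t)=e^{-rt}\mathrm{d}t$, $\mathcal{A}$ generating a $C_0$-group of positivity-preserving operators, $\mathbf{1}$ an eigenvector of $\mathcal{A}$ and $\mathcal{A}^*$ with eigenvalues $\lambda_0$, $\lambda_0^*$, separable power profit and space-homogeneous marginal cost), and assume moreover that $$\mathsf{E}\Big[\int_0^{\infty}e^{-(r\wedge(r-\lambda_0^* ))t}(z^*_t)^{\alpha}\,\mathrm{d}t\Big]<\infty$$ and that there exists $m>0$ such that for all $s\ge0$ $$\mathsf{E}\Big[\int_s^{\infty}e^{-(r-\lambda_0^* )t}(z^*_t)^{\alpha}\,\mathrm{d}t\,\Big|\,\mathcal{F}_s\Big]\le m\,e^{-(r-\lambda_0^* )s}\varphi^*_s .$$ Let $\ell=(\ell_t)_{t\ge0}$ be the (unique up to indistinguishability) strictly positive optional process with upper right-continuous paths that solves $$\mathsf{E}\Big[\int_\tau^\infty e^{-(r-\lambda_0^* )t}(z_t^* )^\alpha\Big(e^{\lambda_0t}\sup_{\tau\le u\le t}e^{-\lambda_0u}\ell_u\Big)^{-\alpha}\mathrm{d}t\,\Big|\,\mathcal{F}_\tau\Big]=e^{-(r-\lambda_0^* )\tau}\varphi^*_\tau\quad\text{for every }\mathbb{F}\text{-stopping time }\tau,$$ and satisfies $e^{-(r-\lambda_0^* )t}(z^*_t)^\alpha\big(e^{\lambda_0t}\sup_{s\le u\le t}e^{-\lambda_0u}\ell_u\big)^{-\alpha}\in L^1(\mathsf{P}\otimes\mathrm{d}t)$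 (on $t\ge s$) for any $s\ge0$. Let $\mathbf{y}\in K_+$ with $\mathbf{y}\le\ell_0\mathbf{1}$ and consider the nondecreasing, $\mathbb{F}$-adapted, $K_+$-valued, right-continuous process $$\widehat{\nu}^{\star}_t:=\mathbf{1}\sup_{0\le u\le t}e^{-\lambda_0u}\ell_u-\mathbf{y},\qquad\widehat{\nu}^{\star}_{0^-}=0.$$ If $\mathsf{E}\big[\int_0^\infty\langle e^{t\mathcal{A}^*}\Phi^*_t,\mathrm{d}\widehat{\nu}^{\star}_t\rangle\big]<\infty$, then $\widehat{\nu}^\star$ is optimal for the problem $$\sup_{\widehat{\nu}\in\widehat{\mathcal{C}}}\mathsf{E}\Big[\int_0^\infty\Pi\big(t,e^{t\mathcal{A}}(\mathbf{y}+\widehat{\nu}_t)\big)e^{-rt}\,\mathrm{d}t-\int_0^\infty\langle e^{t\mathcal{A}^*}\Phi^*_t,\mathrm{d}\widehat{\nu}_t\rangle\Big],$$ i.e. $\widehat\nu^\star\in\widehat{\mathcal{C}}$ attains this supremum.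
   Context: **Spaces.** $(D,\mathcal{M},\mu)$ is a measure space with $\mu(D)<\infty$, $p\in(1,\infty)$, $X=L^p(D,\mathcal{M},\mu)$, $X^*=L^{p^*}(D,\mathcal{M},\mu)$ with $p^*=p/(p-1)$, $\langle v^*,v\rangle=\int_Dv^*v\,\mathrm{d}\mu$; order is pointwise a.e. $K_+=\{v\in X:v\ge0\}$, $K^*_+=\{v^*\in X^*:v^*\ge0\}$. $\mathbf{1}$ is the function identically equal to $1$ on $D$. A bounded linear $P:X\to X$ is positivity-preserving if $f\ge0\Rightarrow Pf\ge0$. **Probability.** $(\Omega,\mathcal{F},\mathbb{F}=(\mathcal{F}_t)_{t\ge0},\mathsf{P})$ is a filtered probability space satisfying the usual conditions; relations between random quantities hold $\mathsf{P}$-a.s. **Controls and integrals.** $\mathcal{S}$ is the set of $\mathbb{F}$-adapted processes $\nu:\Omega\times[0,\infty)\to K_+$ with nondecreasing right-continuous paths. One sets $\nu_{0^-}:=\mathbf{0}$ and identifies $\nu$ with the (random) countably additive $K_+$-valued vector measure $\nu([s,t])=\nu_t-\nu_{s^-}$ (with mass $\nu_0$ at time $0$), which is of finite variation (on compact intervals); $|\nu|$ is its variation measure and $\rho$ its $K_+$-valued density, $\mathrm{d}\nu=\rho\,\mathrm{d}|\nu|$. For a $K_+^*$-valued process $f^*$, $\int_0^\infty\langle f^*_s,\mathrm{d}\nu_s\rangle:=\int_{[0,\infty)}\langle f^*_s,\rho_s\rangle\,\mathrm{d}|\nu|_s\in[0,\infty]$. **Model assumptions.** - $\mathcal{A}:\mathcal{D}(\mathcal{A})\subseteq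 X\to X$ is closed, densely defined and generates a $C_0$-group $(e^{t\mathcal{A}})_{t\in\mathbb{R}}$ of positivity-preserving operators on $X$; $e^{t\mathcal{A}^*}=(e^{t\mathcal{A}})^*$. - $T=+\infty$ and $q(\mathrm{d}t)=e^{-rt}\mathrm{d}t$ with $r>0$. - $\mathbf{1}$ is an eigenvector of $\mathcal{A}$ and of $\mathcal{A}^*$ with eigenvalues $\lambda_0\in\mathbb{R}$ and $\lambda_0^*\in\mathbb{R}$, respectively; $r>\lambda_0^*\vee0$. - $\Pi(\omega,t,\mathbf{k})=(1-\alpha)^{-1}(z^*_t(\omega))^\alpha\langle\mathbf{1},\mathbf{k}^{1-\alpha}\rangle$ for $\mathbf{k}\in K_+$ (power taken pointwise), with $\alpha\in(0,1)$ and $z^*$ an $\mathbb{F}$-progressively measurable nonnegative process. - $\Phi^*_t=e^{-rt}\varphi^*_t\mathbf{1}$, with $\varphi^*$ an $\mathbb{F}$-progressively measurable, nonnegative, càdlàg process such that $(e^{-(r-\lambda_0^* )t}\varphi^*_t)_{t\ge0}$ is of Class (D) (its values at stopping times are uniformly integrable), is lower-semicontinuous in expectation ($\liminf_n\mathsf{E}[Z_{\tau_n}]\ge\mathsf{E}[Z_\tau]$ for every monotone sequence of stopping times $\tau_n\to\tau$ a.s., where $Z_t=e^{-(r-\lambda_0^* )t}\varphi_t^*$), and $\limsup_{t\uparrow\infty}e^{-(r-\lambda_0^* )t}\varphi^*_t=0$. On $\{\tau=+\infty\}$ one sets $e^{-(r-\lambda_0^* )\tau}\varphi^*_\tau:=\limsup_{t\uparrow\infty}e^{-(r-\lambda_0^*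 )t}\varphi^*_t$. **Upper right-continuity** of $\ell$ means $\ell_t=\lim_{\varepsilon\downarrow0}\sup_{u\in[t,t+\varepsilon)}\ell_u$ for all $t$. **Admissible set.** $\widehat{\mathcal{C}}=\{\widehat{\nu}\in\mathcal{S}:\mathsf{E}[\int_0^\infty\langle e^{t\mathcal{A}^*}\Phi^*_t,\mathrm{d}\widehat{\nu}_t\rangle]<\infty\}$.
   Formalization: Controls are required to have paths of finite variation: in L^p, p>1, nondecreasing right-continuous paths need not (e.g. t ↦ 1_[0,t]), and the cost integral is then undefined. The running supremum of e^{-λ0 u}ℓ_u is assumed finite, so that the control is K_+-valued. *)

theory Defs
  imports "HOL-Probability.Probability" "HOL-Probability.Stopping_Time"
begin

section \<open>The spaces \<open>L\<^sup>p\<close>, represented by functions modulo equality almost everywhere\<close>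

text \<open>
  Elements of \<open>L\<^sup>p\<close> are represented by measurable functions. Every notion below is
  invariant under equality almost everywhere, which plays the role of equality in \<open>L\<^sup>p\<close>.
\<close>

definition Lp_space :: "'d measure \<Rightarrow> real \<Rightarrow> ('d \<Rightarrow> real) set" where
  "Lp_space \<mu> p = {f \<in> borel_measurable \<mu>. integrable \<mu> (\<lambda>x. \<bar>f x\<bar> powr p)}"

definition Lp_norm :: "'d measure \<Rightarrow> real \<Rightarrow> ('d \<Rightarrow> real) \<Rightarrow> real" where
  "Lp_norm \<mu> p f = (\<integral>x. \<bar>f x\<bar> powr p \<partial>\<mu>) powr (1 / p)"

definition Lp_dist :: "'d measure \<Rightarrow> real \<Rightarrow> ('d \<Rightarrow> real) \<Rightarrow> ('d \<Rightarrow> real) \<Rightarrow> real" where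
  "Lp_dist \<mu> p f g = Lp_norm \<mu> p (\<lambda>x. f x - g x)"

definition Lp_cone :: "'d measure \<Rightarrow> real \<Rightarrow> ('d \<Rightarrow> real) set" where
  "Lp_cone \<mu> p = {f \<in> Lp_space \<mu> p. AE x in \<mu>. 0 \<le> f x}"

definition pairing :: "'d measure \<Rightarrow> ('d \<Rightarrow> real) \<Rightarrow> ('d \<Rightarrow> real) \<Rightarrow> real" where
  "pairing \<mu> g f = (\<integral>x. g x * f x \<partial>\<mu>)"

definition conj_exponent :: "real \<Rightarrow> real" where
  "conj_exponent p = p / (p - 1)"

definition Lp_open :: "'d measure \<Rightarrow> real \<Rightarrow> ('d \<Rightarrow> real) set \<Rightarrow> bool" where
  "Lp_open \<mu> p G \<longleftrightarrow> G \<subseteq> Lp_space \<mu> p \<and>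
     (\<forall>f\<in>G. \<exists>e>0. \<forall>g\<in>Lp_space \<mu> p. Lp_dist \<mu> p g f < e \<longrightarrow> g \<in> G)"

definition Lp_borel :: "'d measure \<Rightarrow> real \<Rightarrow> ('d \<Rightarrow> real) measure" where
  "Lp_borel \<mu> p = sigma (Lp_space \<mu> p) {G. Lp_open \<mu> p G}"


section \<open>Operators, groups and generators\<close>

text \<open>Linearity and boundedness imply that \<open>T\<close> respects equality almost everywhere.\<close>

definition Lp_bounded_linear :: "'d measure \<Rightarrow> real \<Rightarrow> (('d \<Rightarrow> real) \<Rightarrow> ('d \<Rightarrow> real)) \<Rightarrow> bool" where
  "Lp_bounded_linear \<mu> p T \<longleftrightarrow>
     (\<forall>f\<in>Lp_space \<mu> p. T f \<in> Lp_space \<mu> p) \<and>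
     (\<forall>f\<in>Lp_space \<mu> p. \<forall>g\<in>Lp_space \<mu> p. AE x in \<mu>. T (\<lambda>x. f x + g x) x = T f x + T g x) \<and>
     (\<forall>f\<in>Lp_space \<mu> p. \<forall>c. AE x in \<mu>. T (\<lambda>x. c * f x) x = c * T f x) \<and>
     (\<exists>K. \<forall>f\<in>Lp_space \<mu> p. Lp_norm \<mu> p (T f) \<le> K * Lp_norm \<mu> p f)"

definition positivity_preserving ::
  "'d measure \<Rightarrow> real \<Rightarrow> (('d \<Rightarrow> real) \<Rightarrow> ('d \<Rightarrow> real)) \<Rightarrow> bool" where
  "positivity_preserving \<mu> p T \<longleftrightarrow> (\<forall>f\<in>Lp_cone \<mu> p. T f \<in> Lp_cone \<mu> p)"

definition C0_group ::
  "'d measure \<Rightarrow> real \<Rightarrow> (real \<Rightarrow> ('d \<Rightarrow> real) \<Rightarrow> ('d \<Rightarrow> real)) \<Rightarrow> bool" where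
  "C0_group \<mu> p U \<longleftrightarrow>
     (\<forall>t. Lp_bounded_linear \<mu> p (U t)) \<and>
     (\<forall>f\<in>Lp_space \<mu> p. AE x in \<mu>. U 0 f x = f x) \<and>
     (\<forall>s t. \<forall>f\<in>Lp_space \<mu> p. AE x in \<mu>. U (s + t) f x = U s (U t f) x) \<and>
     (\<forall>f\<in>Lp_space \<mu> p. ((\<lambda>t. Lp_dist \<mu> p (U t f) f) \<longlongrightarrow> 0) (at 0))"

text \<open>
  Unbounded operators are given by their graphs, so that the domain of \<open>A\<close> is \<open>Domain A\<close> and
  \<open>(f, g) \<in> A\<close> means \<open>A f = g\<close>. The graphs are closed under equality almost everywhere.
\<close>

definition generator ::
  "'d measure \<Rightarrow> real \<Rightarrow> (real \<Rightarrow> ('d \<Rightarrow> real) \<Rightarrow> ('d \<Rightarrow> real)) \<Rightarrow> (('d \<Rightarrow> real) \<times> ('d \<Rightarrow> real)) set" where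
  "generator \<mu> p U = {(f, g). f \<in> Lp_space \<mu> p \<and> g \<in> Lp_space \<mu> p \<and>
     ((\<lambda>h. Lp_dist \<mu> p (\<lambda>x. (U h f x - f x) / h) g) \<longlongrightarrow> 0) (at 0)}"

definition closed_operator ::
  "'d measure \<Rightarrow> real \<Rightarrow> (('d \<Rightarrow> real) \<times> ('d \<Rightarrow> real)) set \<Rightarrow> bool" where
  "closed_operator \<mu> p A \<longleftrightarrow>
     (\<forall>u v f g. (\<forall>n. (u n, v n) \<in> A) \<and> f \<in> Lp_space \<mu> p \<and> g \<in> Lp_space \<mu> p \<and>
        (\<lambda>n::nat. Lp_dist \<mu> p (u n) f) \<longlonglongrightarrow> 0 \<and> (\<lambda>n. Lp_dist \<mu> p (v n) g) \<longlonglongrightarrow> 0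
        \<longrightarrow> (f, g) \<in> A)"

definition densely_defined ::
  "'d measure \<Rightarrow> real \<Rightarrow> (('d \<Rightarrow> real) \<times> ('d \<Rightarrow> real)) set \<Rightarrow> bool" where
  "densely_defined \<mu> p A \<longleftrightarrow>
     (\<forall>f\<in>Lp_space \<mu> p. \<forall>e>0. \<exists>g\<in>Domain A. Lp_dist \<mu> p g f < e)"

text \<open>The (unbounded) adjoint of \<open>A\<close> on \<open>X\<^sup>*\<close>, and the adjoint of a bounded operator.\<close>

definition adjoint_graph ::
  "'d measure \<Rightarrow> real \<Rightarrow> (('d \<Rightarrow> real) \<times> ('d \<Rightarrow> real)) set \<Rightarrow> (('d \<Rightarrow> real) \<times> ('d \<Rightarrow> real)) set" where
  "adjoint_graph \<mu> p A = {(g, h). g \<in> Lp_space \<mu> (conj_exponent p) \<and>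
     h \<in> Lp_space \<mu> (conj_exponent p) \<and> (\<forall>(u, v)\<in>A. pairing \<mu> g v = pairing \<mu> h u)}"

definition is_adjoint ::
  "'d measure \<Rightarrow> real \<Rightarrow> (('d \<Rightarrow> real) \<Rightarrow> ('d \<Rightarrow> real)) \<Rightarrow> (('d \<Rightarrow> real) \<Rightarrow> ('d \<Rightarrow> real)) \<Rightarrow> bool" where
  "is_adjoint \<mu> p T T' \<longleftrightarrow>
     (\<forall>g\<in>Lp_space \<mu> (conj_exponent p). T' g \<in> Lp_space \<mu> (conj_exponent p) \<and>
        (\<forall>f\<in>Lp_space \<mu> p. pairing \<mu> (T' g) f = pairing \<mu> g (T f)))"

definition eigenvector ::
  "'d measure \<Rightarrow> (('d \<Rightarrow> real) \<times> ('d \<Rightarrow> real)) set \<Rightarrow> real \<Rightarrow> ('d \<Rightarrow> real) \<Rightarrow> bool" where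
  "eigenvector \<mu> A c v \<longleftrightarrow> \<not> (AE x in \<mu>. v x = 0) \<and> (v, \<lambda>x. c * v x) \<in> A"


section \<open>Filtered probability spaces and processes\<close>

text \<open>
  The filtration is indexed by \<open>[0,\<infinity>]\<close>, with \<open>F \<infinity>\<close> the \<open>\<sigma>\<close>-algebra generated by all \<open>F t\<close>,
  \<open>t < \<infinity>\<close>; stopping times are then \<open>[0,\<infinity>]\<close>-valued. Processes are indexed by real \<open>t \<ge> 0\<close>;
  their values at negative times are irrelevant.
\<close>

definition usual_conditions :: "'w measure \<Rightarrow> (ennreal \<Rightarrow> 'w measure) \<Rightarrow> bool" where
  "usual_conditions P F \<longleftrightarrow>
     prob_space P \<and> complete_measure P \<and> filtration (space P) F \<and>
     (\<forall>t. subalgebra P (F t)) \<and>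
     null_sets P \<subseteq> sets (F 0) \<and>
     (\<forall>t<\<infinity>. sets (F t) = (\<Inter>s\<in>{t<..}. sets (F s))) \<and>
     sets (F \<infinity>) = sigma_sets (space P) (\<Union>t\<in>{..<\<infinity>}. sets (F t))"

definition progressive :: "(ennreal \<Rightarrow> 'w measure) \<Rightarrow> (real \<Rightarrow> 'w \<Rightarrow> real) \<Rightarrow> bool" where
  "progressive F Z \<longleftrightarrow>
     (\<forall>t\<ge>0. (\<lambda>(s, \<omega>). Z s \<omega>) \<in>
        borel_measurable (restrict_space borel {0..t} \<Otimes>\<^sub>M F (ennreal t)))"

definition cadlag :: "(real \<Rightarrow> real) \<Rightarrow> bool" where
  "cadlag x \<longleftrightarrow> (\<forall>t\<ge>0. (x \<longlongrightarrow> x t) (at_right t)) \<and> (\<forall>t>0. \<exists>l. (x \<longlongrightarrow> l) (at_left t))"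

text \<open>The optional \<open>\<sigma>\<close>-algebra on \<open>[0,\<infinity>) \<times> \<Omega>\<close>: generated by the adapted cadlag processes.\<close>

definition optional_sigma :: "'w measure \<Rightarrow> (ennreal \<Rightarrow> 'w measure) \<Rightarrow> (real \<times> 'w) measure" where
  "optional_sigma P F = sigma ({0..} \<times> space P)
     {(\<lambda>(t, \<omega>). X t \<omega>) -` B \<inter> ({0..} \<times> space P) | X B.
        (\<forall>t\<ge>0. X t \<in> borel_measurable (F (ennreal t))) \<and>
        (\<forall>\<omega>\<in>space P. cadlag (\<lambda>t. X t \<omega>)) \<and> B \<in> sets (borel :: real measure)}"

definition optional_process ::
  "'w measure \<Rightarrow> (ennreal \<Rightarrow> 'w measure) \<Rightarrow> (real \<Rightarrow> 'w \<Rightarrow> real) \<Rightarrow> bool" where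
  "optional_process P F Z \<longleftrightarrow> (\<lambda>(t, \<omega>). Z t \<omega>) \<in> borel_measurable (optional_sigma P F)"

definition upper_right_continuous :: "(real \<Rightarrow> real) \<Rightarrow> bool" where
  "upper_right_continuous x \<longleftrightarrow>
     (\<forall>t\<ge>0. ((\<lambda>\<epsilon>. SUP u\<in>{t..<t + \<epsilon>}. ereal (x u)) \<longlongrightarrow> ereal (x t)) (at_right 0))"

text \<open>\<open>Z\<^sub>\<tau>\<close>, with the value \<open>limsup Z\<^sub>t\<close> as \<open>t \<rightarrow> \<infinity>\<close> where \<open>\<tau> = \<infinity>\<close>.\<close>

definition at_time :: "(real \<Rightarrow> 'w \<Rightarrow> real) \<Rightarrow> ('w \<Rightarrow> ennreal) \<Rightarrow> 'w \<Rightarrow> real" where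
  "at_time Z \<tau> \<omega> =
     (if \<tau> \<omega> = \<infinity> then real_of_ereal (Limsup at_top (\<lambda>t. ereal (Z t \<omega>)))
      else Z (enn2real (\<tau> \<omega>)) \<omega>)"

definition uniformly_integrable :: "'w measure \<Rightarrow> ('w \<Rightarrow> real) set \<Rightarrow> bool" where
  "uniformly_integrable P \<X> \<longleftrightarrow> \<X> \<subseteq> borel_measurable P \<and>
     (\<forall>\<epsilon>>0. \<exists>c. \<forall>X\<in>\<X>. (\<integral>\<^sup>+\<omega>\<in>{\<omega>. c < \<bar>X \<omega>\<bar>}. ennreal \<bar>X \<omega>\<bar> \<partial>P) \<le> ennreal \<epsilon>)"

definition class_D ::
  "'w measure \<Rightarrow> (ennreal \<Rightarrow> 'w measure) \<Rightarrow> (real \<Rightarrow> 'w \<Rightarrow> real) \<Rightarrow> bool" where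
  "class_D P F Z \<longleftrightarrow> uniformly_integrable P {at_time Z \<tau> | \<tau>. stopping_time F \<tau>}"

definition lsc_in_expectation ::
  "'w measure \<Rightarrow> (ennreal \<Rightarrow> 'w measure) \<Rightarrow> (real \<Rightarrow> 'w \<Rightarrow> real) \<Rightarrow> bool" where
  "lsc_in_expectation P F Z \<longleftrightarrow>
     (\<forall>(\<sigma> :: nat \<Rightarrow> 'w \<Rightarrow> ennreal) \<tau>.
        (\<forall>n. stopping_time F (\<sigma> n)) \<and> stopping_time F \<tau> \<and>
        ((AE \<omega> in P. incseq (\<lambda>n. \<sigma> n \<omega>)) \<or> (AE \<omega> in P. decseq (\<lambda>n. \<sigma> n \<omega>))) \<and>
        (AE \<omega> in P. (\<lambda>n. \<sigma> n \<omega>) \<longlonglongrightarrow> \<tau> \<omega>)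
        \<longrightarrow> liminf (\<lambda>n. ereal (\<integral>\<omega>. at_time Z (\<sigma> n) \<omega> \<partial>P)) \<ge> ereal (\<integral>\<omega>. at_time Z \<tau> \<omega> \<partial>P))"

text \<open>Expectation of an extended-real random variable with integrable negative part.\<close>

definition ext_expectation :: "'w measure \<Rightarrow> ('w \<Rightarrow> ereal) \<Rightarrow> ereal" where
  "ext_expectation P X =
     enn2ereal (\<integral>\<^sup>+\<omega>. e2ennreal (X \<omega>) \<partial>P) - enn2ereal (\<integral>\<^sup>+\<omega>. e2ennreal (- X \<omega>) \<partial>P)"


section \<open>Controls and integrals against them\<close>

text \<open>
  Throughout, a path \<open>n :: real \<Rightarrow> 'd \<Rightarrow> real\<close> is considered on \<open>[0,\<infinity>)\<close> with \<open>n 0- = 0\<close>, so its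
  variation on \<open>[0,t]\<close> includes the norm of \<open>n 0\<close>. For a right-continuous path of locally
  finite variation, the variation measure of the associated vector measure is the Stieltjes
  measure of the total variation function.
\<close>

definition variation_sums ::
  "'d measure \<Rightarrow> real \<Rightarrow> (real \<Rightarrow> 'd \<Rightarrow> real) \<Rightarrow> real \<Rightarrow> real set" where
  "variation_sums \<mu> p n t =
     {Lp_norm \<mu> p (n 0) + (\<Sum>i<k. Lp_dist \<mu> p (n (c (Suc i))) (n (c i))) | k c.
        incseq c \<and> c 0 = 0 \<and> c k = t}"

definition finite_variation :: "'d measure \<Rightarrow> real \<Rightarrow> (real \<Rightarrow> 'd \<Rightarrow> real) \<Rightarrow> bool" where
  "finite_variation \<mu> p n \<longleftrightarrow> (\<forall>t\<ge>0. bdd_above (variation_sums \<mu> p n t))"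

definition variation_measure ::
  "'d measure \<Rightarrow> real \<Rightarrow> (real \<Rightarrow> 'd \<Rightarrow> real) \<Rightarrow> real measure" where
  "variation_measure \<mu> p n =
     interval_measure (\<lambda>t. if t < 0 then 0 else Sup (variation_sums \<mu> p n t))"

text \<open>
  Bochner integral of an \<open>L\<^sup>p\<close>-valued function, as in \<^const>\<open>has_bochner_integral\<close> (which is
  not applicable here, since \<open>L\<^sup>p\<close> is not a type and need not be separable).
\<close>

definition Lp_has_integral ::
  "'d measure \<Rightarrow> real \<Rightarrow> real measure \<Rightarrow> (real \<Rightarrow> 'd \<Rightarrow> real) \<Rightarrow> ('d \<Rightarrow> real) \<Rightarrow> bool" where
  "Lp_has_integral \<mu> p m f I \<longleftrightarrow> I \<in> Lp_space \<mu> p \<and> (\<forall>t\<in>space m. f t \<in> Lp_space \<mu> p) \<and>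
     (\<exists>s :: nat \<Rightarrow> real \<Rightarrow> 'd \<Rightarrow> real.
        (\<forall>i. finite (s i ` space m) \<and> s i ` space m \<subseteq> Lp_space \<mu> p \<and>
             (\<forall>v. {t \<in> space m. s i t = v} \<in> sets m) \<and>
             emeasure m {t \<in> space m. s i t \<noteq> (\<lambda>x. 0)} < \<infinity> \<and>
             (\<lambda>t. Lp_dist \<mu> p (f t) (s i t)) \<in> borel_measurable m) \<and>
        (\<lambda>i. \<integral>\<^sup>+t. ennreal (Lp_dist \<mu> p (f t) (s i t)) \<partial>m) \<longlonglongrightarrow> 0 \<and>
        (\<lambda>i. Lp_dist \<mu> p
               (\<lambda>x. \<Sum>v\<in>s i ` space m. measure m {t \<in> space m. s i t = v} * v x) I) \<longlonglongrightarrow> 0)"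

text \<open>\<open>dn = \<rho> d|n|\<close>, that is, \<open>n t = n [0,t]\<close> is the integral of \<open>\<rho>\<close> over \<open>[0,t]\<close> for all \<open>t\<close>.\<close>

definition is_density ::
  "'d measure \<Rightarrow> real \<Rightarrow> (real \<Rightarrow> 'd \<Rightarrow> real) \<Rightarrow> (real \<Rightarrow> 'd \<Rightarrow> real) \<Rightarrow> bool" where
  "is_density \<mu> p n \<rho> \<longleftrightarrow> (\<forall>s\<ge>0. \<rho> s \<in> Lp_cone \<mu> p) \<and>
     (\<forall>t\<ge>0. Lp_has_integral \<mu> p (variation_measure \<mu> p n)
        (\<lambda>s x. indicator {0..t} s * \<rho> s x) (n t))"

definition path_integral ::
  "'d measure \<Rightarrow> real \<Rightarrow> (real \<Rightarrow> 'd \<Rightarrow> real) \<Rightarrow> (real \<Rightarrow> 'd \<Rightarrow> real) \<Rightarrow> ennreal" where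
  "path_integral \<mu> p f n =
     (\<integral>\<^sup>+s\<in>{0..}. ennreal (pairing \<mu> (f s) ((SOME \<rho>. is_density \<mu> p n \<rho>) s))
        \<partial>variation_measure \<mu> p n)"

text \<open>
  A nondecreasing right-continuous path in \<open>L\<^sup>p\<close>, \<open>p > 1\<close>, need not have locally finite variation
  (\<open>t \<mapsto> 1\<^bsub>[0,t]\<^esub>\<close> in \<open>L\<^sup>p(0,1)\<close> does not), and without it neither the variation measure nor the
  density exists. Finite variation is therefore part of the definition of a control. Given
  finite variation, the density exists because \<open>L\<^sup>p\<close> is reflexive and hence has the
  Radon-Nikodym property, so the last condition only records that the integral makes sense.
\<close>

definition controls ::
  "'d measure \<Rightarrow> real \<Rightarrow> 'w measure \<Rightarrow> (ennreal \<Rightarrow> 'w measure) \<Rightarrow> (real \<Rightarrow> 'w \<Rightarrow> 'd \<Rightarrow> real) set" where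
  "controls \<mu> p P F = {\<nu>.
     (\<forall>t\<ge>0. \<nu> t \<in> F (ennreal t) \<rightarrow>\<^sub>M Lp_borel \<mu> p) \<and>
     (AE \<omega> in P.
        (\<forall>t\<ge>0. \<nu> t \<omega> \<in> Lp_cone \<mu> p) \<and>
        (\<forall>s t. 0 \<le> s \<and> s \<le> t \<longrightarrow> (AE x in \<mu>. \<nu> s \<omega> x \<le> \<nu> t \<omega> x)) \<and>
        (\<forall>t\<ge>0. ((\<lambda>s. Lp_dist \<mu> p (\<nu> s \<omega>) (\<nu> t \<omega>)) \<longlongrightarrow> 0) (at_right t)) \<and>
        finite_variation \<mu> p (\<lambda>t. \<nu> t \<omega>) \<and>
        (\<exists>\<rho>. is_density \<mu> p (\<lambda>t. \<nu> t \<omega>) \<rho>))}"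


section \<open>The control problem\<close>

definition profit ::
  "'d measure \<Rightarrow> real \<Rightarrow> (real \<Rightarrow> 'w \<Rightarrow> real) \<Rightarrow> 'w \<Rightarrow> real \<Rightarrow> ('d \<Rightarrow> real) \<Rightarrow> real" where
  "profit \<mu> \<alpha> z \<omega> t k =
     1 / (1 - \<alpha>) * z t \<omega> powr \<alpha> * pairing \<mu> (\<lambda>x. 1) (\<lambda>x. k x powr (1 - \<alpha>))"

definition marginal_cost :: "real \<Rightarrow> (real \<Rightarrow> 'w \<Rightarrow> real) \<Rightarrow> real \<Rightarrow> 'w \<Rightarrow> 'd \<Rightarrow> real" where
  "marginal_cost r \<phi> t \<omega> = (\<lambda>x. exp (- r * t) * \<phi> t \<omega>)"

text \<open>In the following, \<open>U t\<close> and \<open>V t\<close> stand for \<open>e\<^bsup>tA\<^esup>\<close> and its adjoint.\<close>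

definition total_cost ::
  "'d measure \<Rightarrow> real \<Rightarrow> (real \<Rightarrow> ('d \<Rightarrow> real) \<Rightarrow> ('d \<Rightarrow> real)) \<Rightarrow> real \<Rightarrow> (real \<Rightarrow> 'w \<Rightarrow> real) \<Rightarrow>
   (real \<Rightarrow> 'w \<Rightarrow> 'd \<Rightarrow> real) \<Rightarrow> 'w \<Rightarrow> ennreal" where
  "total_cost \<mu> p V r \<phi> \<nu> \<omega> =
     path_integral \<mu> p (\<lambda>t. V t (marginal_cost r \<phi> t \<omega>)) (\<lambda>t. \<nu> t \<omega>)"

definition total_profit ::
  "'d measure \<Rightarrow> (real \<Rightarrow> ('d \<Rightarrow> real) \<Rightarrow> ('d \<Rightarrow> real)) \<Rightarrow> real \<Rightarrow> real \<Rightarrow> (real \<Rightarrow> 'w \<Rightarrow> real) \<Rightarrow>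
   ('d \<Rightarrow> real) \<Rightarrow> (real \<Rightarrow> 'w \<Rightarrow> 'd \<Rightarrow> real) \<Rightarrow> 'w \<Rightarrow> ennreal" where
  "total_profit \<mu> U r \<alpha> z y \<nu> \<omega> =
     (\<integral>\<^sup>+t\<in>{0..}. ennreal (profit \<mu> \<alpha> z \<omega> t (U t (\<lambda>x. y x + \<nu> t \<omega> x)) * exp (- r * t)) \<partial>lborel)"

definition admissible ::
  "'d measure \<Rightarrow> real \<Rightarrow> 'w measure \<Rightarrow> (ennreal \<Rightarrow> 'w measure) \<Rightarrow>
   (real \<Rightarrow> ('d \<Rightarrow> real) \<Rightarrow> ('d \<Rightarrow> real)) \<Rightarrow> real \<Rightarrow> (real \<Rightarrow> 'w \<Rightarrow> real) \<Rightarrow>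
   (real \<Rightarrow> 'w \<Rightarrow> 'd \<Rightarrow> real) set" where
  "admissible \<mu> p P F V r \<phi> =
     {\<nu> \<in> controls \<mu> p P F. (\<integral>\<^sup>+\<omega>. total_cost \<mu> p V r \<phi> \<nu> \<omega> \<partial>P) < \<infinity>}"

definition payoff ::
  "'d measure \<Rightarrow> real \<Rightarrow> 'w measure \<Rightarrow> (real \<Rightarrow> ('d \<Rightarrow> real) \<Rightarrow> ('d \<Rightarrow> real)) \<Rightarrow>
   (real \<Rightarrow> ('d \<Rightarrow> real) \<Rightarrow> ('d \<Rightarrow> real)) \<Rightarrow> real \<Rightarrow> real \<Rightarrow> (real \<Rightarrow> 'w \<Rightarrow> real) \<Rightarrow>
   (real \<Rightarrow> 'w \<Rightarrow> real) \<Rightarrow> ('d \<Rightarrow> real) \<Rightarrow> (real \<Rightarrow> 'w \<Rightarrow> 'd \<Rightarrow> real) \<Rightarrow> ereal" where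
  "payoff \<mu> p P U V r \<alpha> z \<phi> y \<nu> =
     ext_expectation P (\<lambda>\<omega>. enn2ereal (total_profit \<mu> U r \<alpha> z y \<nu> \<omega>)
                             - enn2ereal (total_cost \<mu> p V r \<phi> \<nu> \<omega>))"


section \<open>The base capacity\<close>

text \<open>\<open>lam0\<close> and \<open>lam0s\<close> are the eigenvalues of the generator and of its adjoint, respectively.\<close>

definition discounted :: "real \<Rightarrow> real \<Rightarrow> (real \<Rightarrow> 'w \<Rightarrow> real) \<Rightarrow> real \<Rightarrow> 'w \<Rightarrow> real" where
  "discounted r lam0s \<phi> t \<omega> = exp (- (r - lam0s) * t) * \<phi> t \<omega>"

definition running_sup :: "real \<Rightarrow> (real \<Rightarrow> 'w \<Rightarrow> real) \<Rightarrow> real \<Rightarrow> real \<Rightarrow> 'w \<Rightarrow> real" where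
  "running_sup lam0 l s t \<omega> = (SUP u\<in>{s..t}. exp (- lam0 * u) * l u \<omega>)"

definition backward_integrand ::
  "real \<Rightarrow> real \<Rightarrow> real \<Rightarrow> real \<Rightarrow> (real \<Rightarrow> 'w \<Rightarrow> real) \<Rightarrow> (real \<Rightarrow> 'w \<Rightarrow> real) \<Rightarrow>
   real \<Rightarrow> real \<Rightarrow> 'w \<Rightarrow> real" where
  "backward_integrand r lam0 lam0s \<alpha> z l s t \<omega> =
     exp (- (r - lam0s) * t) * z t \<omega> powr \<alpha>
       * (exp (lam0 * t) * running_sup lam0 l s t \<omega>) powr (- \<alpha>)"

definition solves_backward_equation ::
  "'w measure \<Rightarrow> (ennreal \<Rightarrow> 'w measure) \<Rightarrow> real \<Rightarrow> real \<Rightarrow> real \<Rightarrow> real \<Rightarrow> (real \<Rightarrow> 'w \<Rightarrow> real) \<Rightarrow>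
   (real \<Rightarrow> 'w \<Rightarrow> real) \<Rightarrow> (real \<Rightarrow> 'w \<Rightarrow> real) \<Rightarrow> bool" where
  "solves_backward_equation P F r lam0 lam0s \<alpha> z \<phi> l \<longleftrightarrow>
     (\<forall>\<tau>. stopping_time F \<tau> \<longrightarrow>
        (AE \<omega> in P.
           nn_cond_exp P (filtration.pre_sigma (space P) F \<tau>)
             (\<lambda>\<omega>. \<integral>\<^sup>+t\<in>{t. 0 \<le> t \<and> \<tau> \<omega> \<le> ennreal t}.
                ennreal (backward_integrand r lam0 lam0s \<alpha> z l (enn2real (\<tau> \<omega>)) t \<omega>) \<partial>lborel) \<omega>
           = ennreal (at_time (discounted r lam0s \<phi>) \<tau> \<omega>)))"

definition optimal_control ::
  "real \<Rightarrow> (real \<Rightarrow> 'w \<Rightarrow> real) \<Rightarrow> ('d \<Rightarrow> real) \<Rightarrow> real \<Rightarrow> 'w \<Rightarrow> 'd \<Rightarrow> real" where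
  "optimal_control lam0 l y t \<omega> = (\<lambda>x. running_sup lam0 l 0 t \<omega> - y x)"

end

theory Submission
  imports Defs
begin

text \<open>
  The proof is a first-order argument: the profit is concave in the state, the cost is linear in the
  control, and the backward equation is the first-order condition of the candidate.

  Two facts reduce the problem to real-valued processes. As \<open>1\<close> is an eigenvector of the generator
  and of its adjoint, computing \<open>\<langle>1, e\<^bsup>tA\<^esup> 1\<rangle>\<close> in both ways shows that the two eigenvalues are one number
  \<open>\<lambda>\<close> (lemma \<open>eigenvalues_eq\<close>), and both the cost of a control \<open>\<nu>\<close> and the pairing of \<open>1\<close> with the
  state depend on \<open>\<nu>\<close> only through its mass \<open>n\<^sub>t = \<langle>1, \<nu>\<^sub>t\<rangle>\<close>. The state of the candidate at time \<open>t\<close> is the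
  constant function \<open>e\<^bsup>\<lambda>t\<^esup> L\<^sub>t\<close>, where \<open>L\<close> is the running supremum of \<open>e\<^bsup>-\<lambda>u\<^esup> l\<^sub>u\<close>. The tangent of
  \<open>k \<mapsto> k\<^bsup>1-\<alpha>\<^esup>\<close> at this constant gives the pathwise estimate (lemma \<open>path_comparison\<close>)
  \<open>profit \<nu> - profit \<nu>\<^sup>* \<le> \<integral> G\<^sub>t (n\<^sub>t - n\<^sup>*\<^sub>t) dt\<close>, with \<open>G\<close> the marginal profit along the candidate.

  It remains to compare \<open>\<integral> G\<^sub>t n\<^sub>t dt\<close> with the cost. Exchanging integrals turns it into
  \<open>\<integral> (\<integral>\<^sub>s\<^sup>\<infinity> G\<^sub>t dt) dn\<^sub>s\<close>. The marginal profit \<open>G\<close> is built from suprema since time \<open>0\<close>, and the integrand of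
  the backward equation at \<open>\<tau>\<close> from the smaller suprema since \<open>\<tau>\<close>; as a negative power reverses the order,
  the conditional expectation of \<open>\<integral>\<^sub>\<tau>\<^sup>\<infinity> G\<^sub>t dt\<close> is at most the discounted marginal cost at \<open>\<tau>\<close>. Hence the
  expected \<open>\<integral> G\<^sub>t n\<^sub>t dt\<close> is at most the expected cost of \<open>\<nu>\<close> (lemma \<open>expectation_gain_le\<close>). For the
  candidate there is equality (lemma \<open>expectation_gain_eq\<close>), because \<open>dn\<^sup>*\<close> charges only times at which
  \<open>L\<close> increases, and after such a time both suprema agree. Adding the two comparisons to the pathwise
  estimate yields the theorem.

  The equation is available at stopping times only, while the control acts in a whole measure \<open>dn\<close>. The
  measure is therefore parametrised by its generalised inverse: \<open>dn\<close> is the image of Lebesgue measure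
  under \<open>u \<mapsto> C\<^sub>u = inf {t. n\<^sub>t > u}\<close>, and each \<open>C\<^sub>u\<close> is a stopping time. The exchange of integrals becomes
  Tonelli's theorem in \<open>(u, \<omega>)\<close>, and the equation is used for one \<open>u\<close> at a time.

  The suprema of \<open>l\<close> run over uncountably many times and cannot in general be reduced to countably many ones. That
  they are adapted, and measurable when started at a random time, is a consequence of the measurable
  projection theorem for complete spaces, which follows from the stability of complete
  \<open>\<sigma>\<close>-algebras under Suslin's operation.
\<close>

section \<open>Measurability of projections\<close>

definition agree_upto :: "nat \<Rightarrow> (nat \<Rightarrow> 'b) \<Rightarrow> (nat \<Rightarrow> 'b) \<Rightarrow> bool" where
  "agree_upto d x y \<longleftrightarrow> (\<forall>j<d. x j = y j)"

lemma finite_bounded_prefixes: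
  "finite {x :: nat \<Rightarrow> nat. (\<forall>j<k. x j \<le> N j) \<and> (\<forall>j\<ge>k. x j = 0)}" (is "finite ?X")
proof -
  have "?X \<subseteq> {x. \<forall>j. (j \<in> {..<k} \<longrightarrow> x j \<in> {..Max (N ` {..<k})}) \<and> (j \<notin> {..<k} \<longrightarrow> x j = 0)}"
  proof (intro subsetI CollectI allI conjI impI)
    fix x j assume "x \<in> ?X" "j \<in> {..<k}"
    then have "x j \<le> N j" "N j \<in> N ` {..<k}" by auto
    then show "x j \<in> {..Max (N ` {..<k})}" by (auto intro: order_trans[OF _ Max_ge])
  qed auto
  then show ?thesis
    by (rule finite_subset) (intro finite_set_of_finite_funs finite_lessThan finite_atMost)
qed

text \<open>
  Koenig's lemma: a prefix shared by infinitely many of the sequences extends to a longer one, since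
  the next coordinate takes only finitely many values.
\<close>

lemma bounded_sequences_cluster_point:
  fixes X :: "nat \<Rightarrow> nat \<Rightarrow> nat" and N :: "nat \<Rightarrow> nat"
  assumes bd: "\<And>k j. j < k \<Longrightarrow> X k j \<le> N j"
  obtains x where "\<And>d m. \<exists>k\<ge>m. agree_upto d (X k) x"
proof -
  define Q where "Q n xs \<longleftrightarrow> length xs = n \<and> infinite {k. \<forall>j<n. X k j = xs ! j}" for n xs
  have "\<exists>f. \<forall>n. Q n (f n) \<and> (\<exists>a. f (Suc n) = f n @ [a])"
  proof (rule dependent_nat_choice)
    show "\<exists>xs. Q 0 xs" by (rule exI[of _ "[]"]) (simp add: Q_def)
  next
    fix xs n assume Q: "Q n xs"
    let ?S = "{k. \<forall>j<n. X k j = xs ! j}"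
    have "infinite (?S - {..n})" using Q by (simp add: Q_def)
    moreover have "finite ((\<lambda>k. X k n) ` (?S - {..n}))"
      by (rule finite_subset[of _ "{..N n}"]) (auto intro!: bd)
    ultimately obtain a where a: "infinite {k \<in> ?S - {..n}. X k n = a}"
      using pigeonhole_infinite[of "?S - {..n}" "\<lambda>k. X k n"] by fastforce
    have "{k \<in> ?S - {..n}. X k n = a} \<subseteq> {k. \<forall>j<Suc n. X k j = (xs @ [a]) ! j}"
      using Q by (auto simp: Q_def nth_append less_Suc_eq)
    then have "Q (Suc n) (xs @ [a])"
      using a Q unfolding Q_def by (auto dest: finite_subset)
    then show "\<exists>ys. Q (Suc n) ys \<and> (\<exists>a. ys = xs @ [a])" by blast
  qed
  then obtain f where Q: "\<And>n. Q n (f n)" and ext: "\<And>n. \<exists>a. f (Suc n) = f n @ [a]"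
    by blast
  have len: "length (f n) = n" for n using Q by (simp add: Q_def)
  have pre: "f m ! j = f (Suc j) ! j" if "j < m" for j m
    using that
  proof (induction m)
    case (Suc m)
    then show ?case
      using ext[of m] len[of m] by (cases "j = m") (auto simp: nth_append)
  qed simp
  show thesis
  proof (rule that[of "\<lambda>j. f (Suc j) ! j"])
    fix d m
    have "infinite {k. \<forall>j<d. X k j = f d ! j}" using Q[of d] by (simp add: Q_def)
    then obtain k where "k \<ge> m" "\<forall>j<d. X k j = f d ! j"
      unfolding infinite_nat_iff_unbounded_le by blast
    then show "\<exists>k\<ge>m. agree_upto d (X k) (\<lambda>j. f (Suc j) ! j)"
      unfolding agree_upto_def by (intro exI[of _ k]) (auto simp: pre[of _ d])
  qed
qed

text \<open>
  The Lusin-Sierpinski theorem, by Choquet's argument. The outer measure is continuous along increasing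
  sequences, so the coordinates of \<open>x\<close> can be bounded one after the other without letting the outer
  measure fall to \<open>c\<close>. Under such bounds only finitely many prefixes matter, and Koenig's lemma shows
  that a decreasing sequence of measurable sets of mass at least \<open>c\<close> has its intersection inside the given
  set. Inner and outer measure therefore agree, and completeness gives measurability.
\<close>

lemma sets_Suslin_operation:
  fixes K :: "nat \<Rightarrow> (nat \<Rightarrow> nat) \<Rightarrow> 'w set"
  assumes "finite_measure M" "complete_measure M"
    and K: "\<And>n x. K n x \<in> sets M"
    and dep: "\<And>n. \<exists>d. \<forall>x y. agree_upto d x y \<longrightarrow> K n x = K n y"
  shows "{\<omega>. \<exists>x. \<forall>n. \<omega> \<in> K n x} \<in> sets M" (is "?S \<in> _")
proof -
  interpret finite_measure M by fact
  interpret complete_measure M by fact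
  obtain d where d: "\<And>n x y. agree_upto (d n) x y \<Longrightarrow> K n x = K n y"
    using dep by metis
  have space: "\<omega> \<in> space M" if "\<omega> \<in> K n x" for \<omega> n x
    using K that sets.sets_into_space by blast
  define B where "B xs = {\<omega>. \<exists>x. (\<forall>j<length xs. x j \<le> xs ! j) \<and> (\<forall>n. \<omega> \<in> K n x)}" for xs
  have B_space: "B xs \<subseteq> space M" for xs unfolding B_def using space by blast
  have inner: "\<exists>T\<in>sets M. T \<subseteq> ?S \<and> c \<le> emeasure M T" if c: "c < outer_measure_of M ?S" for c
  proof -
    define Q where "Q n xs \<longleftrightarrow> length xs = n \<and> c < outer_measure_of M (B xs)" for n xs
    have "\<exists>f. \<forall>n. Q n (f n) \<and> (\<exists>a. f (Suc n) = f n @ [a])"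
    proof (rule dependent_nat_choice)
      show "\<exists>xs. Q 0 xs" using c by (auto simp: Q_def B_def)
    next
      fix xs n assume Q: "Q n xs"
      have "(\<Union>a. B (xs @ [a])) = B xs"
        using Q by (auto simp: B_def Q_def nth_append less_Suc_eq)
      moreover have "(SUP a. outer_measure_of M (B (xs @ [a]))) = outer_measure_of M (\<Union>a. B (xs @ [a]))"
      proof (rule SUP_outer_measure_of_incseq)
        show "incseq (\<lambda>a. B (xs @ [a]))"
        proof (intro incseq_SucI subsetI)
          fix a \<omega> assume "\<omega> \<in> B (xs @ [a])"
          then obtain x where x: "\<forall>j<length (xs @ [a]). x j \<le> (xs @ [a]) ! j" "\<forall>n. \<omega> \<in> K n x"
            unfolding B_def by blast
          have "x j \<le> (xs @ [Suc a]) ! j" if "j < length (xs @ [Suc a])" for j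
            using x(1)[rule_format, of j] that by (auto simp: nth_append less_Suc_eq)
          then show "\<omega> \<in> B (xs @ [Suc a])" unfolding B_def using x(2) by blast
        qed
      qed (rule B_space)
      ultimately have "c < (SUP a. outer_measure_of M (B (xs @ [a])))"
        using Q by (simp add: Q_def)
      then obtain a where "c < outer_measure_of M (B (xs @ [a]))"
        unfolding less_SUP_iff by blast
      then have "Q (Suc n) (xs @ [a])" using Q by (simp add: Q_def)
      then show "\<exists>ys. Q (Suc n) ys \<and> (\<exists>a. ys = xs @ [a])" by blast
    qed
    then obtain f where Q: "\<And>n. Q n (f n)" and ext: "\<And>n. \<exists>a. f (Suc n) = f n @ [a]"
      by blast
    have len: "length (f n) = n" for n using Q by (simp add: Q_def)
    define N where "N j = f (Suc j) ! j" for j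
    have pre: "f m ! j = N j" if "j < m" for j m
      using that
    proof (induction m)
      case (Suc m)
      then show ?case
        using ext[of m] len[of m] by (cases "j = m") (auto simp: nth_append N_def)
    qed simp
    define C where "C k = {\<omega>\<in>space M. \<exists>x. (\<forall>j<k. x j \<le> N j) \<and> (\<forall>n<k. d n \<le> k \<longrightarrow> \<omega> \<in> K n x)}" for k
    have C_eq: "C k = (\<Union>x\<in>{x. (\<forall>j<k. x j \<le> N j) \<and> (\<forall>j\<ge>k. x j = 0)}.
        {\<omega>\<in>space M. \<forall>n\<in>{n\<in>{..<k}. d n \<le> k}. \<omega> \<in> K n x})" (is "_ = ?R") for k
    proof
      show "C k \<subseteq> ?R"
      proof
        fix \<omega> assume "\<omega> \<in> C k"
        then obtain x where x: "\<omega> \<in> space M" "\<forall>j<k. x j \<le> N j" "\<forall>n<k. d n \<le> k \<longrightarrow> \<omega> \<in> K n x"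
          unfolding C_def by blast
        define x' where "x' j = (if j < k then x j else 0)" for j
        have "K n x' = K n x" if "d n \<le> k" for n
          by (rule d) (use that in \<open>auto simp: agree_upto_def x'_def\<close>)
        then show "\<omega> \<in> ?R"
          using x by (intro UN_I[of x']) (auto simp: x'_def)
      qed
    qed (auto simp: C_def)
    have C_sets: "C k \<in> sets M" for k
      unfolding C_eq
    proof (rule sets.finite_UN[OF finite_bounded_prefixes])
      fix x
      have "{\<omega>\<in>space M. \<forall>n\<in>{n\<in>{..<k}. d n \<le> k}. \<omega> \<in> K n x} \<in> sets M"
        by (rule sets.sets_Collect_finite_All) (auto intro!: measurable_sets K simp: Collect_conj_eq sets.Int)
      then show "{\<omega>\<in>space M. \<forall>n\<in>{n\<in>{..<k}. d n \<le> k}. \<omega> \<in> K n x} \<in> sets M" .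
    qed
    have C_dec: "decseq C"
      unfolding decseq_Suc_iff C_def by (auto intro: less_SucI le_SucI)
    have "c \<le> emeasure M (C k)" for k
    proof -
      have "B (f k) \<subseteq> C k"
      proof
        fix \<omega> assume "\<omega> \<in> B (f k)"
        then obtain x where x: "\<forall>j<k. x j \<le> f k ! j" "\<forall>n. \<omega> \<in> K n x"
          unfolding B_def len by blast
        have "\<forall>j<k. x j \<le> N j" using x(1) pre[of _ k] by simp
        then show "\<omega> \<in> C k" unfolding C_def using x(2) space by blast
      qed
      then have "outer_measure_of M (B (f k)) \<le> emeasure M (C k)"
        using outer_measure_of_mono[of "B (f k)" "C k" M] C_sets by simp
      then show ?thesis using Q[of k] by (auto simp: Q_def)
    qed
    then have "c \<le> (INF k. emeasure M (C k))" by (auto intro: INF_greatest)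
    also have "\<dots> = emeasure M (\<Inter>k. C k)"
      using C_sets C_dec by (intro INF_emeasure_decseq) auto
    finally have "c \<le> emeasure M (\<Inter>k. C k)" .
    moreover have "(\<Inter>k. C k) \<subseteq> ?S"
    proof
      fix \<omega> assume "\<omega> \<in> (\<Inter>k. C k)"
      then have "\<forall>k. \<exists>x. (\<forall>j<k. x j \<le> N j) \<and> (\<forall>n<k. d n \<le> k \<longrightarrow> \<omega> \<in> K n x)"
        unfolding C_def by blast
      then obtain X where X: "\<And>k j. j < k \<Longrightarrow> X k j \<le> N j"
          "\<And>k n. n < k \<Longrightarrow> d n \<le> k \<Longrightarrow> \<omega> \<in> K n (X k)"
        by metis
      obtain x where x: "\<And>d m. \<exists>k\<ge>m. agree_upto d (X k) x"
        using bounded_sequences_cluster_point[of X N] X(1) by metis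
      have "\<omega> \<in> K n x" for n
      proof -
        obtain k where k: "k \<ge> max (Suc n) (d n)" "agree_upto (d n) (X k) x"
          using x by blast
        then show ?thesis using X(2)[of n k] d[OF k(2)] by auto
      qed
      then show "\<omega> \<in> ?S" by blast
    qed
    ultimately show ?thesis using C_sets by (intro bexI[of _ "\<Inter>k. C k"]) auto
  qed
  have S_space: "?S \<subseteq> space M" using space by blast
  obtain E where E: "E \<in> sets M" "?S \<subseteq> E" "outer_measure_of M ?S = emeasure M E"
    using outer_measure_of_attain[OF S_space] by blast
  show ?thesis
  proof (cases "emeasure M E = 0")
    case True
    then show ?thesis using E complete[of ?S E] by (auto simp: null_sets_def)
  next
    case False
    define e where "e = measure M E"
    have e: "e > 0" "emeasure M E = ennreal e"
      using False by (auto simp: e_def emeasure_eq_measure less_le)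
    have "\<exists>T. \<forall>i. T i \<in> sets M \<and> T i \<subseteq> ?S \<and> ennreal (e - e / Suc i) \<le> emeasure M (T i)"
    proof (intro choice allI)
      fix i
      have "ennreal (e - e / Suc i) < outer_measure_of M ?S"
        using e E by (simp add: ennreal_less_iff field_simps)
      then show "\<exists>T. T \<in> sets M \<and> T \<subseteq> ?S \<and> ennreal (e - e / Suc i) \<le> emeasure M T"
        using inner by blast
    qed
    then obtain T where T: "\<And>i. T i \<in> sets M" "\<And>i. T i \<subseteq> ?S"
        "\<And>i. ennreal (e - e / Suc i) \<le> emeasure M (T i)"
      by blast
    let ?U = "\<Union>i. T i"
    have "e - e / Suc i \<le> measure M ?U" for i
    proof -
      have "ennreal (e - e / Suc i) \<le> emeasure M ?U"
        using T by (intro order_trans[OF T(3) emeasure_mono]) auto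
      then show ?thesis by (simp add: emeasure_eq_measure)
    qed
    moreover have "(\<lambda>i. e - e / Suc i) \<longlonglongrightarrow> e - 0"
      by (intro tendsto_intros LIMSEQ_Suc[OF lim_const_over_n])
    ultimately have "e - 0 \<le> measure M ?U"
      by (intro LIMSEQ_le_const2) auto
    then have "emeasure M E \<le> emeasure M ?U"
      unfolding e(2) by (simp add: emeasure_eq_measure)
    moreover have "emeasure M ?U \<le> emeasure M E"
      using E T(2) by (intro emeasure_mono) blast+
    ultimately have "emeasure M ?U = emeasure M E" by simp
    moreover have "?U \<in> sets M" using T(1) by (intro sets.countable_UN) blast
    moreover have "?U \<subseteq> ?S" using T(2) by (intro UN_least)
    moreover have "emeasure M ?U < \<infinity>" using emeasure_finite[of ?U] by (simp only: less_top infinity_ennreal_def)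
    ultimately show ?thesis
      using E(1,2) complete_sets_sandwich[of ?U E ?S] by simp
  qed
qed

text \<open>
  Families for the Suslin operation with a parameter \<open>t\<close> in Baire space. Each member may look at finitely
  many coordinates of \<open>t\<close> and of the operation's variable \<open>x\<close>; admitting an arbitrary finite number in
  place of the first \<open>n\<close> keeps the closure proofs free of index arithmetic.
\<close>

definition Suslin_family ::
  "'w measure \<Rightarrow> (nat \<Rightarrow> (nat \<Rightarrow> nat) \<Rightarrow> (nat \<Rightarrow> nat) \<Rightarrow> 'w set) \<Rightarrow> bool" where
  "Suslin_family M K \<longleftrightarrow> (\<forall>n t x. K n t x \<in> sets M) \<and>
     (\<exists>d. \<forall>n t x t' x'. agree_upto (d n) t t' \<and> agree_upto (d n) x x' \<longrightarrow> K n t x = K n t' x')"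

definition Suslin_set :: "'w measure \<Rightarrow> ((nat \<Rightarrow> nat) \<times> 'w) set \<Rightarrow> bool" where
  "Suslin_set M A \<longleftrightarrow> (\<exists>K. Suslin_family M K \<and> A = {(t, \<omega>). \<exists>x. \<forall>n. \<omega> \<in> K n t x})"

lemma Suslin_setI:
  fixes K :: "nat \<Rightarrow> (nat \<Rightarrow> nat) \<Rightarrow> (nat \<Rightarrow> nat) \<Rightarrow> 'w set"
  assumes "\<And>n t x. K n t x \<in> sets M"
    and "\<And>n. \<exists>d. \<forall>t x t' x'. agree_upto d t t' \<and> agree_upto d x x' \<longrightarrow> K n t x = K n t' x'"
    and "\<And>t \<omega>. (t, \<omega>) \<in> A \<longleftrightarrow> (\<exists>x. \<forall>n. \<omega> \<in> K n t x)"
  shows "Suslin_set M A"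
proof -
  have "\<exists>d. \<forall>n. \<forall>t x t' x'. agree_upto (d n) t t' \<and> agree_upto (d n) x x' \<longrightarrow> K n t x = K n t' x'"
    using assms(2) by (intro choice allI)
  then have "Suslin_family M K" using assms(1) by (simp add: Suslin_family_def)
  then show ?thesis unfolding Suslin_set_def using assms(3) by (intro exI[of _ K]) auto
qed

text \<open>
  The first coordinate of \<open>x\<close> chooses the member of the union. Each index \<open>\<langle>i, m\<rangle>\<close> imposes a condition
  only if \<open>i\<close> was chosen; otherwise the number of coordinates used would depend on \<open>x\<close>.
\<close>

lemma Suslin_set_UN:
  assumes "\<And>i::nat. Suslin_set M (A i)"
  shows "Suslin_set M (\<Union>i. A i)"
proof -
  obtain K where K: "\<And>i. Suslin_family M (K i)" "\<And>i. A i = {(t, \<omega>). \<exists>x. \<forall>n. \<omega> \<in> K i n t x}"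
  proof -
    have "\<exists>K. \<forall>i. Suslin_family M (K i) \<and> A i = {(t, \<omega>). \<exists>x. \<forall>n. \<omega> \<in> K i n t x}"
      using assms unfolding Suslin_set_def by (intro choice allI)
    then show thesis using that by blast
  qed
  have "\<exists>d. \<forall>i. \<forall>n t x t' x'. agree_upto (d i n) t t' \<and> agree_upto (d i n) x x' \<longrightarrow>
      K i n t x = K i n t' x'"
    by (rule choice) (use K(1) in \<open>simp add: Suslin_family_def\<close>)
  then obtain d where d: "\<And>i n t x t' x'. agree_upto (d i n) t t' \<Longrightarrow> agree_upto (d i n) x x'
      \<Longrightarrow> K i n t x = K i n t' x'"
    by blast
  have space: "\<omega> \<in> space M" if "\<omega> \<in> K i n t x" for \<omega> i n t x
    using K(1) that sets.sets_into_space unfolding Suslin_family_def by blast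
  define K' where "K' = (\<lambda>(i, n) t x. if x 0 = i then K i n t (\<lambda>j. x (Suc j)) else space M)"
  have K'_iff: "(\<forall>n. \<omega> \<in> K' (prod_decode n) t x) \<longleftrightarrow> (\<forall>n. \<omega> \<in> K (x 0) n t (\<lambda>j. x (Suc j)))" for \<omega> t x
  proof
    assume *: "\<forall>n. \<omega> \<in> K' (prod_decode n) t x"
    show "\<forall>n. \<omega> \<in> K (x 0) n t (\<lambda>j. x (Suc j))"
    proof
      fix n show "\<omega> \<in> K (x 0) n t (\<lambda>j. x (Suc j))"
        using *[rule_format, of "prod_encode (x 0, n)"] by (simp add: K'_def)
    qed
  qed (auto simp: K'_def split: prod.split intro: space)
  show ?thesis
  proof (rule Suslin_setI[where K = "\<lambda>n. K' (prod_decode n)"])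
    show "K' (prod_decode n) t x \<in> sets M" for n t x
      using K(1) by (simp add: Suslin_family_def K'_def split: prod.split)
  next
    fix n
    obtain i m where n: "prod_decode n = (i, m)" by fastforce
    have "K' (prod_decode n) t x = K' (prod_decode n) t' x'"
      if "agree_upto (Suc (d i m)) t t'" "agree_upto (Suc (d i m)) x x'" for t t' x x'
    proof -
      have "x 0 = x' 0" using that by (simp add: agree_upto_def)
      moreover have "K i m t (\<lambda>j. x (Suc j)) = K i m t' (\<lambda>j. x' (Suc j))"
        by (rule d) (use that in \<open>auto simp: agree_upto_def\<close>)
      ultimately show ?thesis by (simp add: K'_def n)
    qed
    then show "\<exists>d. \<forall>t x t' x'. agree_upto d t t' \<and> agree_upto d x x' \<longrightarrow>
        K' (prod_decode n) t x = K' (prod_decode n) t' x'"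
      by blast
  next
    fix t \<omega>
    have "(\<exists>x. \<forall>n. \<omega> \<in> K (x 0) n t (\<lambda>j. x (Suc j))) \<longleftrightarrow> (\<exists>i x. \<forall>n. \<omega> \<in> K i n t x)"
    proof
      assume "\<exists>i x. \<forall>n. \<omega> \<in> K i n t x"
      then obtain i x where "\<forall>n. \<omega> \<in> K i n t x" by blast
      then show "\<exists>x. \<forall>n. \<omega> \<in> K (x 0) n t (\<lambda>j. x (Suc j))"
        by (intro exI[of _ "case_nat i x"]) simp
    qed blast
    then show "(t, \<omega>) \<in> (\<Union>i. A i) \<longleftrightarrow> (\<exists>x. \<forall>n. \<omega> \<in> K' (prod_decode n) t x)"
      unfolding K'_iff using K(2) by auto
  qed
qed

text \<open>
  One sequence \<open>x\<close> encodes a sequence of sequences, the \<open>i\<close>-th being a witness for the \<open>i\<close>-th set.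
\<close>

lemma Suslin_set_INT:
  assumes "\<And>i::nat. Suslin_set M (A i)"
  shows "Suslin_set M (\<Inter>i. A i)"
proof -
  obtain K where K: "\<And>i. Suslin_family M (K i)" "\<And>i. A i = {(t, \<omega>). \<exists>x. \<forall>n. \<omega> \<in> K i n t x}"
  proof -
    have "\<exists>K. \<forall>i. Suslin_family M (K i) \<and> A i = {(t, \<omega>). \<exists>x. \<forall>n. \<omega> \<in> K i n t x}"
      using assms unfolding Suslin_set_def by (intro choice allI)
    then show thesis using that by blast
  qed
  have "\<exists>d. \<forall>i. \<forall>n t x t' x'. agree_upto (d i n) t t' \<and> agree_upto (d i n) x x' \<longrightarrow>
      K i n t x = K i n t' x'"
    by (rule choice) (use K(1) in \<open>simp add: Suslin_family_def\<close>)
  then obtain d where d: "\<And>i n t x t' x'. agree_upto (d i n) t t' \<Longrightarrow> agree_upto (d i n) x x'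
      \<Longrightarrow> K i n t x = K i n t' x'"
    by blast
  define K' where "K' = (\<lambda>(i, n) t x. K i n t (\<lambda>j. x (prod_encode (i, j))))"
  have K'_iff: "(\<forall>n. \<omega> \<in> K' (prod_decode n) t x) \<longleftrightarrow>
      (\<forall>i n. \<omega> \<in> K i n t (\<lambda>j. x (prod_encode (i, j))))" for \<omega> t x
  proof
    assume *: "\<forall>n. \<omega> \<in> K' (prod_decode n) t x"
    show "\<forall>i n. \<omega> \<in> K i n t (\<lambda>j. x (prod_encode (i, j)))"
    proof (intro allI)
      fix i n show "\<omega> \<in> K i n t (\<lambda>j. x (prod_encode (i, j)))"
        using *[rule_format, of "prod_encode (i, n)"] by (simp add: K'_def)
    qed
  qed (auto simp: K'_def split: prod.split)
  show ?thesis
  proof (rule Suslin_setI[where K = "\<lambda>n. K' (prod_decode n)"])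
    show "K' (prod_decode n) t x \<in> sets M" for n t x
      using K(1) by (simp add: Suslin_family_def K'_def split: prod.split)
  next
    fix n
    obtain i m where n: "prod_decode n = (i, m)" by fastforce
    define D where "D = d i m + Suc (Max ((\<lambda>j. prod_encode (i, j)) ` {..<d i m} \<union> {0}))"
    have D: "prod_encode (i, j) < D" if "j < d i m" for j
      unfolding D_def using that by (intro trans_less_add2 le_imp_less_Suc Max_ge) auto
    have "K' (prod_decode n) t x = K' (prod_decode n) t' x'"
      if "agree_upto D t t'" "agree_upto D x x'" for t t' x x'
      unfolding n K'_def prod.case
      by (rule d) (use that D in \<open>auto simp: agree_upto_def D_def\<close>)
    then show "\<exists>d. \<forall>t x t' x'. agree_upto d t t' \<and> agree_upto d x x' \<longrightarrow>
        K' (prod_decode n) t x = K' (prod_decode n) t' x'"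
      by blast
  next
    fix t \<omega>
    have "(\<exists>x. \<forall>i n. \<omega> \<in> K i n t (\<lambda>j. x (prod_encode (i, j)))) \<longleftrightarrow> (\<forall>i. \<exists>x. \<forall>n. \<omega> \<in> K i n t x)"
    proof
      assume "\<forall>i. \<exists>x. \<forall>n. \<omega> \<in> K i n t x"
      then obtain x where "\<And>i n. \<omega> \<in> K i n t (x i)" by metis
      then show "\<exists>x. \<forall>i n. \<omega> \<in> K i n t (\<lambda>j. x (prod_encode (i, j)))"
        by (intro exI[of _ "\<lambda>k. case prod_decode k of (i, j) \<Rightarrow> x i j"]) simp
    qed blast
    then show "(t, \<omega>) \<in> (\<Inter>i. A i) \<longleftrightarrow> (\<exists>x. \<forall>n. \<omega> \<in> K' (prod_decode n) t x)"
      unfolding K'_iff using K(2) by auto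
  qed
qed

lemma Suslin_set_coordinate:
  assumes "\<And>a. B a \<in> sets M"
  shows "Suslin_set M {(t, \<omega>). \<omega> \<in> B (t i)}"
proof (rule Suslin_setI[where K = "\<lambda>n t x. B (t i)"])
  show "\<exists>d. \<forall>t x t' x'. agree_upto d t t' \<and> agree_upto d x x' \<longrightarrow> B (t i) = B (t' i)"
    by (rule exI[of _ "Suc i"]) (auto simp: agree_upto_def)
qed (use assms in auto)

text \<open>
  The complement is included because Suslin sets need not be closed under complements; this makes the
  class a \<open>\<sigma>\<close>-algebra.
\<close>

definition bi_Suslin :: "'w measure \<Rightarrow> ((nat \<Rightarrow> nat) \<times> 'w) set \<Rightarrow> bool" where
  "bi_Suslin M A \<longleftrightarrow> A \<subseteq> UNIV \<times> space M \<and> Suslin_set M A \<and> Suslin_set M (UNIV \<times> space M - A)"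

lemma sigma_algebra_bi_Suslin: "sigma_algebra (UNIV \<times> space M) {A. bi_Suslin M A}"
  unfolding sigma_algebra_iff2
proof (intro conjI ballI allI impI CollectI subsetI)
  have "{(t::nat \<Rightarrow> nat, \<omega>). \<omega> \<in> space M} = UNIV \<times> space M" by auto
  then show "bi_Suslin M ({} :: ((nat \<Rightarrow> nat) \<times> _) set)"
    using Suslin_set_coordinate[of "\<lambda>_. {}" M 0] Suslin_set_coordinate[of "\<lambda>_. space M" M 0]
    by (simp add: bi_Suslin_def)
next
  fix A assume "A \<in> {A. bi_Suslin M A}"
  then have "UNIV \<times> space M - (UNIV \<times> space M - A) = A" by (auto simp: bi_Suslin_def)
  then show "bi_Suslin M (UNIV \<times> space M - A)"
    using \<open>A \<in> _\<close> unfolding bi_Suslin_def by auto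
next
  fix A :: "nat \<Rightarrow> _" assume A: "range A \<subseteq> {A. bi_Suslin M A}"
  have "UNIV \<times> space M - (\<Union>i. A i) = (\<Inter>i. UNIV \<times> space M - A i)" by auto
  moreover have "Suslin_set M (\<Inter>i. UNIV \<times> space M - A i)" "Suslin_set M (\<Union>i. A i)"
    using A by (intro Suslin_set_INT Suslin_set_UN; auto simp: bi_Suslin_def)+
  moreover have "(\<Union>i. A i) \<subseteq> UNIV \<times> space M" using A by (auto simp: bi_Suslin_def)
  ultimately show "bi_Suslin M (\<Union>i. A i)" by (simp add: bi_Suslin_def)
qed (auto simp: bi_Suslin_def)

text \<open>
  The existential quantifier over the parameter \<open>t\<close> is absorbed into the one over \<open>x\<close> by interleaving.
\<close>

lemma projection_Suslin_set:
  assumes "finite_measure M" "complete_measure M" "Suslin_set M A"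
  shows "snd ` A \<in> sets M"
proof -
  obtain K where K: "Suslin_family M K" "A = {(t, \<omega>). \<exists>x. \<forall>n. \<omega> \<in> K n t x}"
    using assms(3) unfolding Suslin_set_def by blast
  let ?L = "\<lambda>n x. K n (\<lambda>j. x (2 * j)) (\<lambda>j. x (Suc (2 * j)))"
  have "snd ` A = {\<omega>. \<exists>x. \<forall>n. \<omega> \<in> ?L n x}"
  proof (intro set_eqI iffI)
    fix \<omega> assume "\<omega> \<in> snd ` A"
    then obtain t x where "\<forall>n. \<omega> \<in> K n t x" unfolding K(2) by auto
    then show "\<omega> \<in> {\<omega>. \<exists>x. \<forall>n. \<omega> \<in> ?L n x}"
      by (intro CollectI exI[of _ "\<lambda>k. if even k then t (k div 2) else x (k div 2)"]) simp
  qed (auto simp: K(2) image_iff)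
  also have "\<dots> \<in> sets M"
  proof (rule sets_Suslin_operation[OF assms(1,2)])
    fix n
    obtain d where d: "\<And>t x t' x'. agree_upto d t t' \<Longrightarrow> agree_upto d x x' \<Longrightarrow> K n t x = K n t' x'"
      using K(1) unfolding Suslin_family_def by blast
    show "\<exists>d. \<forall>x y. agree_upto d x y \<longrightarrow> ?L n x = ?L n y"
      by (intro exI[of _ "2 * d"] allI impI d) (auto simp: agree_upto_def)
  qed (use K(1) in \<open>simp add: Suslin_family_def\<close>)
  finally show ?thesis .
qed

text \<open>
  A measurable surjection of Baire space onto the reals: limits of sequences of enumerated rationals.
\<close>

definition real_of_seq :: "(nat \<Rightarrow> nat) \<Rightarrow> real" where
  "real_of_seq x = lim (\<lambda>n. real_of_rat (from_nat (x n)))"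

lemma surj_real_of_seq: "surj real_of_seq"
proof (rule surjI)
  fix a :: real
  have "\<exists>q. real_of_rat q \<in> {a - 1 / Suc n<..<a + 1 / Suc n}" for n
    using of_rat_dense[of "a - 1 / Suc n" "a + 1 / Suc n"] by (auto simp: field_simps)
  then obtain q where q: "\<And>n. real_of_rat (q n) \<in> {a - 1 / Suc n<..<a + 1 / Suc n}" by metis
  have "(\<lambda>n. real_of_rat (q n)) \<longlonglongrightarrow> a"
  proof (rule tendsto_sandwich)
    have "(\<lambda>n. a - 1 / Suc n) \<longlonglongrightarrow> a - 0" "(\<lambda>n. a + 1 / Suc n) \<longlonglongrightarrow> a + 0"
      by (intro tendsto_intros LIMSEQ_Suc[OF lim_const_over_n])+
    then show "(\<lambda>n. a - 1 / Suc n) \<longlonglongrightarrow> a" "(\<lambda>n. a + 1 / Suc n) \<longlonglongrightarrow> a"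
      by simp_all
  qed (use q in \<open>auto intro!: always_eventually less_imp_le\<close>)
  then have "\<exists>x. real_of_seq x = a"
    unfolding real_of_seq_def by (intro exI[of _ "\<lambda>n. to_nat (q n)"]) (simp add: limI)
  then show "real_of_seq (SOME x. real_of_seq x = a) = a" by (rule someI_ex)
qed

text \<open>
  Pulling back along the surjection from Baire space replaces the real coordinate by a sequence. The
  bi-Suslin sets form a \<open>\<sigma>\<close>-algebra for which all coordinates of the sequence and \<open>\<omega>\<close> are measurable, so
  they contain the pulled-back set, whose projection is the same.
\<close>

theorem measurable_projection:
  fixes A :: "(real \<times> 'w) set"
  assumes "finite_measure M" "complete_measure M" and A: "A \<in> sets (borel \<Otimes>\<^sub>M M)"
  shows "snd ` A \<in> sets M"
proof -
  define Q where "Q = sigma (UNIV \<times> space M) {A. bi_Suslin M A}"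
  have space_Q [simp]: "space Q = UNIV \<times> space M"
    unfolding Q_def by (rule space_measure_of) (auto simp: bi_Suslin_def)
  have sets_Q: "sets Q = {A. bi_Suslin M A}"
    unfolding Q_def by (rule sigma_algebra.sets_measure_of_eq[OF sigma_algebra_bi_Suslin])
  have rect: "bi_Suslin M {(t, \<omega>). \<omega> \<in> B (t i)}"
    if B: "\<And>a. B a \<in> sets M" for B :: "nat \<Rightarrow> 'w set" and i :: nat
  proof -
    have "UNIV \<times> space M - {(t, \<omega>). \<omega> \<in> B (t i)} = {(t, \<omega>). \<omega> \<in> space M - B (t i)}" by auto
    then show ?thesis
      unfolding bi_Suslin_def using Suslin_set_coordinate[of B M i] B
        Suslin_set_coordinate[of "\<lambda>a. space M - B a" M i]
      by (auto dest: sets.sets_into_space[OF B, THEN subsetD])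
  qed
  have [measurable]: "(\<lambda>(t, \<omega>). t i) \<in> measurable Q (count_space UNIV)" for i
  proof (subst measurable_count_space_eq2_countable, intro conjI ballI)
    fix a :: nat
    have "(\<lambda>(t, \<omega>). t i) -` {a} \<inter> space Q = {(t, \<omega>). \<omega> \<in> (if t i = a then space M else {})}"
      by (auto split: if_splits)
    then show "(\<lambda>(t, \<omega>). t i) -` {a} \<inter> space Q \<in> sets Q"
      using rect[of "\<lambda>b. if b = a then space M else {}" i] by (simp add: sets_Q)
  qed auto
  have [measurable]: "snd \<in> measurable Q M"
  proof (rule measurableI)
    fix B assume "B \<in> sets M"
    moreover from this have "snd -` B \<inter> space Q = {(t, \<omega>). \<omega> \<in> B}"
      by (auto dest: sets.sets_into_space)
    ultimately show "snd -` B \<inter> space Q \<in> sets Q"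
      using rect[of "\<lambda>_. B"] by (simp add: sets_Q)
  qed auto
  define h where "h = (\<lambda>(t, \<omega>::'w). (real_of_seq t, \<omega>))"
  have "(\<lambda>x. real_of_rat (from_nat ((\<lambda>(t, \<omega>). t i) x))) \<in> borel_measurable Q" for i
    by (rule measurable_compose[of "\<lambda>(t, \<omega>). t i" Q "count_space UNIV"]) auto
  then have "(\<lambda>(t, \<omega>::'w). real_of_seq t) \<in> borel_measurable Q"
    unfolding real_of_seq_def by (simp add: split_beta' borel_measurable_lim_metric)
  then have h: "h \<in> measurable Q (borel \<Otimes>\<^sub>M M)"
    unfolding h_def by (intro measurable_Pair[of "\<lambda>(t, \<omega>). real_of_seq t" Q borel snd M, simplified split_beta'] |
      simp add: split_beta')+
  have "h -` A \<inter> space Q \<in> sets Q" by (rule measurable_sets[OF h A])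
  then have "snd ` (h -` A \<inter> space Q) \<in> sets M"
    using projection_Suslin_set[OF assms(1,2)] by (simp add: sets_Q bi_Suslin_def)
  also have "snd ` (h -` A \<inter> space Q) = snd ` A"
  proof
    show "snd ` A \<subseteq> snd ` (h -` A \<inter> space Q)"
    proof
      fix \<omega> assume "\<omega> \<in> snd ` A"
      then obtain a where *: "(a, \<omega>) \<in> A" by auto
      obtain x where "a = real_of_seq x" using surj_real_of_seq by (metis surjE)
      moreover have "\<omega> \<in> space M"
        using sets.sets_into_space[OF A] * by (auto simp: space_pair_measure)
      ultimately show "\<omega> \<in> snd ` (h -` A \<inter> space Q)"
        using * by (intro image_eqI[of _ _ "(x, \<omega>)"]) (auto simp: h_def)
    qed
  qed (force simp: h_def)
  finally show ?thesis .
qed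

section \<open>Joint measurability of processes\<close>

text \<open>
  The event that the supremum exceeds \<open>c\<close> is the projection of a measurable set.
\<close>

lemma measurable_SUP_random_set:
  fixes f :: "real \<Rightarrow> 'w \<Rightarrow> real"
  assumes "finite_measure M" "complete_measure M"
    and f [measurable]: "(\<lambda>(t, \<omega>). f t \<omega>) \<in> borel_measurable (borel \<Otimes>\<^sub>M M)"
    and S [measurable]: "S \<in> sets borel" "S \<noteq> {}"
    and bdd: "\<And>\<omega>. \<omega> \<in> space M \<Longrightarrow> bdd_above ((\<lambda>t. f t \<omega>) ` S)"
  shows "(\<lambda>\<omega>. SUP t\<in>S. f t \<omega>) \<in> borel_measurable M"
proof (rule borel_measurable_iff_greater[THEN iffD2], rule allI)
  fix c
  let ?A = "{x \<in> space (borel \<Otimes>\<^sub>M M). fst x \<in> S \<and> c < (\<lambda>(t, \<omega>). f t \<omega>) x}"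
  have "{\<omega> \<in> space M. c < (SUP t\<in>S. f t \<omega>)} = {\<omega> \<in> space M. \<exists>t\<in>S. c < f t \<omega>}"
    by (intro Collect_cong conj_cong refl less_cSUP_iff S(2) bdd)
  also have "\<dots> = snd ` ?A"
    by (force simp: space_pair_measure)
  also have "\<dots> \<in> sets M"
    by (rule measurable_projection[OF assms(1,2)]) measurable
  finally show "{\<omega> \<in> space M. c < (SUP t\<in>S. f t \<omega>)} \<in> sets M" .
qed

text \<open>
  The path is the limit of its values at the grid points strictly to the right of \<open>t\<close>. Time is cut off
  at \<open>0\<close> because values at negative times are arbitrary.
\<close>

lemma right_continuous_jointly_measurable:
  fixes X :: "real \<Rightarrow> 'w \<Rightarrow> real"
  assumes X: "\<And>t. 0 \<le> t \<Longrightarrow> X t \<in> borel_measurable M"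
    and rc: "\<And>t \<omega>. \<omega> \<in> space M \<Longrightarrow> 0 \<le> t \<Longrightarrow> ((\<lambda>s. X s \<omega>) \<longlongrightarrow> X t \<omega>) (at_right t)"
  shows "(\<lambda>(t, \<omega>). X (max 0 t) \<omega>) \<in> borel_measurable (borel \<Otimes>\<^sub>M M)"
proof (rule borel_measurable_LIMSEQ_real)
  let ?k = "\<lambda>n (t::real). nat \<lfloor>max 0 t * real (Suc n)\<rfloor>"
  let ?g = "\<lambda>n t. real (Suc (?k n t)) / real (Suc n)"
  fix n
  have "(\<lambda>x. X (real (Suc k) / real (Suc n)) (snd x)) \<in> borel_measurable (borel \<Otimes>\<^sub>M M)" for k :: nat
    by (rule measurable_compose[OF measurable_snd X]) simp
  moreover have "(\<lambda>x. ?k n (fst x)) \<in> measurable (borel \<Otimes>\<^sub>M M) (count_space UNIV)"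
    by measurable
  ultimately show "(\<lambda>x. X (?g n (fst x)) (snd x)) \<in> borel_measurable (borel \<Otimes>\<^sub>M M)"
    by (rule measurable_compose_countable)
next
  let ?k = "\<lambda>n (t::real). nat \<lfloor>max 0 t * real (Suc n)\<rfloor>"
  let ?g = "\<lambda>n t. real (Suc (?k n t)) / real (Suc n)"
  fix x :: "real \<times> 'w" assume "x \<in> space (borel \<Otimes>\<^sub>M M)"
  then obtain t \<omega> where x: "x = (t, \<omega>)" "\<omega> \<in> space M"
    by (auto simp: space_pair_measure)
  have g: "max 0 t < ?g n t" "?g n t \<le> max 0 t + 1 / real (Suc n)" for n
  proof -
    define a where "a = max 0 t * real (Suc n)"
    have "0 \<le> a" by (simp add: a_def)
    then have "real (Suc (nat \<lfloor>a\<rfloor>)) = of_int \<lfloor>a\<rfloor> + 1" by simp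
    then have "a < real (Suc (nat \<lfloor>a\<rfloor>))" "real (Suc (nat \<lfloor>a\<rfloor>)) \<le> a + 1"
      using of_int_floor_le[of a] real_of_int_floor_add_one_gt[of a] by simp_all linarith
    then have "a / real (Suc n) < real (Suc (nat \<lfloor>a\<rfloor>)) / real (Suc n)"
      "real (Suc (nat \<lfloor>a\<rfloor>)) / real (Suc n) \<le> a / real (Suc n) + 1 / real (Suc n)"
      unfolding add_divide_distrib[symmetric] by (intro divide_strict_right_mono divide_right_mono; simp)+
    moreover have "a / real (Suc n) = max 0 t" by (simp add: a_def)
    ultimately show "max 0 t < ?g n t" "?g n t \<le> max 0 t + 1 / real (Suc n)"
      by (simp_all only: a_def)
  qed
  have "filterlim (\<lambda>n. ?g n t) (at_right (max 0 t)) sequentially"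
  proof (rule tendsto_imp_filterlim_at_right)
    have "(\<lambda>n. max 0 t + 1 / real (Suc n)) \<longlonglongrightarrow> max 0 t + 0"
      by (intro tendsto_intros LIMSEQ_Suc[OF lim_const_over_n])
    then have upper: "(\<lambda>n. max 0 t + 1 / real (Suc n)) \<longlonglongrightarrow> max 0 t" by (simp only: add_0_right)
    show "(\<lambda>n. ?g n t) \<longlonglongrightarrow> max 0 t"
    proof (rule tendsto_sandwich[OF _ _ tendsto_const upper])
      show "\<forall>\<^sub>F n in sequentially. max 0 t \<le> ?g n t"
        by (rule always_eventually, rule allI, rule less_imp_le, rule g(1))
      show "\<forall>\<^sub>F n in sequentially. ?g n t \<le> max 0 t + 1 / real (Suc n)"
        by (rule always_eventually, rule allI, rule g(2))
    qed
  next
    show "\<forall>\<^sub>F n in sequentially. max 0 t < ?g n t"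
      by (rule always_eventually, rule allI, rule g(1))
  qed
  from filterlim_compose[OF rc[OF x(2)] this]
  show "(\<lambda>n. X (?g n (fst x)) (snd x)) \<longlonglongrightarrow> (case x of (t, \<omega>) \<Rightarrow> X (max 0 t) \<omega>)"
    by (simp add: x)
qed

lemma jointly_measurable_of_stopped:
  fixes Z :: "real \<Rightarrow> 'w \<Rightarrow> real"
  assumes "\<And>n::nat. (\<lambda>(t, \<omega>). Z (min (max 0 t) (real n)) \<omega>) \<in> borel_measurable (borel \<Otimes>\<^sub>M M)"
  shows "(\<lambda>(t, \<omega>). Z (max 0 t) \<omega>) \<in> borel_measurable (borel \<Otimes>\<^sub>M M)"
proof (rule borel_measurable_LIMSEQ_real[OF _ assms])
  fix x :: "real \<times> 'w"
  obtain t \<omega> where x: "x = (t, \<omega>)" by fastforce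
  have "\<forall>\<^sub>F n in sequentially. max 0 t \<le> real n"
    using eventually_ge_at_top[of "nat \<lceil>max 0 t\<rceil>"] by eventually_elim linarith
  then have "\<forall>\<^sub>F n in sequentially. Z (min (max 0 t) (real n)) \<omega> = Z (max 0 t) \<omega>"
    by eventually_elim simp
  then show "(\<lambda>n. case x of (t, \<omega>) \<Rightarrow> Z (min (max 0 t) (real n)) \<omega>) \<longlonglongrightarrow>
      (case x of (t, \<omega>) \<Rightarrow> Z (max 0 t) \<omega>)"
    unfolding x by (auto intro: tendsto_eventually)
qed

lemma measurable_borel_pair_subalgebra:
  assumes "subalgebra M N" "f \<in> measurable (borel \<Otimes>\<^sub>M N) L"
  shows "f \<in> measurable (borel \<Otimes>\<^sub>M M) L"
proof -
  have "(\<lambda>\<omega>. \<omega>) \<in> measurable M N"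
    using assms(1) by (auto simp: subalgebra_def intro: measurable_from_subalg)
  then have "(\<lambda>x. (fst x, snd x)) \<in> measurable (borel \<Otimes>\<^sub>M M) (borel \<Otimes>\<^sub>M N)"
    by (intro measurable_Pair measurable_fst measurable_compose[OF measurable_snd])
  from measurable_compose[OF this assms(2)] show ?thesis by simp
qed

lemma progressive_jointly_measurable:
  assumes Z: "progressive F Z" and sub: "\<And>t. subalgebra P (F t)"
  shows "(\<lambda>(t, \<omega>). Z (max 0 t) \<omega>) \<in> borel_measurable (borel \<Otimes>\<^sub>M P)"
proof (rule jointly_measurable_of_stopped)
  fix n :: nat
  let ?R = "restrict_space borel {0..real n} \<Otimes>\<^sub>M F (ennreal (real n))"
  have "(\<lambda>x. (min (max 0 (fst x)) (real n), snd x)) \<in> measurable (borel \<Otimes>\<^sub>M F (ennreal (real n))) ?R"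
    by (intro measurable_Pair measurable_snd measurable_restrict_space2) auto
  moreover have "(\<lambda>(s, \<omega>). Z s \<omega>) \<in> borel_measurable ?R"
    using Z unfolding progressive_def by simp
  ultimately have "(\<lambda>x. Z (min (max 0 (fst x)) (real n)) (snd x)) \<in> borel_measurable (borel \<Otimes>\<^sub>M F (ennreal (real n)))"
    using measurable_compose by fastforce
  then show "(\<lambda>(t, \<omega>). Z (min (max 0 t) (real n)) \<omega>) \<in> borel_measurable (borel \<Otimes>\<^sub>M P)"
    using measurable_borel_pair_subalgebra[OF sub] by (simp add: split_beta')
qed

text \<open>
  Optional processes are progressive: the map that stops time at \<open>T\<close> is measurable into the optional
  \<open>\<sigma>\<close>-algebra, because stopped cadlag processes are jointly measurable with respect to \<open>F T\<close>.
\<close>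

lemma optional_jointly_measurable:
  assumes Z: "optional_process P F Z" and sub: "\<And>t. subalgebra P (F t)"
    and mono: "\<And>s t. s \<le> t \<Longrightarrow> sets (F s) \<subseteq> sets (F t)" and T: "0 \<le> T"
  shows "(\<lambda>(t, \<omega>). Z (min (max 0 t) T) \<omega>) \<in> borel_measurable (borel \<Otimes>\<^sub>M F (ennreal T))"
proof -
  let ?h = "\<lambda>x. (min (max 0 (fst x)) T, snd x)"
  have space: "space (F t) = space P" for t using sub by (simp add: subalgebra_def)
  have "?h \<in> measurable (borel \<Otimes>\<^sub>M F (ennreal T)) (optional_sigma P F)"
    unfolding optional_sigma_def
  proof (rule measurable_measure_of)
    show "?h \<in> space (borel \<Otimes>\<^sub>M F (ennreal T)) \<rightarrow> {0..} \<times> space P"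
      using T by (auto simp: space_pair_measure space)
  next
    fix C assume "C \<in> {(\<lambda>(t, \<omega>). X t \<omega>) -` B \<inter> ({0..} \<times> space P) | X B.
        (\<forall>t\<ge>0. X t \<in> borel_measurable (F (ennreal t))) \<and>
        (\<forall>\<omega>\<in>space P. cadlag (\<lambda>t. X t \<omega>)) \<and> B \<in> sets (borel :: real measure)}"
    then obtain X :: "real \<Rightarrow> _ \<Rightarrow> real" and B where C: "C = (\<lambda>(t, \<omega>). X t \<omega>) -` B \<inter> ({0..} \<times> space P)"
      and X: "\<And>t. 0 \<le> t \<Longrightarrow> X t \<in> borel_measurable (F (ennreal t))"
      and cadlag: "\<And>\<omega>. \<omega> \<in> space P \<Longrightarrow> cadlag (\<lambda>t. X t \<omega>)" and B: "B \<in> sets borel"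
      by blast
    have "(\<lambda>(t, \<omega>). X (min (max 0 t) T) \<omega>) \<in> borel_measurable (borel \<Otimes>\<^sub>M F (ennreal T))"
    proof (rule right_continuous_jointly_measurable[of "\<lambda>t. X (min t T)"])
      fix t :: real assume t: "0 \<le> t"
      have "subalgebra (F (ennreal T)) (F (ennreal (min t T)))"
        using mono T t by (auto simp: subalgebra_def space intro!: mono ennreal_leI)
      then show "X (min t T) \<in> borel_measurable (F (ennreal T))"
        using X[of "min t T"] t T by (auto intro: measurable_from_subalg)
    next
      fix t \<omega> assume "\<omega> \<in> space (F (ennreal T))" and t: "(0::real) \<le> t"
      then have rc: "((\<lambda>s. X s \<omega>) \<longlongrightarrow> X t \<omega>) (at_right t)"
        using cadlag by (auto simp: cadlag_def space)
      show "((\<lambda>s. X (min s T) \<omega>) \<longlongrightarrow> X (min t T) \<omega>) (at_right t)"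
      proof (cases "t < T")
        case True
        then have "\<forall>\<^sub>F s in at_right t. X s \<omega> = X (min s T) \<omega>"
          by (auto simp: eventually_at_right intro!: exI[of _ T])
        then show ?thesis using rc True by (auto dest: Lim_transform_eventually)
      next
        case False
        then have "\<forall>\<^sub>F s in at_right t. X (min s T) \<omega> = X (min t T) \<omega>"
          unfolding eventually_at_right_field by (intro exI[of _ "t + 1"]) (auto simp: min_def)
        then show ?thesis by (rule tendsto_eventually)
      qed
    qed
    moreover have "?h -` C \<inter> space (borel \<Otimes>\<^sub>M F (ennreal T)) =
        (\<lambda>(t, \<omega>). X (min (max 0 t) T) \<omega>) -` B \<inter> space (borel \<Otimes>\<^sub>M F (ennreal T))"
      using T by (auto simp: C space_pair_measure space)
    ultimately show "?h -` C \<inter> space (borel \<Otimes>\<^sub>M F (ennreal T)) \<in> sets (borel \<Otimes>\<^sub>M F (ennreal T))"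
      using B by (simp only: measurable_sets)
  qed auto
  from measurable_compose[OF this Z[unfolded optional_process_def]]
  show ?thesis by (simp add: split_beta')
qed

section \<open>Running suprema\<close>

text \<open>
  Upper right-continuity as a statement about real numbers, which makes its stability under
  multiplication by exponentials evident.
\<close>

definition right_usc :: "(real \<Rightarrow> real) \<Rightarrow> bool" where
  "right_usc x \<longleftrightarrow> (\<forall>t\<ge>0. \<forall>c>x t. \<forall>\<^sub>F u in at_right t. x u < c)"

lemma upper_right_continuous_imp_right_usc:
  assumes "upper_right_continuous x"
  shows "right_usc x"
  unfolding right_usc_def
proof (intro allI impI)
  fix t c :: real assume "0 \<le> t" "x t < c"
  then have "\<forall>\<^sub>F \<epsilon> in at_right 0. (SUP u\<in>{t..<t + \<epsilon>}. ereal (x u)) < ereal c"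
    using assms unfolding upper_right_continuous_def by (intro order_tendstoD(2)) auto
  then obtain b where b: "b > 0" "\<And>\<epsilon>. 0 < \<epsilon> \<Longrightarrow> \<epsilon> < b \<Longrightarrow> (SUP u\<in>{t..<t + \<epsilon>}. ereal (x u)) < ereal c"
    unfolding eventually_at_right_field by auto
  have "x u < c" if "t < u" "u < t + b / 2" for u
  proof -
    have "ereal (x u) \<le> (SUP u\<in>{t..<t + b / 2}. ereal (x u))" using that by (intro SUP_upper) auto
    also have "\<dots> < ereal c" using b by auto
    finally show ?thesis by simp
  qed
  then show "\<forall>\<^sub>F u in at_right t. x u < c"
    unfolding eventually_at_right_field using b(1) by (intro exI[of _ "t + b / 2"]) auto
qed

lemma right_usc_exp_mult:
  assumes x: "right_usc x"
  shows "right_usc (\<lambda>u. exp (k * u) * x u)"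
  unfolding right_usc_def
proof (intro allI impI)
  fix t c :: real assume t: "0 \<le> t" "exp (k * t) * x t < c"
  then have "x t < c * exp (- (k * t))" by (simp add: exp_minus field_simps)
  then obtain d where d: "x t < d" "d < c * exp (- (k * t))" using dense by blast
  have "((\<lambda>u. c * exp (- (k * u))) \<longlongrightarrow> c * exp (- (k * t))) (at_right t)"
    by (intro tendsto_intros)
  then have "\<forall>\<^sub>F u in at_right t. d < c * exp (- (k * u))"
    using d(2) by (rule order_tendstoD)
  moreover have "\<forall>\<^sub>F u in at_right t. x u < d"
    using x t d(1) by (auto simp: right_usc_def)
  ultimately show "\<forall>\<^sub>F u in at_right t. exp (k * u) * x u < c"
  proof eventually_elim
    case (elim u)
    then have "exp (k * u) * x u < exp (k * u) * d" by simp
    also have "\<dots> < c" using elim by (simp add: exp_minus field_simps)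
    finally show ?case .
  qed
qed

text \<open>
  Immediately after \<open>t\<close> the path stays below any bound that exceeds its value at \<open>t\<close>, so the supremum
  cannot jump.
\<close>

lemma running_sup_right_continuous:
  fixes x :: "real \<Rightarrow> real"
  assumes x: "right_usc x" and bdd: "\<And>t. 0 \<le> t \<Longrightarrow> bdd_above (x ` {0..t})" and t: "0 \<le> t"
  shows "((\<lambda>s. SUP u\<in>{0..s}. x u) \<longlongrightarrow> (SUP u\<in>{0..t}. x u)) (at_right t)"
proof (rule order_tendstoI)
  fix c assume c: "c < (SUP u\<in>{0..t}. x u)"
  have "(SUP u\<in>{0..t}. x u) \<le> (SUP u\<in>{0..s}. x u)" if "t < s" for s
    using t that by (intro cSUP_subset_mono bdd) auto
  with c show "\<forall>\<^sub>F s in at_right t. c < (SUP u\<in>{0..s}. x u)"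
    by (auto simp: eventually_at_right_field intro!: exI[of _ "t + 1"] intro: less_le_trans)
next
  fix c assume "(SUP u\<in>{0..t}. x u) < c"
  then obtain c' where c': "(SUP u\<in>{0..t}. x u) < c'" "c' < c" using dense by blast
  have le: "x u \<le> c'" if "u \<in> {0..t}" for u
    using cSUP_upper[OF that bdd[OF t]] c' by simp
  have "x t < c'" using cSUP_upper[of t "{0..t}" x] bdd[OF t] c' t by simp
  then obtain b where b: "b > t" "\<And>u. t < u \<Longrightarrow> u < b \<Longrightarrow> x u < c'"
    using x t unfolding right_usc_def eventually_at_right_field by meson
  have "(SUP u\<in>{0..s}. x u) < c" if s: "t < s" "s < b" for s
  proof -
    have "(SUP u\<in>{0..s}. x u) \<le> c'"
    proof (rule cSUP_least)
      fix u assume "u \<in> {0..s}"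
      then show "x u \<le> c'"
        using le[of u] b(2)[of u] s by (cases "u \<le> t") auto
    qed (use t s in auto)
    with c' show ?thesis by simp
  qed
  with b(1) show "\<forall>\<^sub>F s in at_right t. (SUP u\<in>{0..s}. x u) < c"
    unfolding eventually_at_right_field by blast
qed

section \<open>Stieltjes integrals by change of time\<close>

text \<open>
  The generalised inverse \<open>inf {t. n t > u}\<close> of a nondecreasing path. Only rational times enter, which makes it
  jointly measurable and a stopping time in \<open>\<omega>\<close>, whatever the regularity of single paths.
\<close>

definition time_change :: "(real \<Rightarrow> real) \<Rightarrow> real \<Rightarrow> ennreal" where
  "time_change n u = (INF q\<in>{q\<in>\<rat>. 0 \<le> q}. if u < n q then ennreal q else \<top>)"

text \<open>
  Levels that are never exceeded (\<open>c = \<top>\<close>) do not contribute to Stieltjes integrals.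
\<close>

definition at_finite :: "(real \<Rightarrow> ennreal) \<Rightarrow> ennreal \<Rightarrow> ennreal" where
  "at_finite f c = (if c = \<top> then 0 else f (enn2real c))"

text \<open>
  Paths start from \<open>0\<close> before time \<open>0\<close>, so \<open>n 0 \<ge> 0\<close> is an initial jump.
\<close>

definition nondecreasing_rc :: "(real \<Rightarrow> real) \<Rightarrow> bool" where
  "nondecreasing_rc n \<longleftrightarrow> 0 \<le> n 0 \<and> (\<forall>s t. 0 \<le> s \<and> s \<le> t \<longrightarrow> n s \<le> n t) \<and>
     (\<forall>t\<ge>0. (n \<longlongrightarrow> n t) (at_right t))"

lemma countable_nonneg_Rats: "countable {q\<in>\<rat>. 0 \<le> (q::real)}"
  using countable_rat by (rule countable_subset[rotated]) auto

lemma borel_measurable_time_change: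
  assumes "\<And>q. 0 \<le> q \<Longrightarrow> N q \<in> borel_measurable M" and [measurable]: "u \<in> borel_measurable M"
  shows "(\<lambda>x. time_change (\<lambda>t. N t x) (u x)) \<in> borel_measurable M"
  unfolding time_change_def
proof (rule borel_measurable_INF[OF countable_nonneg_Rats])
  fix q :: real assume "q \<in> {q\<in>\<rat>. 0 \<le> q}"
  then have [measurable]: "N q \<in> borel_measurable M" using assms(1) by simp
  show "(\<lambda>x. if u x < N q x then ennreal q else \<top>) \<in> borel_measurable M" by measurable
qed

lemma time_change_less_iff: "time_change n u < c \<longleftrightarrow> (\<exists>q\<in>\<rat>. 0 \<le> q \<and> u < n q \<and> ennreal q < c)"
  unfolding time_change_def INF_less_iff by auto

lemma time_change_le:
  assumes n: "nondecreasing_rc n" and t: "0 \<le> t" "u < n t"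
  shows "time_change n u \<le> ennreal t"
proof (rule ccontr)
  assume "\<not> time_change n u \<le> ennreal t"
  then obtain c where c: "ennreal t < c" "c < time_change n u" using dense not_le by metis
  then obtain c' where c': "c = ennreal c'" "0 \<le> c'" by (cases c) auto
  then obtain q where q: "q \<in> \<rat>" "t < q" "q < c'"
    using c t Rats_dense_in_real[of t c'] by (auto simp: ennreal_less_iff)
  then have "u < n q" using n t unfolding nondecreasing_rc_def by (force intro: less_le_trans)
  then have "time_change n u \<le> ennreal q"
    unfolding time_change_def using q t by (intro INF_lower2[of q]) auto
  also have "\<dots> < c" using q t c' by (simp add: ennreal_less_iff)
  finally show False using c by simp
qed

lemma le_of_time_change_le:
  assumes n: "nondecreasing_rc n" and t: "0 \<le> t" "time_change n u \<le> ennreal t"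
  shows "u \<le> n t"
proof (rule ccontr)
  assume "\<not> u \<le> n t"
  moreover have "(n \<longlongrightarrow> n t) (at_right t)" using n t by (simp add: nondecreasing_rc_def)
  ultimately obtain b where b: "b > t" "\<And>s. t < s \<Longrightarrow> s < b \<Longrightarrow> n s < u"
    using order_tendstoD(2)[of n "n t" "at_right t" u] unfolding eventually_at_right_field by auto
  have "time_change n u < ennreal b"
    using t b(1) by (intro le_less_trans[OF t(2)]) (simp add: ennreal_less_iff)
  then obtain q where q: "0 \<le> q" "u < n q" "q < b"
    unfolding time_change_less_iff by (auto simp: ennreal_less_iff)
  show False
  proof (cases "q \<le> t")
    case True
    then have "n q \<le> n t" using n q by (simp add: nondecreasing_rc_def)
    then show False using q \<open>\<not> u \<le> n t\<close> by simp
  next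
    case False
    then show False using b(2)[of q] q by simp
  qed
qed

text \<open>
  Up to the single level \<open>u = n t\<close>, the levels reached by time \<open>t\<close> are those below \<open>n t\<close>.
\<close>

lemma emeasure_time_change_le:
  assumes n: "nondecreasing_rc n" and t: "0 \<le> t"
  shows "emeasure lborel {u. 0 \<le> u \<and> time_change n u \<le> ennreal t} = ennreal (n t)"
proof (rule antisym)
  have [measurable]: "time_change n \<in> borel_measurable borel"
    by (rule borel_measurable_time_change[of "\<lambda>t _. n t" borel "\<lambda>u. u"]) auto
  have nt: "0 \<le> n t" using n t unfolding nondecreasing_rc_def by (meson order_refl order_trans)
  have "emeasure lborel {u. 0 \<le> u \<and> time_change n u \<le> ennreal t} \<le> emeasure lborel {0..n t}"
    using le_of_time_change_le[OF n t] by (intro emeasure_mono) auto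
  then show "emeasure lborel {u. 0 \<le> u \<and> time_change n u \<le> ennreal t} \<le> ennreal (n t)"
    using nt by simp
  have "emeasure lborel {0..<n t} \<le> emeasure lborel {u. 0 \<le> u \<and> time_change n u \<le> ennreal t}"
    using time_change_le[OF n t] by (intro emeasure_mono) auto
  then show "ennreal (n t) \<le> emeasure lborel {u. 0 \<le> u \<and> time_change n u \<le> ennreal t}"
    using nt by simp
qed

text \<open>
  Both measures on \<open>[0, \<infinity>)\<close>, the Stieltjes measure of \<open>n\<close> and the image of Lebesgue measure under the time
  change, give mass \<open>n t\<close> to \<open>[0, t]\<close>.
\<close>

theorem nn_integral_time_change:
  assumes n: "nondecreasing_rc n" and M: "sets M = sets borel"
    and m: "\<And>t. 0 \<le> t \<Longrightarrow> emeasure M {0..t} = ennreal (n t)"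
    and f [measurable]: "f \<in> borel_measurable borel"
  shows "(\<integral>\<^sup>+s\<in>{0..}. f s \<partial>M) = (\<integral>\<^sup>+u\<in>{0..}. at_finite f (time_change n u) \<partial>lborel)"
proof -
  have [measurable_cong]: "sets M = sets borel" by (rule M)
  have [measurable]: "time_change n \<in> borel_measurable borel"
    by (rule borel_measurable_time_change[of "\<lambda>t _. n t" borel "\<lambda>u. u"]) auto
  define M1 where "M1 = density M (indicator {0..})"
  define I :: "real \<Rightarrow> ennreal" where "I = indicator {u. 0 \<le> u \<and> time_change n u \<noteq> \<top>}"
  have [measurable]: "I \<in> borel_measurable borel" unfolding I_def by measurable
  define M2 where "M2 = distr (density lborel I) borel (\<lambda>u. enn2real (time_change n u))"
  have M1: "emeasure M1 {..t} = (if t < 0 then 0 else ennreal (n t))" for t :: real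
  proof -
    have "emeasure M1 {..t} = (\<integral>\<^sup>+s. indicator ({0..} \<inter> {..t}) s \<partial>M)"
      by (simp add: M1_def emeasure_density indicator_inter_arith)
    also have "\<dots> = emeasure M ({0..} \<inter> {..t})" by simp
    also have "{0..} \<inter> {..t} = {0..t}" by auto
    finally show ?thesis using m[of t] by (cases "t < 0") auto
  qed
  have M2: "emeasure M2 {..t} = (if t < 0 then 0 else ennreal (n t))" for t :: real
  proof -
    have "emeasure M2 {..t} = (\<integral>\<^sup>+u. I u * indicator {u. enn2real (time_change n u) \<le> t} u \<partial>lborel)"
      by (simp add: M2_def emeasure_distr emeasure_density vimage_def)
    also have "\<dots> = (\<integral>\<^sup>+u. indicator {u. 0 \<le> t \<and> 0 \<le> u \<and> time_change n u \<le> ennreal t} u \<partial>lborel)"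
    proof (rule nn_integral_cong)
      fix u
      show "I u * indicator {u. enn2real (time_change n u) \<le> t} u =
          indicator {u. 0 \<le> t \<and> 0 \<le> u \<and> time_change n u \<le> ennreal t} u"
      proof (cases "time_change n u")
        case (real c)
        then show ?thesis
          by (auto simp: I_def indicator_def ennreal_le_iff)
      next
        case top
        then show ?thesis by (auto simp: I_def indicator_def top_unique)
      qed
    qed
    also have "\<dots> = emeasure lborel {u. 0 \<le> t \<and> 0 \<le> u \<and> time_change n u \<le> ennreal t}"
      by simp
    finally show ?thesis using emeasure_time_change_le[OF n, of t] by (cases "t < 0") auto
  qed
  have "M1 = M2"
  proof (rule measure_eqI_generator_eq[where E = "range atMost" and \<Omega> = UNIV and A = "\<lambda>i::nat. {..real i}"])
    show "Int_stable (range (atMost :: real \<Rightarrow> _))"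
      by (auto simp: Int_stable_def)
    show "sets M1 = sigma_sets UNIV (range atMost)" "sets M2 = sigma_sets UNIV (range atMost)"
      using arg_cong[OF borel_eq_atMost, of sets] by (simp_all add: M1_def M2_def M)
    show "(\<Union>i::nat. {..real i}) = UNIV"
      using real_arch_simple by auto
    show "emeasure M1 X = emeasure M2 X" if "X \<in> range atMost" for X
      using that M1 M2 by auto
    show "emeasure M1 {..real i} \<noteq> \<infinity>" for i :: nat
      by (simp add: M1)
  qed auto
  have "(\<integral>\<^sup>+s\<in>{0..}. f s \<partial>M) = (\<integral>\<^sup>+s. f s \<partial>M1)"
    by (simp add: M1_def nn_integral_density mult.commute)
  also have "\<dots> = (\<integral>\<^sup>+u. I u * f (enn2real (time_change n u)) \<partial>lborel)"
    unfolding \<open>M1 = M2\<close> by (simp add: M2_def nn_integral_distr nn_integral_density)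
  also have "\<dots> = (\<integral>\<^sup>+u\<in>{0..}. at_finite f (time_change n u) \<partial>lborel)"
    by (intro nn_integral_cong) (auto simp: I_def at_finite_def indicator_def)
  finally show ?thesis .
qed

text \<open>
  This is the exchange of integrals in \<open>\<integral> g t (\<integral>\<^bsub>[0,t]\<^esub> dn) dt\<close>: write \<open>n t\<close> as the Lebesgue measure of the
  levels reached by time \<open>t\<close> and apply Tonelli's theorem.
\<close>

lemma nn_integral_mult_nondecreasing:
  assumes n: "nondecreasing_rc n" and g [measurable]: "g \<in> borel_measurable borel"
  shows "(\<integral>\<^sup>+t\<in>{0..}. g t * ennreal (n t) \<partial>lborel) =
    (\<integral>\<^sup>+u\<in>{0..}. (\<integral>\<^sup>+t\<in>{t. 0 \<le> t \<and> time_change n u \<le> ennreal t}. g t \<partial>lborel) \<partial>lborel)"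
proof -
  have [measurable]: "time_change n \<in> borel_measurable borel"
    by (rule borel_measurable_time_change[of "\<lambda>t _. n t" borel "\<lambda>u. u"]) auto
  let ?h = "\<lambda>u t. g t * indicator {0..} t * (indicator {u. 0 \<le> u \<and> time_change n u \<le> ennreal t} u :: ennreal)"
  have "(\<integral>\<^sup>+t\<in>{0..}. g t * ennreal (n t) \<partial>lborel) = (\<integral>\<^sup>+t. \<integral>\<^sup>+u. ?h u t \<partial>lborel \<partial>lborel)"
  proof (rule nn_integral_cong)
    fix t :: real
    have "(\<integral>\<^sup>+u. ?h u t \<partial>lborel) = g t * indicator {0..} t * emeasure lborel {u. 0 \<le> u \<and> time_change n u \<le> ennreal t}"
      by (subst nn_integral_cmult) auto
    then show "g t * ennreal (n t) * indicator {0..} t = (\<integral>\<^sup>+u. ?h u t \<partial>lborel)"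
      using emeasure_time_change_le[OF n, of t] by (cases "0 \<le> t") (auto simp: indicator_def)
  qed
  also have "\<dots> = (\<integral>\<^sup>+u. \<integral>\<^sup>+t. ?h u t \<partial>lborel \<partial>lborel)"
    by (rule lborel_pair.Fubini') measurable
  also have "\<dots> = (\<integral>\<^sup>+u\<in>{0..}. (\<integral>\<^sup>+t\<in>{t. 0 \<le> t \<and> time_change n u \<le> ennreal t}. g t \<partial>lborel) \<partial>lborel)"
    by (intro nn_integral_cong, subst nn_integral_multc[symmetric])
      (auto intro!: nn_integral_cong simp: indicator_def)
  finally show ?thesis .
qed

section \<open>The space \<open>L\<^sup>p\<close> over a finite measure\<close>

lemma Lp_spaceD: "f \<in> Lp_space \<mu> p \<Longrightarrow> f \<in> borel_measurable \<mu>"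
    "f \<in> Lp_space \<mu> p \<Longrightarrow> integrable \<mu> (\<lambda>x. \<bar>f x\<bar> powr p)"
  by (auto simp: Lp_space_def)

lemma Lp_cone_subset: "Lp_cone \<mu> p \<subseteq> Lp_space \<mu> p"
  by (auto simp: Lp_cone_def)

lemma Lp_space_bounded:
  assumes "finite_measure \<mu>" "0 \<le> p" "f \<in> borel_measurable \<mu>" "\<And>x. x \<in> space \<mu> \<Longrightarrow> \<bar>f x\<bar> \<le> B"
  shows "f \<in> Lp_space \<mu> p"
proof -
  interpret finite_measure \<mu> by fact
  have [measurable]: "f \<in> borel_measurable \<mu>" by fact
  have "integrable \<mu> (\<lambda>x. \<bar>f x\<bar> powr p)"
    by (rule integrable_const_bound[where B = "B powr p"])
      (use assms in \<open>auto intro!: powr_mono2\<close>)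
  then show ?thesis using assms by (simp add: Lp_space_def)
qed

lemma Lp_space_cmult: "f \<in> Lp_space \<mu> p \<Longrightarrow> (\<lambda>x. c * f x) \<in> Lp_space \<mu> p"
  by (auto simp: Lp_space_def abs_mult powr_mult)

lemma Lp_space_add:
  assumes "0 \<le> p" "f \<in> Lp_space \<mu> p" "g \<in> Lp_space \<mu> p"
  shows "(\<lambda>x. f x + g x) \<in> Lp_space \<mu> p"
proof -
  note [measurable] = Lp_spaceD(1)[OF assms(2)] Lp_spaceD(1)[OF assms(3)]
  have le: "\<bar>a + b\<bar> powr p \<le> 2 powr p * (\<bar>a\<bar> powr p + \<bar>b\<bar> powr p)" for a b :: real
  proof -
    have "\<bar>a + b\<bar> powr p \<le> (2 * max \<bar>a\<bar> \<bar>b\<bar>) powr p"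
      using assms(1) by (intro powr_mono2) auto
    also have "\<dots> = 2 powr p * max \<bar>a\<bar> \<bar>b\<bar> powr p" by (simp add: powr_mult)
    also have "\<dots> \<le> 2 powr p * (\<bar>a\<bar> powr p + \<bar>b\<bar> powr p)"
      by (intro mult_left_mono) (auto simp: max_def)
    finally show ?thesis .
  qed
  have "integrable \<mu> (\<lambda>x. \<bar>f x + g x\<bar> powr p)"
  proof (rule Bochner_Integration.integrable_bound)
    show "integrable \<mu> (\<lambda>x. 2 powr p * (\<bar>f x\<bar> powr p + \<bar>g x\<bar> powr p))"
      using Lp_spaceD(2)[OF assms(2)] Lp_spaceD(2)[OF assms(3)] by simp
  qed (use le in auto)
  then show ?thesis by (simp add: Lp_space_def)
qed

lemma Lp_space_diff:
  assumes "0 \<le> p" "f \<in> Lp_space \<mu> p" "g \<in> Lp_space \<mu> p"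
  shows "(\<lambda>x. f x - g x) \<in> Lp_space \<mu> p"
  using Lp_space_add[OF assms(1,2) Lp_space_cmult[OF assms(3), of "-1"]] by simp

lemma Lp_norm_nonneg: "0 \<le> Lp_norm \<mu> p f"
  by (simp add: Lp_norm_def)

lemma Lp_norm_powr:
  assumes "0 < p"
  shows "Lp_norm \<mu> p f powr p = (\<integral>x. \<bar>f x\<bar> powr p \<partial>\<mu>)"
  using assms by (simp add: Lp_norm_def powr_powr integral_nonneg_AE)

lemma Lp_norm_cong_AE:
  assumes "AE x in \<mu>. f x = g x" "f \<in> borel_measurable \<mu>" "g \<in> borel_measurable \<mu>"
  shows "Lp_norm \<mu> p f = Lp_norm \<mu> p g"
  unfolding Lp_norm_def using assms by (intro arg_cong2[where f = "(powr)"] integral_cong_AE) auto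

text \<open>
  The constant comes from \<open>a \<le> 1 + a\<^sup>p\<close>, applied to \<open>\<bar>f\<bar>\<close> divided by its norm and integrated.
\<close>

lemma Lp_L1_bound:
  assumes "finite_measure \<mu>" "1 < p" and f: "f \<in> Lp_space \<mu> p"
  shows "integrable \<mu> f" "(\<integral>x. \<bar>f x\<bar> \<partial>\<mu>) \<le> (measure \<mu> (space \<mu>) + 1) * Lp_norm \<mu> p f"
proof -
  interpret finite_measure \<mu> by fact
  note [measurable] = Lp_spaceD(1)[OF f]
  have le: "a \<le> 1 + a powr p" if "0 \<le> a" for a :: real
  proof (cases "a \<le> 1")
    case False
    then have "a powr 1 \<le> a powr p" using assms(2) by (intro powr_mono) auto
    then show ?thesis using False by simp
  qed (use powr_ge_zero[of a p] in linarith)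
  show int: "integrable \<mu> f"
  proof (rule Bochner_Integration.integrable_bound)
    show "integrable \<mu> (\<lambda>x. 1 + \<bar>f x\<bar> powr p)" using Lp_spaceD(2)[OF f] by simp
  qed (use le in auto)
  define N where "N = Lp_norm \<mu> p f"
  have Np: "N powr p = (\<integral>x. \<bar>f x\<bar> powr p \<partial>\<mu>)"
    unfolding N_def using assms(2) by (intro Lp_norm_powr) simp
  show "(\<integral>x. \<bar>f x\<bar> \<partial>\<mu>) \<le> (measure \<mu> (space \<mu>) + 1) * Lp_norm \<mu> p f"
  proof (cases "N = 0")
    case True
    then have "(\<integral>x. \<bar>f x\<bar> powr p \<partial>\<mu>) = 0" using Np by simp
    then have "AE x in \<mu>. \<bar>f x\<bar> powr p = 0"
      using Lp_spaceD(2)[OF f] by (subst (asm) integral_nonneg_eq_0_iff_AE) auto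
    then have "(\<integral>x. \<bar>f x\<bar> \<partial>\<mu>) = 0" by (intro integral_eq_zero_AE) auto
    then show ?thesis by (simp add: Lp_norm_nonneg)
  next
    case False
    then have N: "N > 0" using Lp_norm_nonneg[of \<mu> p f] by (simp add: N_def)
    have "(\<integral>x. \<bar>f x\<bar> \<partial>\<mu>) \<le> (\<integral>x. N * (1 + \<bar>f x\<bar> powr p / N powr p) \<partial>\<mu>)"
    proof (rule integral_mono)
      show "integrable \<mu> (\<lambda>x. N * (1 + \<bar>f x\<bar> powr p / N powr p))"
        using Lp_spaceD(2)[OF f] by simp
      fix x
      show "\<bar>f x\<bar> \<le> N * (1 + \<bar>f x\<bar> powr p / N powr p)"
        using mult_left_mono[OF le[of "\<bar>f x\<bar> / N"], of N] N by (simp add: powr_divide)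
    qed (use int in simp)
    also have "\<dots> = N * (measure \<mu> (space \<mu>) + (\<integral>x. \<bar>f x\<bar> powr p \<partial>\<mu>) / N powr p)"
      using Lp_spaceD(2)[OF f] by simp
    also have "\<dots> = (measure \<mu> (space \<mu>) + 1) * N"
      using N by (simp flip: Np)
    finally show ?thesis by (simp add: N_def)
  qed
qed

lemma pairing_bound:
  assumes "finite_measure \<mu>" "1 < p" and f: "f \<in> Lp_space \<mu> p"
    and b [measurable]: "b \<in> borel_measurable \<mu>" and B: "\<And>x. \<bar>b x\<bar> \<le> B"
  shows "integrable \<mu> (\<lambda>x. b x * f x)"
    "\<bar>pairing \<mu> b f\<bar> \<le> B * (measure \<mu> (space \<mu>) + 1) * Lp_norm \<mu> p f"
proof -
  note [measurable] = Lp_spaceD(1)[OF f]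
  note int = Lp_L1_bound[OF assms(1-3)]
  have le: "\<bar>b x * f x\<bar> \<le> B * \<bar>f x\<bar>" for x
    by (simp add: abs_mult B mult_right_mono)
  show *: "integrable \<mu> (\<lambda>x. b x * f x)"
    by (rule Bochner_Integration.integrable_bound[of _ "\<lambda>x. B * \<bar>f x\<bar>"])
      (use int(1) le in \<open>auto intro: order_trans abs_ge_self\<close>)
  have "\<bar>pairing \<mu> b f\<bar> \<le> (\<integral>x. \<bar>b x * f x\<bar> \<partial>\<mu>)"
    unfolding pairing_def by (rule integral_abs_bound)
  also have "\<dots> \<le> (\<integral>x. B * \<bar>f x\<bar> \<partial>\<mu>)"
    using * int(1) le by (intro integral_mono) auto
  also have "\<dots> \<le> B * ((measure \<mu> (space \<mu>) + 1) * Lp_norm \<mu> p f)"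
    using int(2) order_trans[OF abs_ge_zero B] by (simp add: mult_left_mono)
  finally show "\<bar>pairing \<mu> b f\<bar> \<le> B * (measure \<mu> (space \<mu>) + 1) * Lp_norm \<mu> p f"
    by (simp add: mult.assoc)
qed

lemma pairing_const: "pairing \<mu> (\<lambda>x. c) f = c * (\<integral>x. f x \<partial>\<mu>)"
  by (simp add: pairing_def)

section \<open>Groups with a constant eigenvector\<close>

lemma solution_linear_ODE:
  fixes g :: "real \<Rightarrow> real"
  assumes "\<And>t. (g has_real_derivative a * g t) (at t)"
  shows "g t = exp (a * t) * g 0"
proof -
  have "((\<lambda>t. exp (- a * t) * g t) has_real_derivative 0) (at t)" for t
    by (auto intro!: derivative_eq_intros assms simp: field_simps)
  then have "exp (- a * t) * g t = exp (- a * 0) * g 0"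
    by (intro DERIV_isconst_all) auto
  then show ?thesis by (simp add: exp_minus field_simps)
qed

locale constant_eigenvector_group =
  fixes \<mu> :: "'d measure" and p :: real and U :: "real \<Rightarrow> ('d \<Rightarrow> real) \<Rightarrow> ('d \<Rightarrow> real)"
    and lam0 lam0s :: real
  assumes finite_mu: "finite_measure \<mu>" and p: "1 < p" and U: "C0_group \<mu> p U"
    and dense: "densely_defined \<mu> p (generator \<mu> p U)"
    and eigen: "eigenvector \<mu> (generator \<mu> p U) lam0 (\<lambda>x. 1)"
    and eigen_adj: "eigenvector \<mu> (adjoint_graph \<mu> p (generator \<mu> p U)) lam0s (\<lambda>x. 1)"
begin

sublocale finite_measure \<mu> by (rule finite_mu)

lemma p_nonneg: "0 \<le> p" using p by simp

lemma const_Lp: "(\<lambda>x. c) \<in> Lp_space \<mu> p"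
  by (rule Lp_space_bounded[OF finite_mu p_nonneg, where B = "\<bar>c\<bar>"]) auto

lemma U_Lp: "f \<in> Lp_space \<mu> p \<Longrightarrow> U t f \<in> Lp_space \<mu> p"
  using U by (simp add: C0_group_def Lp_bounded_linear_def)

lemma U_measurable: "f \<in> Lp_space \<mu> p \<Longrightarrow> U t f \<in> borel_measurable \<mu>"
  by (rule Lp_spaceD(1)[OF U_Lp])

lemma U_linear:
  assumes "f \<in> Lp_space \<mu> p" "g \<in> Lp_space \<mu> p"
  shows "AE x in \<mu>. U t (\<lambda>x. a * f x + b * g x) x = a * U t f x + b * U t g x"
proof -
  have "\<forall>f\<in>Lp_space \<mu> p. \<forall>g\<in>Lp_space \<mu> p. AE x in \<mu>. U t (\<lambda>x. f x + g x) x = U t f x + U t g x"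
    using U by (simp add: C0_group_def Lp_bounded_linear_def)
  from this[rule_format, OF Lp_space_cmult[OF assms(1), of a] Lp_space_cmult[OF assms(2), of b]]
  have "AE x in \<mu>. U t (\<lambda>x. a * f x + b * g x) x = U t (\<lambda>x. a * f x) x + U t (\<lambda>x. b * g x) x" .
  moreover have "\<forall>f\<in>Lp_space \<mu> p. \<forall>c. AE x in \<mu>. U t (\<lambda>x. c * f x) x = c * U t f x"
    using U by (simp add: C0_group_def Lp_bounded_linear_def)
  note this[rule_format, OF assms(1), of a] this[rule_format, OF assms(2), of b]
  ultimately show ?thesis by eventually_elim simp
qed

lemma U_cmult: "f \<in> Lp_space \<mu> p \<Longrightarrow> AE x in \<mu>. U t (\<lambda>x. c * f x) x = c * U t f x"
  using U by (simp add: C0_group_def Lp_bounded_linear_def)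

lemma U_group: "f \<in> Lp_space \<mu> p \<Longrightarrow> AE x in \<mu>. U (s + t) f x = U s (U t f) x"
  using U by (simp add: C0_group_def)

lemma U_bounded: obtains K where "K \<ge> 0" "\<And>f. f \<in> Lp_space \<mu> p \<Longrightarrow> Lp_norm \<mu> p (U t f) \<le> K * Lp_norm \<mu> p f"
proof -
  obtain K where K: "\<And>f. f \<in> Lp_space \<mu> p \<Longrightarrow> Lp_norm \<mu> p (U t f) \<le> K * Lp_norm \<mu> p f"
  proof -
    have "\<exists>K. \<forall>f\<in>Lp_space \<mu> p. Lp_norm \<mu> p (U t f) \<le> K * Lp_norm \<mu> p f"
      using U by (simp add: C0_group_def Lp_bounded_linear_def)
    then show thesis using that by blast
  qed
  have "Lp_norm \<mu> p (U t f) \<le> max 0 K * Lp_norm \<mu> p f" if "f \<in> Lp_space \<mu> p" for f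
    using K[OF that] mult_right_mono[of K "max 0 K" "Lp_norm \<mu> p f"] Lp_norm_nonneg[of \<mu> p f] by simp
  then show thesis using that[of "max 0 K"] by simp
qed

lemma generatorD:
  assumes "(f, g) \<in> generator \<mu> p U"
  shows "f \<in> Lp_space \<mu> p" "g \<in> Lp_space \<mu> p"
    "((\<lambda>h. Lp_dist \<mu> p (\<lambda>x. (U h f x - f x) / h) g) \<longlongrightarrow> 0) (at 0)"
  using assms by (auto simp: generator_def)

lemma U_difference_quotient:
  assumes fg: "(f, g) \<in> generator \<mu> p U"
  shows "(\<lambda>x. (U h f x - f x) / h - g x) \<in> Lp_space \<mu> p"
    "AE x in \<mu>. U t (\<lambda>x. (U h f x - f x) / h - g x) x = (U (t + h) f x - U t f x) / h - U t g x"
proof -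
  note f = generatorD(1)[OF fg] and g = generatorD(2)[OF fg]
  let ?d = "\<lambda>x. (1 / h) * U h f x + (- 1 / h) * f x"
  have eq: "(\<lambda>x. (U h f x - f x) / h - g x) = (\<lambda>x. 1 * ?d x + (- 1) * g x)"
    by (auto simp: field_simps diff_divide_distrib)
  have d: "?d \<in> Lp_space \<mu> p"
    by (intro Lp_space_add[OF p_nonneg] Lp_space_cmult U_Lp f)
  show "(\<lambda>x. (U h f x - f x) / h - g x) \<in> Lp_space \<mu> p"
    unfolding eq by (intro Lp_space_add[OF p_nonneg] Lp_space_cmult d g)
  show "AE x in \<mu>. U t (\<lambda>x. (U h f x - f x) / h - g x) x = (U (t + h) f x - U t f x) / h - U t g x"
    using U_linear[OF d g, of t 1 "-1"] U_linear[OF U_Lp[OF f] f, of t "1 / h" h "- 1 / h"] U_group[OF f, of t h]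
    unfolding eq by eventually_elim (simp add: diff_divide_distrib)
qed

text \<open>
  The group commutes with its generator.
\<close>

lemma U_generator:
  assumes fg: "(f, g) \<in> generator \<mu> p U"
  shows "(U t f, U t g) \<in> generator \<mu> p U"
proof -
  note f = generatorD(1)[OF fg] and g = generatorD(2)[OF fg]
  obtain K where K: "K \<ge> 0" "\<And>f. f \<in> Lp_space \<mu> p \<Longrightarrow> Lp_norm \<mu> p (U t f) \<le> K * Lp_norm \<mu> p f"
    using U_bounded by blast
  have "((\<lambda>h. Lp_dist \<mu> p (\<lambda>x. (U h (U t f) x - U t f x) / h) (U t g)) \<longlongrightarrow> 0) (at 0)"
  proof (rule tendsto_sandwich[OF _ _ tendsto_const])
    show "((\<lambda>h. K * Lp_dist \<mu> p (\<lambda>x. (U h f x - f x) / h) g) \<longlongrightarrow> 0) (at 0)"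
      using tendsto_mult_left[OF generatorD(3)[OF fg], of K] by simp
    have "Lp_dist \<mu> p (\<lambda>x. (U h (U t f) x - U t f x) / h) (U t g)
        \<le> K * Lp_dist \<mu> p (\<lambda>x. (U h f x - f x) / h) g" for h
    proof -
      have "Lp_dist \<mu> p (\<lambda>x. (U h (U t f) x - U t f x) / h) (U t g) =
          Lp_norm \<mu> p (U t (\<lambda>x. (U h f x - f x) / h - g x))"
        unfolding Lp_dist_def
      proof (rule Lp_norm_cong_AE)
        show "AE x in \<mu>. (U h (U t f) x - U t f x) / h - U t g x = U t (\<lambda>x. (U h f x - f x) / h - g x) x"
          using U_difference_quotient(2)[OF fg, of t h] U_group[OF f, of h t]
          by eventually_elim (simp add: add.commute)
      qed (auto intro!: borel_measurable_diff borel_measurable_divide U_measurable U_Lp f g U_difference_quotient(1)[OF fg])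
      also have "\<dots> \<le> K * Lp_dist \<mu> p (\<lambda>x. (U h f x - f x) / h) g"
        unfolding Lp_dist_def by (rule K(2)[OF U_difference_quotient(1)[OF fg]])
      finally show ?thesis .
    qed
    then show "\<forall>\<^sub>F h in at 0. Lp_dist \<mu> p (\<lambda>x. (U h (U t f) x - U t f x) / h) (U t g)
        \<le> K * Lp_dist \<mu> p (\<lambda>x. (U h f x - f x) / h) g"
      by (auto intro: always_eventually)
  qed (auto simp: Lp_dist_def Lp_norm_nonneg)
  then show ?thesis by (simp add: generator_def U_Lp f g)
qed

text \<open>
  Pairing with a bounded function turns the difference quotients, which converge in \<open>L\<^sup>p\<close>, into numbers: by
  linearity the error is the pairing with \<open>U t\<close> of the error at time \<open>0\<close>.
\<close>

lemma pairing_U_derivative: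
  assumes fg: "(f, g) \<in> generator \<mu> p U" and b: "b \<in> borel_measurable \<mu>" "\<And>x. \<bar>b x\<bar> \<le> B"
  shows "((\<lambda>t. pairing \<mu> b (U t f)) has_real_derivative pairing \<mu> b (U t g)) (at t)"
proof -
  note f = generatorD(1)[OF fg] and g = generatorD(2)[OF fg]
  obtain K where K: "K \<ge> 0" "\<And>f. f \<in> Lp_space \<mu> p \<Longrightarrow> Lp_norm \<mu> p (U t f) \<le> K * Lp_norm \<mu> p f"
    using U_bounded by blast
  define C where "C = B * (measure \<mu> (space \<mu>) + 1)"
  have B0: "0 \<le> B" using b(2) abs_ge_zero order_trans by blast
  have C: "0 \<le> C" unfolding C_def using B0 by simp
  note bound = pairing_bound[OF finite_mu p _ b(1) b(2)]
  have "\<bar>(pairing \<mu> b (U (t + h) f) - pairing \<mu> b (U t f)) / h - pairing \<mu> b (U t g)\<bar>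
      \<le> C * K * Lp_dist \<mu> p (\<lambda>x. (U h f x - f x) / h) g" for h
  proof -
    let ?D = "\<lambda>x. (U h f x - f x) / h - g x"
    note int = bound(1)[OF U_Lp[OF f]] bound(1)[OF U_Lp[OF g]]
    have "pairing \<mu> b (U t ?D) = (\<integral>x. (b x * U (t + h) f x - b x * U t f x) / h - b x * U t g x \<partial>\<mu>)"
      unfolding pairing_def
    proof (rule integral_cong_AE)
      show "AE x in \<mu>. b x * U t ?D x = (b x * U (t + h) f x - b x * U t f x) / h - b x * U t g x"
        using U_difference_quotient(2)[OF fg, of t h]
        by eventually_elim (simp add: right_diff_distrib diff_divide_distrib)
    qed (use b int U_Lp[OF U_difference_quotient(1)[OF fg, of h], THEN Lp_spaceD(1)] in \<open>auto\<close>)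
    also have "\<dots> = (pairing \<mu> b (U (t + h) f) - pairing \<mu> b (U t f)) / h - pairing \<mu> b (U t g)"
      using int by (simp add: pairing_def)
    finally have "\<bar>(pairing \<mu> b (U (t + h) f) - pairing \<mu> b (U t f)) / h - pairing \<mu> b (U t g)\<bar> =
        \<bar>pairing \<mu> b (U t ?D)\<bar>" by simp
    also have "\<dots> \<le> C * Lp_norm \<mu> p (U t ?D)"
      unfolding C_def by (rule bound(2)[OF U_Lp[OF U_difference_quotient(1)[OF fg]]])
    also have "\<dots> \<le> C * (K * Lp_norm \<mu> p ?D)"
      using K(2)[OF U_difference_quotient(1)[OF fg, of h]] C by (rule mult_left_mono)
    finally show ?thesis by (simp add: Lp_dist_def mult.assoc)
  qed
  then have le: "\<forall>h. norm ((pairing \<mu> b (U (t + h) f) - pairing \<mu> b (U t f)) / h - pairing \<mu> b (U t g))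
      \<le> C * K * Lp_dist \<mu> p (\<lambda>x. (U h f x - f x) / h) g" by simp
  have "((\<lambda>h. C * K * Lp_dist \<mu> p (\<lambda>x. (U h f x - f x) / h) g) \<longlongrightarrow> 0) (at 0)"
    using tendsto_mult_left[OF generatorD(3)[OF fg], of "C * K"] by simp
  from Lim_null_comparison[OF always_eventually[OF le] this]
  have "((\<lambda>h. (pairing \<mu> b (U (t + h) f) - pairing \<mu> b (U t f)) / h - pairing \<mu> b (U t g)) \<longlongrightarrow> 0) (at 0)" .
  then show ?thesis
    unfolding DERIV_def by (simp add: LIM_zero_iff)
qed

lemma measure_pos: "0 < measure \<mu> (space \<mu>)"
proof -
  have "\<not> (AE x in \<mu>. False)" using eigen by (simp add: eigenvector_def)
  then show ?thesis
    by (auto simp: less_le emeasure_eq_measure AE_iff_measurable[of "space \<mu>"])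
qed

text \<open>
  Each pairing of \<open>U t 1\<close> with a bounded function solves a linear differential equation; indicators
  of measurable sets then determine \<open>U t 1\<close>.
\<close>

lemma U_const: "AE x in \<mu>. U t (\<lambda>x. c) x = exp (lam0 * t) * c"
proof -
  have gen: "(\<lambda>x. 1, \<lambda>x. lam0 * 1) \<in> generator \<mu> p U"
    using eigen by (simp add: eigenvector_def)
  have one: "pairing \<mu> b (U t (\<lambda>x. 1)) = exp (lam0 * t) * pairing \<mu> b (\<lambda>x. 1)"
    if b: "b \<in> borel_measurable \<mu>" "\<And>x. \<bar>b x\<bar> \<le> B" for b B t
  proof -
    have "pairing \<mu> b (U t (\<lambda>x. lam0 * 1)) = lam0 * pairing \<mu> b (U t (\<lambda>x. 1))" for t
    proof -
      have "pairing \<mu> b (U t (\<lambda>x. lam0 * 1)) = (\<integral>x. lam0 * (b x * U t (\<lambda>x. 1) x) \<partial>\<mu>)"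
        unfolding pairing_def
      proof (rule integral_cong_AE)
        show "AE x in \<mu>. b x * U t (\<lambda>x. lam0 * 1) x = lam0 * (b x * U t (\<lambda>x. 1) x)"
          using U_cmult[OF const_Lp[of 1], of t lam0] by eventually_elim simp
      qed (use b U_Lp[OF const_Lp, THEN Lp_spaceD(1)] in auto)
      then show ?thesis by (simp add: pairing_def)
    qed
    then have "pairing \<mu> b (U t (\<lambda>x. 1)) = exp (lam0 * t) * pairing \<mu> b (U 0 (\<lambda>x. 1))"
      using pairing_U_derivative[OF gen b] by (intro solution_linear_ODE) simp
    also have "pairing \<mu> b (U 0 (\<lambda>x. 1)) = pairing \<mu> b (\<lambda>x. 1)"
      unfolding pairing_def
    proof (rule integral_cong_AE)
      have "AE x in \<mu>. U 0 (\<lambda>x. 1) x = 1"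
        using U const_Lp[of 1] unfolding C0_group_def by blast
      then show "AE x in \<mu>. b x * U 0 (\<lambda>x. 1) x = b x * 1" by eventually_elim simp
    qed (use b U_Lp[OF const_Lp, THEN Lp_spaceD(1)] in auto)
    finally show ?thesis .
  qed
  have "AE x in \<mu>. U t (\<lambda>x. 1) x = exp (lam0 * t)"
  proof (rule density_unique_real)
    fix S assume S: "S \<in> sets \<mu>"
    then show "(LINT x:S|\<mu>. U t (\<lambda>x. 1) x) = (LINT x:S|\<mu>. exp (lam0 * t))"
      using one[of "indicator S" 1 t] by (simp add: pairing_def set_lebesgue_integral_def indicator_def)
  qed (use Lp_L1_bound(1)[OF finite_mu p U_Lp[OF const_Lp]] in auto)
  with U_cmult[OF const_Lp[of 1], of t c] show ?thesis
    by eventually_elim (simp add: mult.commute)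
qed

text \<open>
  On the domain of the generator, \<open>\<langle>1, U t f\<rangle>\<close> solves the linear differential equation given by the adjoint
  eigenvalue; both sides are continuous in \<open>f\<close> and the domain is dense.
\<close>

lemma integral_U:
  assumes f: "f \<in> Lp_space \<mu> p"
  shows "(\<integral>x. U t f x \<partial>\<mu>) = exp (lam0s * t) * (\<integral>x. f x \<partial>\<mu>)"
proof -
  have dom: "(\<integral>x. U t f x \<partial>\<mu>) = exp (lam0s * t) * (\<integral>x. f x \<partial>\<mu>)"
    if fg: "(f, g) \<in> generator \<mu> p U" for f g
  proof -
    note f = generatorD(1)[OF fg]
    have "pairing \<mu> (\<lambda>x. 1) (U t g) = lam0s * pairing \<mu> (\<lambda>x. 1) (U t f)" for t
      using eigen_adj U_generator[OF fg, of t]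
      by (auto simp: eigenvector_def adjoint_graph_def pairing_def)
    then have "pairing \<mu> (\<lambda>x. 1) (U t f) = exp (lam0s * t) * pairing \<mu> (\<lambda>x. 1) (U 0 f)"
      using pairing_U_derivative[OF fg, of "\<lambda>x. 1" 1] by (intro solution_linear_ODE) simp
    moreover have "(\<integral>x. U 0 f x \<partial>\<mu>) = (\<integral>x. f x \<partial>\<mu>)"
    proof (rule integral_cong_AE)
      show "AE x in \<mu>. U 0 f x = f x" using U f unfolding C0_group_def by blast
    qed (use f U_Lp[OF f] in \<open>auto dest: Lp_spaceD(1)\<close>)
    ultimately show ?thesis by (simp add: pairing_def)
  qed
  define \<Phi> where "\<Phi> f = (\<integral>x. U t f x \<partial>\<mu>) - exp (lam0s * t) * (\<integral>x. f x \<partial>\<mu>)" for f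
  obtain K where K: "K \<ge> 0" "\<And>f. f \<in> Lp_space \<mu> p \<Longrightarrow> Lp_norm \<mu> p (U t f) \<le> K * Lp_norm \<mu> p f"
    using U_bounded by blast
  define C where "C = (measure \<mu> (space \<mu>) + 1) * (K + exp (lam0s * t))"
  have C: "0 \<le> C" using K(1) by (simp add: C_def)
  have bound: "\<bar>\<Phi> d\<bar> \<le> C * Lp_norm \<mu> p d" if d: "d \<in> Lp_space \<mu> p" for d
  proof -
    have b: "\<bar>\<integral>x. h x \<partial>\<mu>\<bar> \<le> (measure \<mu> (space \<mu>) + 1) * Lp_norm \<mu> p h" if "h \<in> Lp_space \<mu> p" for h
      using pairing_bound(2)[OF finite_mu p that, of "\<lambda>x. 1" 1] by (simp add: pairing_def)
    have "\<bar>\<Phi> d\<bar> \<le> \<bar>\<integral>x. U t d x \<partial>\<mu>\<bar> + exp (lam0s * t) * \<bar>\<integral>x. d x \<partial>\<mu>\<bar>"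
      unfolding \<Phi>_def by (rule order_trans[OF abs_triangle_ineq4]) (simp add: abs_mult)
    also have "\<dots> \<le> (measure \<mu> (space \<mu>) + 1) * (K * Lp_norm \<mu> p d) +
        exp (lam0s * t) * ((measure \<mu> (space \<mu>) + 1) * Lp_norm \<mu> p d)"
      using b[OF d] by (intro add_mono mult_left_mono order_trans[OF b[OF U_Lp[OF d]]] K(2)[OF d]) auto
    also have "\<dots> = C * Lp_norm \<mu> p d" by (simp add: C_def algebra_simps)
    finally show ?thesis .
  qed
  have "\<bar>\<Phi> f\<bar> \<le> e" if e: "e > 0" for e
  proof -
    have "e / (C + 1) > 0" using e C by simp
    then obtain g g' where g: "(g, g') \<in> generator \<mu> p U" "Lp_dist \<mu> p g f < e / (C + 1)"
      using dense f unfolding densely_defined_def by blast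
    note gL = generatorD(1)[OF g(1)]
    have d: "(\<lambda>x. g x - f x) \<in> Lp_space \<mu> p" using Lp_space_diff[OF p_nonneg gL f] .
    have int: "integrable \<mu> h" if "h \<in> Lp_space \<mu> p" for h by (rule Lp_L1_bound(1)[OF finite_mu p that])
    have "(\<integral>x. U t (\<lambda>x. g x - f x) x \<partial>\<mu>) = (\<integral>x. U t g x - U t f x \<partial>\<mu>)"
    proof (rule integral_cong_AE)
      show "AE x in \<mu>. U t (\<lambda>x. g x - f x) x = U t g x - U t f x"
        using U_linear[OF gL f, of t 1 "-1"] by simp
    qed (use d gL f in \<open>auto intro!: borel_measurable_diff U_measurable\<close>)
    then have "\<Phi> (\<lambda>x. g x - f x) = \<Phi> g - \<Phi> f"
      using int[OF U_Lp[OF gL]] int[OF U_Lp[OF f]] int[OF gL] int[OF f]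
      by (simp add: \<Phi>_def algebra_simps)
    moreover have "\<Phi> g = 0" using dom[OF g(1)] by (simp add: \<Phi>_def)
    ultimately have "\<bar>\<Phi> f\<bar> \<le> C * Lp_dist \<mu> p g f" using bound[OF d] by (simp add: Lp_dist_def)
    also have "\<dots> \<le> (C + 1) * Lp_dist \<mu> p g f"
      by (intro mult_right_mono) (auto simp: Lp_dist_def Lp_norm_nonneg)
    also have "\<dots> \<le> e" using g(2) C by (simp add: field_simps)
    finally show ?thesis .
  qed
  then have "\<bar>\<Phi> f\<bar> \<le> 0" by (rule field_le_epsilon) simp
  then show ?thesis by (simp add: \<Phi>_def)
qed

text \<open>
  The integral of \<open>U 1 1\<close> is computed once from each eigenvalue equation; the measure of the space is
  positive because the eigenvector does not vanish.
\<close>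

lemma eigenvalues_eq: "lam0s = lam0"
proof -
  have "(\<integral>x. U 1 (\<lambda>x. 1) x \<partial>\<mu>) = (\<integral>x. exp (lam0 * 1) * 1 \<partial>\<mu>)"
    using U_const[of 1 1] U_Lp[OF const_Lp, THEN Lp_spaceD(1)] by (intro integral_cong_AE) auto
  then show ?thesis using integral_U[OF const_Lp[of 1], of 1] measure_pos by simp
qed

text \<open>
  The price that the adjoint group assigns to a control is the mass times an exponential, since the
  marginal cost is constant in space.
\<close>

lemma pairing_adjoint_const:
  assumes V: "is_adjoint \<mu> p (U s) (V s)" and f: "f \<in> Lp_space \<mu> p"
  shows "pairing \<mu> (V s (\<lambda>x. c)) f = c * exp (lam0 * s) * (\<integral>x. f x \<partial>\<mu>)"
proof -
  have "(\<lambda>x. c) \<in> Lp_space \<mu> (conj_exponent p)"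
    using p by (intro Lp_space_bounded[OF finite_mu, where B = "\<bar>c\<bar>"]) (auto simp: conj_exponent_def)
  then have "pairing \<mu> (V s (\<lambda>x. c)) f = pairing \<mu> (\<lambda>x. c) (U s f)"
    using V f by (simp add: is_adjoint_def)
  then show ?thesis by (simp add: pairing_const integral_U[OF f] eigenvalues_eq)
qed

end

section \<open>The mass of a control\<close>

definition mass :: "'d measure \<Rightarrow> (real \<Rightarrow> 'd \<Rightarrow> real) \<Rightarrow> real \<Rightarrow> real" where
  "mass \<mu> n t = (\<integral>x. n t x \<partial>\<mu>)"

lemma integral_Lp_bound:
  assumes "finite_measure \<mu>" "1 < p" "f \<in> Lp_space \<mu> p"
  shows "\<bar>\<integral>x. f x \<partial>\<mu>\<bar> \<le> (measure \<mu> (space \<mu>) + 1) * Lp_norm \<mu> p f"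
  using pairing_bound(2)[OF assms, of "\<lambda>x. 1" 1] by (simp add: pairing_def)

lemma integral_Lp_dist_bound:
  assumes "finite_measure \<mu>" "1 < p" "f \<in> Lp_space \<mu> p" "g \<in> Lp_space \<mu> p"
  shows "\<bar>(\<integral>x. f x \<partial>\<mu>) - (\<integral>x. g x \<partial>\<mu>)\<bar> \<le> (measure \<mu> (space \<mu>) + 1) * Lp_dist \<mu> p f g"
  using integral_Lp_bound[OF assms(1,2) Lp_space_diff[OF _ assms(3,4)]] assms
    Lp_L1_bound(1)[OF assms(1-3)] Lp_L1_bound(1)[OF assms(1,2,4)]
  by (simp add: Lp_dist_def)

lemma Lp_space_sum:
  assumes "finite_measure \<mu>" "0 \<le> p" "finite S" "\<And>v. v \<in> S \<Longrightarrow> f v \<in> Lp_space \<mu> p"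
  shows "(\<lambda>x. \<Sum>v\<in>S. f v x) \<in> Lp_space \<mu> p"
  using assms(3,4)
proof (induction S rule: finite_induct)
  case empty
  show ?case using Lp_space_bounded[OF assms(1,2), of "\<lambda>x. 0" 0] by simp
next
  case (insert v S)
  then show ?case by (simp add: Lp_space_add[OF assms(2)])
qed

text \<open>
  Integration over space commutes with the Bochner integral over time. The function \<open>t \<mapsto> \<integral> f t\<close> itself need
  not be Borel measurable, only a modification on a null set is.
\<close>

lemma Lp_has_integral_imp_integral:
  assumes mu: "finite_measure \<mu>" "1 < p" and m: "sets m = sets borel"
    and int: "Lp_has_integral \<mu> p m f I"
  obtains h where "has_bochner_integral m h (\<integral>x. I x \<partial>\<mu>)" "AE t in m. h t = (\<integral>x. f t x \<partial>\<mu>)"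
proof -
  have space [simp]: "space m = UNIV" using sets_eq_imp_space_eq[OF m] by simp
  obtain s where I: "I \<in> Lp_space \<mu> p" and f: "\<And>t. f t \<in> Lp_space \<mu> p"
    and s: "\<And>i. finite (range (s i))" "\<And>i t. s i t \<in> Lp_space \<mu> p"
      "\<And>i v. {t. s i t = v} \<in> sets m"
      "\<And>i. emeasure m {t. s i t \<noteq> (\<lambda>x. 0)} < \<infinity>"
      "\<And>i. (\<lambda>t. Lp_dist \<mu> p (f t) (s i t)) \<in> borel_measurable m"
    and lim: "(\<lambda>i. \<integral>\<^sup>+t. ennreal (Lp_dist \<mu> p (f t) (s i t)) \<partial>m) \<longlonglongrightarrow> 0"
      "(\<lambda>i. Lp_dist \<mu> p (\<lambda>x. \<Sum>v\<in>range (s i). measure m {t. s i t = v} * v x) I) \<longlonglongrightarrow> 0"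
  proof -
    from int obtain s where "I \<in> Lp_space \<mu> p" "\<forall>t. f t \<in> Lp_space \<mu> p"
      and s: "\<forall>i. finite (range (s i)) \<and> range (s i) \<subseteq> Lp_space \<mu> p \<and>
             (\<forall>v. {t. s i t = v} \<in> sets m) \<and> emeasure m {t. s i t \<noteq> (\<lambda>x. 0)} < \<infinity> \<and>
             (\<lambda>t. Lp_dist \<mu> p (f t) (s i t)) \<in> borel_measurable m"
        "(\<lambda>i. \<integral>\<^sup>+t. ennreal (Lp_dist \<mu> p (f t) (s i t)) \<partial>m) \<longlonglongrightarrow> 0"
        "(\<lambda>i. Lp_dist \<mu> p (\<lambda>x. \<Sum>v\<in>range (s i). measure m {t. s i t = v} * v x) I) \<longlonglongrightarrow> 0"
      unfolding Lp_has_integral_def space by auto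
    then show thesis by (intro that[of s]) (blast | simp)+
  qed
  define C where "C = measure \<mu> (space \<mu>) + 1"
  have C: "C > 0" by (simp add: C_def add_nonneg_pos)
  define d where "d i t = Lp_dist \<mu> p (f t) (s i t)" for i t
  define J where "J i t = (\<integral>x. s i t x \<partial>\<mu>)" for i t
  define F where "F t = (\<integral>x. f t x \<partial>\<mu>)" for t
  have d0: "0 \<le> d i t" for i t by (simp add: d_def Lp_dist_def Lp_norm_nonneg)
  have [measurable]: "d i \<in> borel_measurable m" for i using s(5) by (simp add: d_def[abs_def])
  have FJ: "\<bar>F t - J i t\<bar> \<le> C * d i t" for i t
    unfolding F_def J_def C_def d_def by (rule integral_Lp_dist_bound[OF mu f s(2)])
  have simple_s: "simple_function m (s i)" for i
    unfolding simple_function_def using s(1,3) by (auto simp: vimage_def)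
  have simple_J: "simple_function m (J i)" for i
    using simple_function_compose2[OF simple_s[of i] simple_s[of i], of "\<lambda>v _. \<integral>x. v x \<partial>\<mu>"]
    by (simp add: J_def[abs_def])
  have [measurable]: "J i \<in> borel_measurable m" for i
    by (rule borel_measurable_simple_function[OF simple_J])
  have J_int: "Bochner_Integration.simple_bochner_integrable m (J i)" for i
  proof -
    have "{t. s i t \<noteq> (\<lambda>x. 0)} = space m - {t. s i t = (\<lambda>x. 0)}" by auto
    then have "{t. s i t \<noteq> (\<lambda>x. 0)} \<in> sets m" using s(3)[of i "\<lambda>x. 0"] by (simp only: sets.compl_sets)
    then have "emeasure m {t\<in>space m. J i t \<noteq> 0} \<le> emeasure m {t. s i t \<noteq> (\<lambda>x. 0)}"
      by (intro emeasure_mono) (auto simp: J_def)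
    then have "emeasure m {t\<in>space m. J i t \<noteq> 0} \<noteq> \<infinity>"
      using s(4)[of i] by (metis infinity_ennreal_def leD less_top)
    with simple_J[of i] show ?thesis by (simp add: simple_bochner_integrable.simps)
  qed
  \<comment> \<open>\<open>F\<close> lies below every \<open>J i + C * d i\<close>, and their infimum equals it where \<open>d i\<close> comes close to \<open>0\<close>\<close>
  define h where "h t = (INF i. J i t + C * d i t)" for t
  have F_le: "F t \<le> J i t + C * d i t" for i t using FJ[of t i] by simp
  have bdd: "bdd_below (range (\<lambda>i. J i t + C * d i t))" for t
    by (rule bdd_belowI2[of _ "F t"]) (rule F_le)
  have [measurable]: "h \<in> borel_measurable m"
    unfolding h_def by (rule borel_measurable_cINF) (auto intro: bdd)
  have "(\<integral>\<^sup>+t. (INF i. ennreal (d i t)) \<partial>m) \<le> (\<integral>\<^sup>+t. ennreal (d i t) \<partial>m)" for i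
    by (intro nn_integral_mono INF_lower) simp
  then have "(\<integral>\<^sup>+t. (INF i. ennreal (d i t)) \<partial>m) \<le> 0"
    using lim(1) unfolding d_def[symmetric] by (rule_tac LIMSEQ_le_const) auto
  then have "AE t in m. (INF i. ennreal (d i t)) = 0"
    by (simp add: nn_integral_0_iff_AE)
  then have AE_h: "AE t in m. h t = F t"
  proof eventually_elim
    case (elim t)
    have "h t \<le> F t + e" if "e > 0" for e
    proof -
      have "(INF i. ennreal (d i t)) < ennreal (e / (2 * C))" using that C elim by simp
      then obtain i where "d i t < e / (2 * C)"
        unfolding INF_less_iff by (auto simp: ennreal_less_iff d0)
      then have "2 * (C * d i t) < e" using C by (simp add: field_simps)
      moreover have "h t \<le> J i t + C * d i t" unfolding h_def by (rule cINF_lower[OF bdd]) simp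
      ultimately show ?thesis using FJ[of t i] by simp
    qed
    then have "h t \<le> F t" by (rule field_le_epsilon)
    moreover have "F t \<le> h t" unfolding h_def by (rule cINF_greatest) (auto intro: F_le)
    ultimately show ?case by simp
  qed
  have "has_bochner_integral m h (\<integral>x. I x \<partial>\<mu>)"
  proof (rule has_bochner_integral.intros[of _ _ J, OF _ J_int])
    show "(\<lambda>i. \<integral>\<^sup>+t. norm (h t - J i t) \<partial>m) \<longlonglongrightarrow> 0"
    proof (rule tendsto_sandwich[OF _ _ tendsto_const])
      have "(\<integral>\<^sup>+t. norm (h t - J i t) \<partial>m) \<le> ennreal C * (\<integral>\<^sup>+t. ennreal (d i t) \<partial>m)" for i
      proof -
        have "(\<integral>\<^sup>+t. norm (h t - J i t) \<partial>m) \<le> (\<integral>\<^sup>+t. ennreal C * ennreal (d i t) \<partial>m)"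
        proof (rule nn_integral_mono_AE)
          show "AE t in m. ennreal (norm (h t - J i t)) \<le> ennreal C * ennreal (d i t)"
            using AE_h
          proof eventually_elim
            case (elim t)
            then show ?case
              using FJ[of t i] C d0[of i t] by (simp add: ennreal_mult[symmetric] ennreal_leI)
          qed
        qed
        then show ?thesis by (simp add: nn_integral_cmult)
      qed
      then show "\<forall>\<^sub>F i in sequentially. (\<integral>\<^sup>+t. norm (h t - J i t) \<partial>m) \<le> ennreal C * (\<integral>\<^sup>+t. ennreal (d i t) \<partial>m)"
        by (auto intro: always_eventually)
      show "(\<lambda>i. ennreal C * (\<integral>\<^sup>+t. ennreal (d i t) \<partial>m)) \<longlonglongrightarrow> 0"
        using ennreal_tendsto_cmult[OF _ lim(1), of "ennreal C"] by (simp add: d_def)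
    qed auto
    show "(\<lambda>i. Bochner_Integration.simple_bochner_integral m (J i)) \<longlonglongrightarrow> (\<integral>x. I x \<partial>\<mu>)"
    proof (rule LIM_zero_cancel)
      have le: "norm (Bochner_Integration.simple_bochner_integral m (J i) - (\<integral>x. I x \<partial>\<mu>))
          \<le> C * Lp_dist \<mu> p (\<lambda>x. \<Sum>v\<in>range (s i). measure m {t. s i t = v} * v x) I" for i
      proof -
        have vL: "v \<in> Lp_space \<mu> p" if "v \<in> range (s i)" for v using s(2) that by auto
        have "Bochner_Integration.simple_bochner_integral m (J i) =
            (\<Sum>v\<in>s i ` space m. measure m {t\<in>space m. s i t = v} *\<^sub>R (\<integral>x. v x \<partial>\<mu>))"
          by (rule simple_bochner_integral_partition[OF J_int simple_s]) (simp_all add: J_def)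
        also have "\<dots> = (\<integral>x. (\<Sum>v\<in>range (s i). measure m {t. s i t = v} * v x) \<partial>\<mu>)"
          using Lp_L1_bound(1)[OF mu vL] by simp
        finally show ?thesis
          unfolding C_def real_norm_def
          by (simp only:) (intro integral_Lp_dist_bound[OF mu _ I] Lp_space_sum[OF mu(1)] s(1) Lp_space_cmult vL;
              use mu(2) in simp)
      qed
      show "(\<lambda>i. Bochner_Integration.simple_bochner_integral m (J i) - (\<integral>x. I x \<partial>\<mu>)) \<longlonglongrightarrow> 0"
        by (rule Lim_null_comparison[OF always_eventually, OF allI, OF le])
          (use tendsto_mult_left[OF lim(2), of C] in simp)
    qed
  qed simp
  then show thesis using AE_h that by (simp add: F_def)
qed

text \<open>
  Integrating the density over space gives a density of the mass. One function serves all \<open>t\<close>: it is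
  the limit of the versions for the intervals \<open>[0, k]\<close>.
\<close>

lemma is_density_mass:
  assumes mu: "finite_measure \<mu>" "1 < p" and dens: "is_density \<mu> p n \<rho>"
  obtains h where "h \<in> borel_measurable borel"
    "AE s in variation_measure \<mu> p n. 0 \<le> s \<longrightarrow> h s = ennreal (\<integral>x. \<rho> s x \<partial>\<mu>)"
    "\<And>t. 0 \<le> t \<Longrightarrow> (\<integral>\<^sup>+s\<in>{0..t}. h s \<partial>variation_measure \<mu> p n) = ennreal (mass \<mu> n t)"
proof -
  define m where "m = variation_measure \<mu> p n"
  have m: "sets m = sets borel" by (simp add: m_def variation_measure_def)
  note [measurable_cong] = m
  define R where "R s = (\<integral>x. \<rho> s x \<partial>\<mu>)" for s
  have R0: "0 \<le> R s" if "0 \<le> s" for s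
    unfolding R_def using dens that by (intro integral_nonneg_AE) (auto simp: is_density_def Lp_cone_def)
  have "\<exists>g. \<forall>t. 0 \<le> t \<longrightarrow> has_bochner_integral m (g t) (mass \<mu> n t) \<and> (AE s in m. g t s = indicator {0..t} s * R s)"
  proof (intro choice allI)
    fix t :: real
    show "\<exists>g. 0 \<le> t \<longrightarrow> has_bochner_integral m g (mass \<mu> n t) \<and> (AE s in m. g s = indicator {0..t} s * R s)"
    proof (cases "0 \<le> t")
      case True
      then have "Lp_has_integral \<mu> p m (\<lambda>s x. indicator {0..t} s * \<rho> s x) (n t)"
        using dens by (simp add: is_density_def m_def)
      then obtain g where "has_bochner_integral m g (\<integral>x. n t x \<partial>\<mu>)"
          "AE s in m. g s = (\<integral>x. indicator {0..t} s * \<rho> s x \<partial>\<mu>)"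
        using Lp_has_integral_imp_integral[OF mu m] by blast
      then show ?thesis by (intro exI[of _ g]) (simp add: mass_def R_def)
    qed simp
  qed
  then obtain g where g: "\<And>t. 0 \<le> t \<Longrightarrow> has_bochner_integral m (g t) (mass \<mu> n t)"
      "\<And>t. 0 \<le> t \<Longrightarrow> AE s in m. g t s = indicator {0..t} s * R s"
    by blast
  have g_meas: "g (real k) \<in> borel_measurable m" for k
    using g(1)[of "real k"] by (simp add: has_bochner_integral.simps)
  define h where "h s = lim (\<lambda>k. g (real k) s)" for s
  have h_meas: "h \<in> borel_measurable m"
    unfolding h_def by (rule borel_measurable_lim_metric[OF g_meas])
  have "AE s in m. \<forall>k. g (real k) s = indicator {0..real k} s * R s"
    unfolding AE_all_countable using g(2) by simp
  then have h: "AE s in m. 0 \<le> s \<longrightarrow> h s = R s"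
  proof eventually_elim
    case (elim s)
    show ?case
    proof
      assume "0 \<le> s"
      have "\<forall>\<^sub>F k in sequentially. s \<le> real k"
        using eventually_ge_at_top[of "nat \<lceil>s\<rceil>"] by eventually_elim linarith
      then have "\<forall>\<^sub>F k in sequentially. g (real k) s = R s"
        by eventually_elim (use elim \<open>0 \<le> s\<close> in simp)
      then show "h s = R s" unfolding h_def by (intro limI tendsto_eventually)
    qed
  qed
  show thesis
  proof (rule that[of "\<lambda>s. ennreal (h s)"])
    show "(\<lambda>s. ennreal (h s)) \<in> borel_measurable borel"
      using h_meas by (simp add: measurable_cong_sets[OF m refl])
    show "AE s in variation_measure \<mu> p n. 0 \<le> s \<longrightarrow> ennreal (h s) = ennreal (\<integral>x. \<rho> s x \<partial>\<mu>)"
      using h unfolding m_def[symmetric] by eventually_elim (simp add: R_def)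
    fix t :: real assume t: "0 \<le> t"
    have "(\<integral>\<^sup>+s\<in>{0..t}. ennreal (h s) \<partial>m) = (\<integral>\<^sup>+s. ennreal (g t s) \<partial>m)"
    proof (rule nn_integral_cong_AE)
      show "AE s in m. ennreal (h s) * indicator {0..t} s = ennreal (g t s)"
        using h g(2)[OF t]
      proof eventually_elim
        case (elim s)
        then show ?case by (cases "s \<in> {0..t}") simp_all
      qed
    qed
    also have "\<dots> = ennreal (mass \<mu> n t)"
    proof -
      have "AE s in m. 0 \<le> g t s" using g(2)[OF t]
      proof eventually_elim
        case (elim s)
        then show ?case using R0[of s] by (cases "s \<in> {0..t}") simp_all
      qed
      then show ?thesis
        using g(1)[OF t] by (simp add: nn_integral_eq_integral has_bochner_integral_iff)
    qed
    finally show "(\<integral>\<^sup>+s\<in>{0..t}. ennreal (h s) \<partial>variation_measure \<mu> p n) = ennreal (mass \<mu> n t)"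
      by (simp add: m_def)
  qed
qed

text \<open>
  The variation of a path enters through the density, which determines the Stieltjes measure of the mass.
\<close>

definition control_path :: "'d measure \<Rightarrow> real \<Rightarrow> (real \<Rightarrow> 'd \<Rightarrow> real) \<Rightarrow> bool" where
  "control_path \<mu> p n \<longleftrightarrow> (\<forall>t\<ge>0. n t \<in> Lp_cone \<mu> p) \<and>
     (\<forall>s t. 0 \<le> s \<and> s \<le> t \<longrightarrow> (AE x in \<mu>. n s x \<le> n t x)) \<and>
     (\<forall>t\<ge>0. ((\<lambda>s. Lp_dist \<mu> p (n s) (n t)) \<longlongrightarrow> 0) (at_right t)) \<and>
     (\<exists>\<rho>. is_density \<mu> p n \<rho>)"

lemma nondecreasing_rc_mass:
  assumes mu: "finite_measure \<mu>" "1 < p" and n: "control_path \<mu> p n"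
  shows "nondecreasing_rc (mass \<mu> n)"
  unfolding nondecreasing_rc_def
proof (intro conjI allI impI)
  have L: "n t \<in> Lp_space \<mu> p" if "0 \<le> t" for t
    using n that Lp_cone_subset by (auto simp: control_path_def)
  show "0 \<le> mass \<mu> n 0"
    using n by (auto simp: mass_def control_path_def Lp_cone_def intro!: integral_nonneg_AE)
  fix s t :: real
  show "mass \<mu> n s \<le> mass \<mu> n t" if "0 \<le> s \<and> s \<le> t"
    unfolding mass_def using that n
    by (intro integral_mono_AE Lp_L1_bound(1)[OF mu L]) (auto simp: control_path_def)
  show "(mass \<mu> n \<longlongrightarrow> mass \<mu> n t) (at_right t)" if t: "0 \<le> t"
  proof -
    have "((\<lambda>s. (measure \<mu> (space \<mu>) + 1) * Lp_dist \<mu> p (n s) (n t)) \<longlongrightarrow> 0) (at_right t)"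
      using tendsto_mult_left[of "\<lambda>s. Lp_dist \<mu> p (n s) (n t)" 0 "at_right t"] n t
      by (auto simp: control_path_def)
    moreover have "\<forall>\<^sub>F s in at_right t. norm (mass \<mu> n s - mass \<mu> n t) \<le> (measure \<mu> (space \<mu>) + 1) * Lp_dist \<mu> p (n s) (n t)"
      unfolding eventually_at_right_field mass_def real_norm_def
      using t by (intro exI[of _ "t + 1"]) (auto intro!: integral_Lp_dist_bound[OF mu] L)
    ultimately have "((\<lambda>s. mass \<mu> n s - mass \<mu> n t) \<longlongrightarrow> 0) (at_right t)"
      by (rule Lim_null_comparison[rotated])
    then show ?thesis by (simp add: LIM_zero_iff)
  qed
qed

text \<open>
  The chosen density enters only through its integral over space, which is the density of \<open>dn\<close> with respect
  to the variation measure. The cost is therefore a Stieltjes integral against the mass, to which the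
  time change applies.
\<close>

lemma (in constant_eigenvector_group) path_integral_eq_time_change:
  assumes V: "\<And>t. is_adjoint \<mu> p (U t) (V t)" and n: "control_path \<mu> p n"
    and c [measurable]: "(\<lambda>s. c (max 0 s)) \<in> borel_measurable borel" and c0: "\<And>s. 0 \<le> s \<Longrightarrow> 0 \<le> c s"
  shows "path_integral \<mu> p (\<lambda>t. V t (\<lambda>x. exp (- r * t) * c t)) n =
    (\<integral>\<^sup>+u\<in>{0..}. at_finite (\<lambda>s. ennreal (exp (- (r - lam0s) * s) * c s)) (time_change (mass \<mu> n) u) \<partial>lborel)"
proof -
  define m where "m = variation_measure \<mu> p n"
  have m: "sets m = sets borel" by (simp add: m_def variation_measure_def)
  note [measurable_cong] = m
  define \<rho> where "\<rho> = (SOME \<rho>. is_density \<mu> p n \<rho>)"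
  have "\<exists>\<rho>. is_density \<mu> p n \<rho>" using n unfolding control_path_def by blast
  then have dens: "is_density \<mu> p n \<rho>"
    unfolding \<rho>_def by (rule someI_ex)
  obtain h where [measurable]: "h \<in> borel_measurable borel"
    and h: "AE s in m. 0 \<le> s \<longrightarrow> h s = ennreal (\<integral>x. \<rho> s x \<partial>\<mu>)"
    "\<And>t. 0 \<le> t \<Longrightarrow> (\<integral>\<^sup>+s\<in>{0..t}. h s \<partial>m) = ennreal (mass \<mu> n t)"
    using is_density_mass[OF finite_mu p dens] unfolding m_def by blast
  have rhoL: "\<rho> s \<in> Lp_space \<mu> p" if "0 \<le> s" for s
    using dens that Lp_cone_subset by (auto simp: is_density_def)
  have rho0: "0 \<le> (\<integral>x. \<rho> s x \<partial>\<mu>)" if "0 \<le> s" for s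
    using dens that by (intro integral_nonneg_AE) (auto simp: is_density_def Lp_cone_def)
  define f where "f s = ennreal (exp (- (r - lam0s) * max 0 s) * c (max 0 s))" for s
  have [measurable]: "f \<in> borel_measurable borel" unfolding f_def by measurable
  define M where "M = density m h"
  have "path_integral \<mu> p (\<lambda>t. V t (\<lambda>x. exp (- r * t) * c t)) n =
      (\<integral>\<^sup>+s\<in>{0..}. ennreal (pairing \<mu> (V s (\<lambda>x. exp (- r * s) * c s)) (\<rho> s)) \<partial>m)"
    by (simp add: path_integral_def \<rho>_def m_def)
  also have "\<dots> = (\<integral>\<^sup>+s. h s * (f s * indicator {0..} s) \<partial>m)"
  proof (rule nn_integral_cong_AE)
    show "AE s in m. ennreal (pairing \<mu> (V s (\<lambda>x. exp (- r * s) * c s)) (\<rho> s)) * indicator {0..} s =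
        h s * (f s * indicator {0..} s)"
      using h(1)
    proof eventually_elim
      case (elim s)
      show ?case
      proof (cases "0 \<le> s")
        case True
        have "pairing \<mu> (V s (\<lambda>x. exp (- r * s) * c s)) (\<rho> s) =
            (exp (- r * s) * exp (lam0 * s)) * c s * (\<integral>x. \<rho> s x \<partial>\<mu>)"
          using pairing_adjoint_const[where V = V and s = s and c = "exp (- r * s) * c s", OF V rhoL[OF True]]
          by (simp only: mult_ac)
        also have "exp (- r * s) * exp (lam0 * s) = exp (- (r - lam0s) * s)"
          by (simp add: eigenvalues_eq algebra_simps flip: exp_add)
        finally show ?thesis
          using True elim c0[OF True] rho0[OF True] by (simp add: f_def ennreal_mult mult_ac)
      qed simp
    qed
  qed
  also have "\<dots> = (\<integral>\<^sup>+s\<in>{0..}. f s \<partial>M)"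
    by (simp add: M_def nn_integral_density)
  also have "\<dots> = (\<integral>\<^sup>+u\<in>{0..}. at_finite f (time_change (mass \<mu> n) u) \<partial>lborel)"
  proof (rule nn_integral_time_change[OF nondecreasing_rc_mass[OF finite_mu p n]])
    show "emeasure M {0..t} = ennreal (mass \<mu> n t)" if "0 \<le> t" for t
      using h(2)[OF that] by (simp add: M_def emeasure_density)
  qed (simp_all add: M_def m)
  also have "\<dots> = (\<integral>\<^sup>+u\<in>{0..}. at_finite (\<lambda>s. ennreal (exp (- (r - lam0s) * s) * c s)) (time_change (mass \<mu> n) u) \<partial>lborel)"
    by (intro nn_integral_cong) (auto simp: at_finite_def f_def)
  finally show ?thesis .
qed

section \<open>Stopping times and the backward equation\<close>

lemma (in complete_measure) borel_measurable_cong_AE_complete: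
  fixes f g :: "'a \<Rightarrow> 'b::topological_space"
  assumes "g \<in> borel_measurable M" "AE x in M. f x = g x"
  shows "f \<in> borel_measurable M"
proof (rule measurableI)
  fix B :: "'b set" assume "B \<in> sets borel"
  then have A: "g -` B \<inter> space M \<in> sets M" using assms(1) by (rule measurable_sets[rotated])
  have ae: "AE x in M. x \<in> g -` B \<inter> space M \<longleftrightarrow> x \<in> f -` B \<inter> space M"
    using assms(2) by eventually_elim auto
  show "f -` B \<inter> space M \<in> sets M" by (rule in_sets_AE[OF ae A]) (rule Int_lower2)
qed simp

locale filtered_space =
  fixes P :: "'w measure" and F :: "ennreal \<Rightarrow> 'w measure"
  assumes usual: "usual_conditions P F"
begin

sublocale prob_space P using usual by (simp add: usual_conditions_def)
sublocale complete_measure P using usual by (simp add: usual_conditions_def)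
sublocale filtration "space P" F using usual by (simp add: usual_conditions_def)

lemma subalg_F: "subalgebra P (F t)"
  using usual by (simp add: usual_conditions_def)

lemma null_sets_F: "null_sets P \<subseteq> sets (F t)"
proof -
  have "null_sets P \<subseteq> sets (F 0)" using usual unfolding usual_conditions_def by blast
  also have "\<dots> \<subseteq> sets (F t)" by (rule sets_F_mono) simp
  finally show ?thesis .
qed

lemma right_continuous_F: "t < \<infinity> \<Longrightarrow> sets (F t) = (\<Inter>s\<in>{t<..}. sets (F s))"
  using usual by (simp add: usual_conditions_def)

lemma stopping_time_measurable: "stopping_time F \<tau> \<Longrightarrow> \<tau> \<in> borel_measurable P"
  using subalg_F by (intro measurable_stopping_time[of F]) (auto simp: subalgebra_def)

text \<open>
  The event \<open>\<tau> \<le> t\<close> is the intersection of the events \<open>\<tau> < c\<close> for \<open>c\<close> decreasing to \<open>t\<close>, and the filtration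
  is right-continuous.
\<close>

lemma stopping_timeI_less:
  assumes less: "\<And>t. t < \<infinity> \<Longrightarrow> {\<omega>\<in>space P. \<tau> \<omega> < t} \<in> sets (F t)"
  shows "stopping_time F \<tau>"
proof
  fix t
  have "{\<omega>\<in>space P. \<tau> \<omega> \<le> t} \<in> sets (F t)"
  proof (cases "t = \<infinity>")
    case True
    then show ?thesis using sets.top[of "F t"] by (simp add: space_F)
  next
    case False
    then have t: "t < \<infinity>" by (simp add: less_top)
    have "{\<omega>\<in>space P. \<tau> \<omega> \<le> t} \<in> sets (F s)" if s: "t < s" for s
    proof -
      obtain c :: "nat \<Rightarrow> ennreal" where c: "\<And>i. t < c i" "\<And>i. c i < s" "c \<longlonglongrightarrow> t"
      proof -
        obtain d where d: "t < d" "d < s" using dense[OF s] by blast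
        obtain e :: "nat \<Rightarrow> ennreal" where e: "\<And>i. t < e i" "e \<longlonglongrightarrow> t"
          using approx_from_above_dense_linorder[OF s] by blast
        have "(\<lambda>i. min (e i) d) \<longlonglongrightarrow> min t d" by (intro tendsto_intros e)
        moreover have "min t d = t" using d by simp
        ultimately show thesis using d e(1) by (intro that[of "\<lambda>i. min (e i) d"]) (simp_all add: min_less_iff_disj)
      qed
      have "{\<omega>\<in>space P. \<tau> \<omega> \<le> t} = (\<Inter>i. {\<omega>\<in>space P. \<tau> \<omega> < c i})"
      proof (intro equalityI subsetI)
        fix \<omega> assume *: "\<omega> \<in> (\<Inter>i. {\<omega>\<in>space P. \<tau> \<omega> < c i})"
        then have "\<tau> \<omega> \<le> t" by (intro LIMSEQ_le_const[OF c(3)]) (auto intro: less_imp_le)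
        with * show "\<omega> \<in> {\<omega>\<in>space P. \<tau> \<omega> \<le> t}" by auto
      qed (use c(1) in \<open>auto intro: le_less_trans\<close>)
      also have "\<dots> \<in> sets (F s)"
      proof (rule sets.countable_INT)
        show "range (\<lambda>i. {\<omega>\<in>space P. \<tau> \<omega> < c i}) \<subseteq> sets (F s)"
        proof clarify
          fix i
          have "c i < \<infinity>" "c i \<le> s" using c(2)[of i] by (auto simp: less_top intro: less_le_trans)
          then show "{\<omega>\<in>space P. \<tau> \<omega> < c i} \<in> sets (F s)"
            using less sets_F_mono by blast
        qed
      qed simp
      finally show ?thesis .
    qed
    then show ?thesis using right_continuous_F[OF t] by auto
  qed
  then show "Measurable.pred (F t) (\<lambda>\<omega>. \<tau> \<omega> \<le> t)" by (simp add: pred_def space_F)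
qed

lemma stopping_time_time_change:
  assumes N: "\<And>t. 0 \<le> t \<Longrightarrow> N t \<in> borel_measurable (F (ennreal t))"
  shows "stopping_time F (\<lambda>\<omega>. time_change (\<lambda>t. N t \<omega>) u)"
proof (rule stopping_timeI_less)
  fix t :: ennreal
  let ?Q = "{q\<in>\<rat>. 0 \<le> q \<and> ennreal q < t}"
  have "{\<omega>\<in>space P. time_change (\<lambda>t. N t \<omega>) u < t} = (\<Union>q\<in>?Q. {\<omega>\<in>space P. u < N q \<omega>})"
    by (auto simp: time_change_less_iff)
  also have "\<dots> \<in> sets (F t)"
  proof (rule sets.countable_UN'')
    show "countable ?Q" by (rule countable_subset[OF _ countable_rat]) auto
    fix q assume q: "q \<in> ?Q"
    then have "{\<omega>\<in>space P. u < N q \<omega>} \<in> sets (F (ennreal q))"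
      using measurable_sets[OF N[of q], of "{u<..}"] by (simp add: vimage_def space_F Collect_conj_eq Int_commute)
    then show "{\<omega>\<in>space P. u < N q \<omega>} \<in> sets (F t)"
      using sets_F_mono[OF less_imp_le, of "ennreal q" t] q by auto
  qed
  finally show "{\<omega>\<in>space P. time_change (\<lambda>t. N t \<omega>) u < t} \<in> sets (F t)" .
qed

lemma subalg_pre_sigma:
  assumes "stopping_time F \<tau>"
  shows "subalgebra P (pre_sigma \<tau>)"
proof -
  have "A \<in> sets P" if "A \<in> sets (pre_sigma \<tau>)" for A
    using sets_pre_sigmaD[OF assms that, of \<infinity>] subalg_F[of \<infinity>] by (auto simp: subalgebra_def)
  then show ?thesis by (auto simp: subalgebra_def space_pre_sigma)
qed

lemma expectation_nn_cond_exp_pre_sigma: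
  assumes "stopping_time F \<tau>" "f \<in> borel_measurable P"
  shows "(\<integral>\<^sup>+\<omega>. nn_cond_exp P (pre_sigma \<tau>) f \<omega> \<partial>P) = (\<integral>\<^sup>+\<omega>. f \<omega> \<partial>P)"
proof -
  interpret S: finite_measure_subalgebra P "pre_sigma \<tau>"
    by unfold_locales (rule subalg_pre_sigma[OF assms(1)])
  show ?thesis using S.nn_cond_exp_intg[of "\<lambda>_. 1" f] assms(2) by simp
qed

end

section \<open>Suprema since a random time\<close>

definition base_process :: "real \<Rightarrow> (real \<Rightarrow> 'w \<Rightarrow> real) \<Rightarrow> real \<Rightarrow> 'w \<Rightarrow> real" where
  "base_process lam0 l t \<omega> = exp (- lam0 * t) * l t \<omega>"

lemma running_sup_eq: "running_sup lam0 l s t \<omega> = (SUP u\<in>{s..t}. base_process lam0 l u \<omega>)"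
  by (simp add: running_sup_def base_process_def)

definition base_path :: "(real \<Rightarrow> real) \<Rightarrow> bool" where
  "base_path x \<longleftrightarrow> (\<forall>t\<ge>0. 0 < x t) \<and> right_usc x \<and> (\<forall>t\<ge>0. bdd_above (x ` {0..t}))"

lemma base_path_running_sup_mono:
  assumes "base_path x" "0 \<le> s" "s \<le> s'" "s' \<le> t" "t \<le> t'"
  shows "(SUP u\<in>{s'..t}. x u) \<le> (SUP u\<in>{s..t'}. x u)" "0 < (SUP u\<in>{s'..t}. x u)"
proof -
  have bdd: "bdd_above (x ` {a..b})" if "0 \<le> a" "0 \<le> b" for a b
    using assms(1) that by (auto simp: base_path_def intro: bdd_above_mono[of "x ` {0..b}"])
  show "(SUP u\<in>{s'..t}. x u) \<le> (SUP u\<in>{s..t'}. x u)"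
    using assms by (intro cSUP_subset_mono bdd) auto
  have "x t \<le> (SUP u\<in>{s'..t}. x u)" using assms by (intro cSUP_upper bdd) auto
  moreover have "0 < x t" using assms by (auto simp: base_path_def)
  ultimately show "0 < (SUP u\<in>{s'..t}. x u)" by linarith
qed

text \<open>
  Suprema over \<open>[c, t]\<close> become suprema over the fixed interval \<open>[0, t]\<close> when the path is set to \<open>0\<close> before \<open>c\<close>.
\<close>

definition started :: "ennreal \<Rightarrow> (real \<Rightarrow> real) \<Rightarrow> real \<Rightarrow> real" where
  "started c x u = (if c \<le> ennreal u then x u else 0)"

lemma started_bdd: "base_path x \<Longrightarrow> 0 \<le> t \<Longrightarrow> bdd_above (started c x ` {0..t})"
proof -
  assume x: "base_path x" and t: "0 \<le> t"
  then have "bdd_above (x ` {0..t})" by (simp add: base_path_def)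
  then obtain B where B: "\<And>u. u \<in> {0..t} \<Longrightarrow> x u \<le> B" unfolding bdd_above_def by blast
  show ?thesis
  proof (rule bdd_aboveI2[of _ _ "max 0 B"])
    show "started c x u \<le> max 0 B" if "u \<in> {0..t}" for u
      using B[OF that] by (simp add: started_def le_max_iff_disj)
  qed
qed

lemma started_right_usc:
  assumes "base_path x"
  shows "right_usc (started c x)"
  unfolding right_usc_def
proof (intro allI impI)
  fix t k :: real assume t: "0 \<le> t" "started c x t < k"
  show "\<forall>\<^sub>F u in at_right t. started c x u < k"
  proof (cases "c \<le> ennreal t")
    case True
    then have "\<forall>\<^sub>F u in at_right t. x u < k"
      using assms t by (auto simp: base_path_def right_usc_def started_def)
    moreover have "0 < x t" using assms t by (auto simp: base_path_def)
    ultimately show ?thesis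
      using True t(2) by (auto elim!: eventually_mono simp: started_def)
  next
    case False
    then obtain b where b: "t < b" "\<And>u. u < b \<Longrightarrow> \<not> c \<le> ennreal u"
    proof (cases c)
      case (real r)
      then show thesis using False t that[of r] by (auto simp: ennreal_le_iff2 not_le)
    next
      case top
      then show thesis using that[of "t + 1"] by (simp add: top_unique)
    qed
    then show ?thesis
      using t(2) False unfolding eventually_at_right_field
      by (intro exI[of _ b]) (auto simp: started_def)
  qed
qed

text \<open>
  The values before \<open>c\<close>, being \<open>0\<close>, do not influence the supremum of a positive path.
\<close>

lemma SUP_started:
  assumes x: "base_path x" and t: "0 \<le> t" "c \<le> ennreal t"
  shows "(SUP u\<in>{0..t}. started c x u) = (SUP u\<in>{enn2real c..t}. x u)"
proof -
  obtain s where s: "c = ennreal s" "0 \<le> s" "s \<le> t" using t by (cases c) (auto simp: top_unique)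
  have bdd: "bdd_above (x ` {s..t})"
    using x t s by (auto simp: base_path_def intro: bdd_above_mono[of "x ` {0..t}"])
  show ?thesis
  proof (rule antisym)
    show "(SUP u\<in>{0..t}. started c x u) \<le> (SUP u\<in>{enn2real c..t}. x u)"
    proof (rule cSUP_least)
      fix u assume u: "u \<in> {0..t}"
      show "started c x u \<le> (SUP u\<in>{enn2real c..t}. x u)"
      proof (cases "s \<le> u")
        case True
        then show ?thesis using u s bdd by (auto simp: started_def intro!: cSUP_upper)
      next
        case False
        then show ?thesis
          using base_path_running_sup_mono(2)[OF x s(2) order_refl s(3) order_refl] u s
          by (auto simp: started_def ennreal_le_iff)
      qed
    qed (use t in auto)
    show "(SUP u\<in>{enn2real c..t}. x u) \<le> (SUP u\<in>{0..t}. started c x u)"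
    proof (rule cSUP_mono)
      show "\<exists>m\<in>{0..t}. x u \<le> started c x m" if "u \<in> {enn2real c..t}" for u
        using that s by (intro bexI[of _ u]) (auto simp: started_def ennreal_leI)
    qed (use s started_bdd[OF x t(1)] in auto)
  qed
qed

section \<open>Costs and marginal profits\<close>

locale base_capacity = filtered_space P F
  for P :: "'w measure" and F :: "ennreal \<Rightarrow> 'w measure" +
  fixes r lam0 lam0s \<alpha> :: real and z \<phi> l :: "real \<Rightarrow> 'w \<Rightarrow> real"
  assumes alpha: "0 < \<alpha>" "\<alpha> < 1"
    and z: "progressive F z" and phi: "progressive F \<phi>"
    and phi_lim: "AE \<omega> in P. Limsup at_top (\<lambda>t. ereal (discounted r lam0s \<phi> t \<omega>)) = 0"
    and l: "optional_process P F l"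
    and l_path: "AE \<omega> in P. (\<forall>t\<ge>0. 0 < l t \<omega>) \<and> upper_right_continuous (\<lambda>t. l t \<omega>)"
    and l_bdd: "AE \<omega> in P. \<forall>t\<ge>0. bdd_above ((\<lambda>u. exp (- lam0 * u) * l u \<omega>) ` {0..t})"
    and backward: "solves_backward_equation P F r lam0 lam0s \<alpha> z \<phi> l"
begin

abbreviation X where "X \<equiv> base_process lam0 l"

lemma AE_base_path: "AE \<omega> in P. base_path (\<lambda>t. X t \<omega>)"
  using l_path l_bdd
proof eventually_elim
  case (elim \<omega>)
  have "right_usc (\<lambda>t. exp (- lam0 * t) * l t \<omega>)"
    using elim by (intro right_usc_exp_mult upper_right_continuous_imp_right_usc) simp
  then show ?case using elim by (simp add: base_path_def base_process_def[abs_def])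
qed

definition bad_paths :: "'w set" where "bad_paths = {\<omega>\<in>space P. \<not> base_path (\<lambda>t. X t \<omega>)}"

lemma bad_paths: "bad_paths \<in> null_sets P"
  using AE_base_path unfolding bad_paths_def AE_iff_null_sets .

lemma AE_good: "AE \<omega> in P. \<omega> \<notin> bad_paths"
  by (rule AE_not_in[OF bad_paths])

text \<open>
  With the constant \<open>1\<close> in place of the exceptional paths, suprema are finite and right-continuous everywhere, and
  adaptedness is kept because null sets belong to \<open>F 0\<close>.
\<close>

definition X_reg :: "real \<Rightarrow> 'w \<Rightarrow> real" where
  "X_reg t \<omega> = (if \<omega> \<in> bad_paths then 1 else X t \<omega>)"

lemma base_path_X_reg: "\<omega> \<in> space P \<Longrightarrow> base_path (\<lambda>t. X_reg t \<omega>)"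
proof (cases "\<omega> \<in> bad_paths")
  case True
  then show ?thesis
    by (auto simp: X_reg_def base_path_def right_usc_def intro!: bdd_aboveI2[of _ _ 1])
next
  case False
  assume "\<omega> \<in> space P"
  with False show ?thesis by (simp add: X_reg_def bad_paths_def)
qed

lemma X_reg_measurable:
  assumes T: "0 \<le> T"
  shows "(\<lambda>(t, \<omega>). X_reg (min (max 0 t) T) \<omega>) \<in> borel_measurable (borel \<Otimes>\<^sub>M F (ennreal T))"
proof -
  have [measurable]: "(\<lambda>x. l (min (max 0 (fst x)) T) (snd x)) \<in> borel_measurable (borel \<Otimes>\<^sub>M F (ennreal T))"
    using optional_jointly_measurable[OF l subalg_F sets_F_mono T] by (simp add: split_beta')
  have [measurable]: "bad_paths \<in> sets (F (ennreal T))" using bad_paths null_sets_F by blast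
  show ?thesis unfolding X_reg_def base_process_def split_beta' by measurable
qed

lemma X_reg_jointly_measurable: "(\<lambda>(t, \<omega>). X_reg (max 0 t) \<omega>) \<in> borel_measurable (borel \<Otimes>\<^sub>M P)"
proof (rule jointly_measurable_of_stopped)
  fix n :: nat
  have "0 \<le> real n" by simp
  from measurable_borel_pair_subalgebra[OF subalg_F X_reg_measurable[OF this]]
  show "(\<lambda>(t, \<omega>). X_reg (min (max 0 t) (real n)) \<omega>) \<in> borel_measurable (borel \<Otimes>\<^sub>M P)" .
qed

text \<open>
  The projection theorem is applied to the restriction of the probability measure to \<open>F t\<close>, which is
  complete because \<open>F t\<close> contains all null sets.
\<close>

lemma running_sup_adapted:
  assumes t: "0 \<le> t"
  shows "(\<lambda>\<omega>. running_sup lam0 l 0 t \<omega>) \<in> borel_measurable (F (ennreal t))"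
proof -
  define M where "M = restr_to_subalg P (F (ennreal t))"
  note sub = subalg_F[of "ennreal t"]
  have sets: "sets M = sets (F (ennreal t))" unfolding M_def by (rule sets_restr_to_subalg[OF sub])
  have space: "space M = space P" by (simp add: M_def space_restr_to_subalg)
  have null: "null_sets M = null_sets P \<inter> sets (F (ennreal t))"
    unfolding M_def by (rule null_sets_restr_to_subalg[OF sub])
  have fin: "finite_measure M"
    unfolding M_def by (intro finite_measure_restr_to_subalg sub) (simp add: emeasure_space_1)
  interpret M: complete_measure M
  proof
    fix A B assume "B \<subseteq> A" "A \<in> null_sets M"
    then have "B \<in> null_sets P" using null complete2 by blast
    then show "B \<in> sets M" using null_sets_F sets by blast
  qed
  have "sets (borel \<Otimes>\<^sub>M M) = sets (borel \<Otimes>\<^sub>M F (ennreal t))"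
    by (rule sets_pair_measure_cong[OF refl sets])
  then have "(\<lambda>(u, \<omega>). X_reg (min (max 0 u) t) \<omega>) \<in> borel_measurable (borel \<Otimes>\<^sub>M M)"
    using X_reg_measurable[OF t] measurable_cong_sets[OF _ refl] by blast
  then have "(\<lambda>\<omega>. SUP u\<in>{0..t}. X_reg (min (max 0 u) t) \<omega>) \<in> borel_measurable M"
  proof (rule measurable_SUP_random_set[OF fin M.complete_measure_axioms])
    fix \<omega> assume "\<omega> \<in> space M"
    then have "bdd_above ((\<lambda>u. X_reg u \<omega>) ` {0..t})" using base_path_X_reg t by (simp add: space base_path_def)
    moreover have "(\<lambda>u. X_reg (min (max 0 u) t) \<omega>) ` {0..t} = (\<lambda>u. X_reg u \<omega>) ` {0..t}"
      by (intro image_cong) auto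
    ultimately show "bdd_above ((\<lambda>u. X_reg (min (max 0 u) t) \<omega>) ` {0..t})" by simp
  qed (use t in auto)
  moreover have "AE \<omega> in M. running_sup lam0 l 0 t \<omega> = (SUP u\<in>{0..t}. X_reg (min (max 0 u) t) \<omega>)"
  proof (rule AE_I[of _ _ bad_paths])
    show "bad_paths \<in> sets M" "emeasure M bad_paths = 0"
      using bad_paths null_sets_F null sets by (auto simp: null_sets_def)
  qed (auto simp: X_reg_def running_sup_eq intro!: SUP_cong)
  ultimately have "(\<lambda>\<omega>. running_sup lam0 l 0 t \<omega>) \<in> borel_measurable M"
    by (rule M.borel_measurable_cong_AE_complete)
  then show ?thesis by (simp add: measurable_cong_sets[OF sets refl])
qed

text \<open>
  The supremum over \<open>[\<tau>, t]\<close>. Replacing the path by \<open>0\<close> before \<open>\<tau>\<close> makes it right-continuous at all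
  times \<open>t\<close>, including those before \<open>\<tau>\<close>, for which \<open>[\<tau>, t]\<close> is empty.
\<close>

definition sup_since :: "('w \<Rightarrow> ennreal) \<Rightarrow> real \<Rightarrow> 'w \<Rightarrow> real" where
  "sup_since \<tau> t \<omega> = (SUP u\<in>{0..t}. started (\<tau> \<omega>) (\<lambda>u. X_reg u \<omega>) u)"

lemma sup_since_eq:
  assumes "\<omega> \<in> space P" "\<omega> \<notin> bad_paths" "0 \<le> t" "\<tau> \<omega> \<le> ennreal t"
  shows "sup_since \<tau> t \<omega> = running_sup lam0 l (enn2real (\<tau> \<omega>)) t \<omega>"
  unfolding sup_since_def using SUP_started[OF base_path_X_reg[OF assms(1)] assms(3,4)] assms(2)
  by (simp add: X_reg_def running_sup_eq)

lemma sup_since_jointly_measurable: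
  assumes [measurable]: "\<tau> \<in> borel_measurable P"
  shows "(\<lambda>(t, \<omega>). sup_since \<tau> (max 0 t) \<omega>) \<in> borel_measurable (borel \<Otimes>\<^sub>M P)"
proof (rule right_continuous_jointly_measurable)
  fix t :: real assume t: "0 \<le> t"
  have [measurable]: "(\<lambda>x. X_reg (max 0 (fst x)) (snd x)) \<in> borel_measurable (borel \<Otimes>\<^sub>M P)"
    using X_reg_jointly_measurable by (simp add: split_beta')
  have "(\<lambda>\<omega>. SUP u\<in>{0..t}. started (\<tau> \<omega>) (\<lambda>u. X_reg (max 0 u) \<omega>) u) \<in> borel_measurable P"
  proof (rule measurable_SUP_random_set)
    show "(\<lambda>(u, \<omega>). started (\<tau> \<omega>) (\<lambda>u. X_reg (max 0 u) \<omega>) u) \<in> borel_measurable (borel \<Otimes>\<^sub>M P)"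
      unfolding started_def split_beta' by measurable
    fix \<omega> assume "\<omega> \<in> space P"
    from started_bdd[OF base_path_X_reg[OF this] t, of "\<tau> \<omega>"]
    have "bdd_above (started (\<tau> \<omega>) (\<lambda>u. X_reg u \<omega>) ` {0..t})" .
    also have "started (\<tau> \<omega>) (\<lambda>u. X_reg u \<omega>) ` {0..t} = started (\<tau> \<omega>) (\<lambda>u. X_reg (max 0 u) \<omega>) ` {0..t}"
      by (intro image_cong) (auto simp: started_def)
    finally show "bdd_above (started (\<tau> \<omega>) (\<lambda>u. X_reg (max 0 u) \<omega>) ` {0..t})" .
  qed (use t in \<open>auto intro: finite_measure_axioms complete_measure_axioms\<close>)
  also have "(\<lambda>\<omega>. SUP u\<in>{0..t}. started (\<tau> \<omega>) (\<lambda>u. X_reg (max 0 u) \<omega>) u) = sup_since \<tau> t"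
    by (intro ext) (auto simp: sup_since_def started_def intro!: SUP_cong)
  finally show "sup_since \<tau> t \<in> borel_measurable P" .
next
  fix t :: real and \<omega> assume "\<omega> \<in> space P" "0 \<le> t"
  then show "((\<lambda>s. sup_since \<tau> s \<omega>) \<longlongrightarrow> sup_since \<tau> t \<omega>) (at_right t)"
    unfolding sup_since_def
    by (intro running_sup_right_continuous started_right_usc started_bdd base_path_X_reg)
qed

text \<open>
  The integrand of the backward equation started at \<open>\<tau>\<close>, in a version that is jointly measurable. For
  \<open>\<tau> = 0\<close> it is the marginal profit along the candidate.
\<close>

definition marginal_profit :: "('w \<Rightarrow> ennreal) \<Rightarrow> 'w \<Rightarrow> real \<Rightarrow> ennreal" where
  "marginal_profit \<tau> \<omega> t = ennreal (exp (- (r - lam0s) * t) * z (max 0 t) \<omega> powr \<alpha>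
     * (exp (lam0 * t) * sup_since \<tau> (max 0 t) \<omega>) powr (- \<alpha>))"

lemma marginal_profit_eq:
  assumes "\<omega> \<in> space P" "\<omega> \<notin> bad_paths" "0 \<le> t" "\<tau> \<omega> \<le> ennreal t"
  shows "marginal_profit \<tau> \<omega> t = ennreal (backward_integrand r lam0 lam0s \<alpha> z l (enn2real (\<tau> \<omega>)) t \<omega>)"
  using sup_since_eq[where \<tau> = \<tau>, OF assms] assms(3) by (simp add: marginal_profit_def backward_integrand_def)

lemma marginal_profit_measurable:
  assumes [measurable]: "\<tau> \<in> borel_measurable P"
  shows "(\<lambda>(\<omega>, t). marginal_profit \<tau> \<omega> t) \<in> borel_measurable (P \<Otimes>\<^sub>M borel)"
proof -
  have swap: "(\<lambda>x. (snd x, fst x)) \<in> measurable (P \<Otimes>\<^sub>M borel) (borel \<Otimes>\<^sub>M P)" by measurable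
  have [measurable]: "(\<lambda>x. sup_since \<tau> (max 0 (snd x)) (fst x)) \<in> borel_measurable (P \<Otimes>\<^sub>M borel)"
    using measurable_compose[OF swap sup_since_jointly_measurable[OF assms]] by simp
  have [measurable]: "(\<lambda>x. z (max 0 (snd x)) (fst x)) \<in> borel_measurable (P \<Otimes>\<^sub>M borel)"
    using measurable_compose[OF swap progressive_jointly_measurable[OF z subalg_F]] by simp
  show ?thesis unfolding marginal_profit_def split_beta' by measurable
qed

text \<open>
  Taking expectations in the backward equation. At \<open>\<tau> = \<infinity>\<close> both sides vanish, the right one because the
  discounted marginal cost tends to \<open>0\<close>.
\<close>

lemma expectation_backward:
  assumes \<tau>: "stopping_time F \<tau>"
  shows "(\<integral>\<^sup>+\<omega>. (\<integral>\<^sup>+t\<in>{t. 0 \<le> t \<and> \<tau> \<omega> \<le> ennreal t}. marginal_profit \<tau> \<omega> t \<partial>lborel) \<partial>P) =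
    (\<integral>\<^sup>+\<omega>. at_finite (\<lambda>s. ennreal (discounted r lam0s \<phi> s \<omega>)) (\<tau> \<omega>) \<partial>P)"
proof -
  note [measurable] = stopping_time_measurable[OF \<tau>]
  let ?B = "\<lambda>\<omega>. \<integral>\<^sup>+t\<in>{t. 0 \<le> t \<and> \<tau> \<omega> \<le> ennreal t}. marginal_profit \<tau> \<omega> t \<partial>lborel"
  let ?C = "\<lambda>\<omega>. \<integral>\<^sup>+t\<in>{t. 0 \<le> t \<and> \<tau> \<omega> \<le> ennreal t}.
      ennreal (backward_integrand r lam0 lam0s \<alpha> z l (enn2real (\<tau> \<omega>)) t \<omega>) \<partial>lborel"
  have [measurable]: "(\<lambda>x. marginal_profit \<tau> (fst x) (snd x)) \<in> borel_measurable (P \<Otimes>\<^sub>M borel)"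
    using marginal_profit_measurable[of \<tau>] by (simp add: split_beta')
  have B: "?B \<in> borel_measurable P"
  proof (rule lborel.borel_measurable_nn_integral)
    show "(\<lambda>(\<omega>, t). marginal_profit \<tau> \<omega> t * indicator {t. 0 \<le> t \<and> \<tau> \<omega> \<le> ennreal t} t)
        \<in> borel_measurable (P \<Otimes>\<^sub>M lborel)"
      unfolding split_beta' indicator_def by measurable
  qed
  have CB: "AE \<omega> in P. ?C \<omega> = ?B \<omega>"
    using AE_good AE_space
  proof eventually_elim
    case (elim \<omega>)
    show ?case
      using marginal_profit_eq[OF elim(2,1)] by (intro nn_integral_cong) (auto simp: indicator_def)
  qed
  have C: "?C \<in> borel_measurable P"
    by (rule borel_measurable_cong_AE_complete[OF B CB])
  have "(\<integral>\<^sup>+\<omega>. ?B \<omega> \<partial>P) = (\<integral>\<^sup>+\<omega>. ?C \<omega> \<partial>P)"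
    by (rule nn_integral_cong_AE) (use CB in auto)
  also have "\<dots> = (\<integral>\<^sup>+\<omega>. nn_cond_exp P (pre_sigma \<tau>) ?C \<omega> \<partial>P)"
    by (rule expectation_nn_cond_exp_pre_sigma[OF \<tau> C, symmetric])
  also have "\<dots> = (\<integral>\<^sup>+\<omega>. at_finite (\<lambda>s. ennreal (discounted r lam0s \<phi> s \<omega>)) (\<tau> \<omega>) \<partial>P)"
  proof (rule nn_integral_cong_AE)
    have "AE \<omega> in P. nn_cond_exp P (pre_sigma \<tau>) ?C \<omega> = ennreal (at_time (discounted r lam0s \<phi>) \<tau> \<omega>)"
      using backward \<tau> unfolding solves_backward_equation_def by blast
    then show "AE \<omega> in P. nn_cond_exp P (pre_sigma \<tau>) ?C \<omega> =
        at_finite (\<lambda>s. ennreal (discounted r lam0s \<phi> s \<omega>)) (\<tau> \<omega>)"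
      using phi_lim by eventually_elim (simp add: at_time_def at_finite_def)
  qed
  finally show ?thesis .
qed

text \<open>
  In the notation of the introduction, \<open>gain N\<close> is \<open>\<integral> G\<^sub>t n\<^sub>t dt\<close>, and \<open>cost N\<close> is the discounted marginal cost
  integrated against \<open>dn\<close> after the change of time.
\<close>

definition gain :: "(real \<Rightarrow> 'w \<Rightarrow> real) \<Rightarrow> 'w \<Rightarrow> ennreal" where
  "gain N \<omega> = (\<integral>\<^sup>+t\<in>{0..}. marginal_profit (\<lambda>_. 0) \<omega> t * ennreal (N t \<omega>) \<partial>lborel)"

definition cost :: "(real \<Rightarrow> 'w \<Rightarrow> real) \<Rightarrow> 'w \<Rightarrow> ennreal" where
  "cost N \<omega> = (\<integral>\<^sup>+u\<in>{0..}. at_finite (\<lambda>s. ennreal (discounted r lam0s \<phi> s \<omega>)) (time_change (\<lambda>t. N t \<omega>) u) \<partial>lborel)"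

definition tail :: "(real \<Rightarrow> 'w \<Rightarrow> real) \<Rightarrow> 'w \<Rightarrow> real \<Rightarrow> ennreal" where
  "tail N \<omega> u = (\<integral>\<^sup>+t\<in>{t. 0 \<le> t \<and> time_change (\<lambda>t. N t \<omega>) u \<le> ennreal t}. marginal_profit (\<lambda>_. 0) \<omega> t \<partial>lborel)"

context
  fixes N :: "real \<Rightarrow> 'w \<Rightarrow> real"
  assumes adapted: "\<And>t. 0 \<le> t \<Longrightarrow> N t \<in> borel_measurable (F (ennreal t))"
    and paths: "AE \<omega> in P. nondecreasing_rc (\<lambda>t. N t \<omega>)"
begin

lemma N_measurable: "0 \<le> t \<Longrightarrow> N t \<in> borel_measurable P"
  by (rule measurable_from_subalg[OF subalg_F adapted])

lemma C_measurable: "(\<lambda>x. time_change (\<lambda>t. N t (fst x)) (snd x)) \<in> borel_measurable (P \<Otimes>\<^sub>M borel)"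
  by (rule borel_measurable_time_change[of "\<lambda>t x. N t (fst x)"])
    (auto intro: measurable_compose[OF measurable_fst N_measurable])

lemma at_finite_measurable:
  "(\<lambda>x. at_finite (\<lambda>s. ennreal (discounted r lam0s \<phi> s (fst x))) (time_change (\<lambda>t. N t (fst x)) (snd x)))
    \<in> borel_measurable (P \<Otimes>\<^sub>M borel)"
proof -
  note [measurable] = C_measurable
  have "(\<lambda>x. (enn2real (time_change (\<lambda>t. N t (fst x)) (snd x)), fst x)) \<in> measurable (P \<Otimes>\<^sub>M borel) (borel \<Otimes>\<^sub>M P)"
    by measurable
  from measurable_compose[OF this progressive_jointly_measurable[OF phi subalg_F]]
  have [measurable]: "(\<lambda>x. \<phi> (enn2real (time_change (\<lambda>t. N t (fst x)) (snd x))) (fst x)) \<in> borel_measurable (P \<Otimes>\<^sub>M borel)"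
    by simp
  show ?thesis unfolding at_finite_def discounted_def by measurable
qed

lemma tail_measurable: "(\<lambda>x. tail N (fst x) (snd x)) \<in> borel_measurable (P \<Otimes>\<^sub>M borel)"
  unfolding tail_def
proof (rule lborel.borel_measurable_nn_integral)
  note [measurable] = C_measurable
  have [measurable]: "(\<lambda>x. marginal_profit (\<lambda>_. 0) (fst x) (snd x)) \<in> borel_measurable (P \<Otimes>\<^sub>M borel)"
    using marginal_profit_measurable[of "\<lambda>_. 0"] by (simp add: split_beta')
  have *: "(\<lambda>y. (fst (fst y), snd y)) \<in> measurable ((P \<Otimes>\<^sub>M borel) \<Otimes>\<^sub>M borel) (P \<Otimes>\<^sub>M borel)"
    by measurable
  have [measurable]: "(\<lambda>y. marginal_profit (\<lambda>_. 0) (fst (fst y)) (snd y)) \<in> borel_measurable ((P \<Otimes>\<^sub>M borel) \<Otimes>\<^sub>M borel)"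
    using measurable_compose[OF * marginal_profit_measurable[of "\<lambda>_. 0"]] by simp
  have [measurable]: "(\<lambda>y. time_change (\<lambda>t. N t (fst (fst y))) (snd (fst y))) \<in> borel_measurable ((P \<Otimes>\<^sub>M borel) \<Otimes>\<^sub>M borel)"
    using measurable_compose[OF measurable_fst C_measurable] by simp
  show "(\<lambda>(x, t). marginal_profit (\<lambda>_. 0) (fst x) t * indicator {t. 0 \<le> t \<and> time_change (\<lambda>t. N t (fst x)) (snd x) \<le> ennreal t} t)
      \<in> borel_measurable ((P \<Otimes>\<^sub>M borel) \<Otimes>\<^sub>M lborel)"
    unfolding split_beta' indicator_def by measurable
qed

lemma gain_eq_tail: "AE \<omega> in P. gain N \<omega> = (\<integral>\<^sup>+u\<in>{0..}. tail N \<omega> u \<partial>lborel)"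
  using paths AE_space
proof eventually_elim
  case (elim \<omega>)
  have "marginal_profit (\<lambda>_. 0) \<omega> \<in> borel_measurable borel"
    using measurable_compose[OF measurable_Pair1'[OF elim(2)] marginal_profit_measurable[of "\<lambda>_. 0"]] by simp
  from nn_integral_mult_nondecreasing[OF elim(1) this] show ?case
    by (simp add: gain_def tail_def)
qed

lemma gain_measurable: "gain N \<in> borel_measurable P"
proof (rule borel_measurable_cong_AE_complete[OF _ gain_eq_tail])
  note [measurable] = tail_measurable
  show "(\<lambda>\<omega>. \<integral>\<^sup>+u\<in>{0..}. tail N \<omega> u \<partial>lborel) \<in> borel_measurable P"
    by (rule lborel.borel_measurable_nn_integral) (simp add: split_beta')
qed

lemma cost_measurable: "cost N \<in> borel_measurable P"
proof -
  note [measurable] = at_finite_measurable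
  show ?thesis unfolding cost_def
    by (rule lborel.borel_measurable_nn_integral) (simp add: split_beta')
qed

lemma expectation_gain: "(\<integral>\<^sup>+\<omega>. gain N \<omega> \<partial>P) = (\<integral>\<^sup>+u\<in>{0..}. (\<integral>\<^sup>+\<omega>. tail N \<omega> u \<partial>P) \<partial>lborel)"
proof -
  note [measurable] = tail_measurable
  interpret pair_sigma_finite P "lborel :: real measure" ..
  have "(\<integral>\<^sup>+\<omega>. gain N \<omega> \<partial>P) = (\<integral>\<^sup>+\<omega>. (\<integral>\<^sup>+u. tail N \<omega> u * indicator {0..} u \<partial>lborel) \<partial>P)"
    by (rule nn_integral_cong_AE) (rule gain_eq_tail)
  also have "\<dots> = (\<integral>\<^sup>+u. (\<integral>\<^sup>+\<omega>. tail N \<omega> u * indicator {0..} u \<partial>P) \<partial>lborel)"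
    by (rule Fubini'[symmetric]) (simp add: split_beta')
  also have "\<dots> = (\<integral>\<^sup>+u\<in>{0..}. (\<integral>\<^sup>+\<omega>. tail N \<omega> u \<partial>P) \<partial>lborel)"
    by (intro nn_integral_cong) (simp split: split_indicator)
  finally show ?thesis .
qed

lemma expectation_cost:
  "(\<integral>\<^sup>+\<omega>. cost N \<omega> \<partial>P) = (\<integral>\<^sup>+u\<in>{0..}. (\<integral>\<^sup>+\<omega>. (\<integral>\<^sup>+t\<in>{t. 0 \<le> t \<and> time_change (\<lambda>t. N t \<omega>) u \<le> ennreal t}.
      marginal_profit (\<lambda>\<omega>. time_change (\<lambda>t. N t \<omega>) u) \<omega> t \<partial>lborel) \<partial>P) \<partial>lborel)"
proof -
  note [measurable] = at_finite_measurable
  interpret pair_sigma_finite P "lborel :: real measure" ..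
  let ?a = "\<lambda>\<omega> u. at_finite (\<lambda>s. ennreal (discounted r lam0s \<phi> s \<omega>)) (time_change (\<lambda>t. N t \<omega>) u)"
  have "(\<integral>\<^sup>+\<omega>. cost N \<omega> \<partial>P) = (\<integral>\<^sup>+u. (\<integral>\<^sup>+\<omega>. ?a \<omega> u * indicator {0..} u \<partial>P) \<partial>lborel)"
    unfolding cost_def by (rule Fubini'[symmetric]) (simp add: split_beta')
  also have "\<dots> = (\<integral>\<^sup>+u\<in>{0..}. (\<integral>\<^sup>+\<omega>. ?a \<omega> u \<partial>P) \<partial>lborel)"
    by (intro nn_integral_cong) (simp split: split_indicator)
  finally show ?thesis
    by (simp only: expectation_backward[OF stopping_time_time_change[OF adapted]])
qed

text \<open>
  The supremum since \<open>0\<close> dominates the supremum since \<open>\<tau>\<close>, and the power is negative.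
\<close>

lemma marginal_profit_mono:
  assumes "\<omega> \<in> space P" "\<omega> \<notin> bad_paths" "0 \<le> t" "\<tau> \<omega> \<le> ennreal t"
  shows "marginal_profit (\<lambda>_. 0) \<omega> t \<le> marginal_profit \<tau> \<omega> t"
proof -
  have path: "base_path (\<lambda>t. X t \<omega>)" using assms by (simp add: bad_paths_def)
  have "enn2real (\<tau> \<omega>) \<le> t" using assms(3,4) by (simp add: enn2real_leI)
  then have "sup_since \<tau> t \<omega> \<le> sup_since (\<lambda>_. 0) t \<omega>" "0 < sup_since \<tau> t \<omega>"
    using base_path_running_sup_mono[OF path, of 0 "enn2real (\<tau> \<omega>)" t t] assms
    by (simp_all add: sup_since_eq running_sup_eq)
  then show ?thesis
    unfolding marginal_profit_def using assms(3) alpha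
    by (intro ennreal_leI mult_left_mono powr_mono2') auto
qed

text \<open>
  For every level \<open>u\<close>, the backward equation at the stopping time \<open>C\<^sub>u\<close> bounds the expected marginal
  profit after \<open>C\<^sub>u\<close>.
\<close>

lemma expectation_gain_le: "(\<integral>\<^sup>+\<omega>. gain N \<omega> \<partial>P) \<le> (\<integral>\<^sup>+\<omega>. cost N \<omega> \<partial>P)"
  unfolding expectation_gain expectation_cost tail_def
proof (rule nn_integral_mono, rule mult_right_mono, rule nn_integral_mono_AE)
  fix u :: real
  show "AE \<omega> in P. (\<integral>\<^sup>+t\<in>{t. 0 \<le> t \<and> time_change (\<lambda>t. N t \<omega>) u \<le> ennreal t}. marginal_profit (\<lambda>_. 0) \<omega> t \<partial>lborel)
      \<le> (\<integral>\<^sup>+t\<in>{t. 0 \<le> t \<and> time_change (\<lambda>t. N t \<omega>) u \<le> ennreal t}.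
      marginal_profit (\<lambda>\<omega>. time_change (\<lambda>t. N t \<omega>) u) \<omega> t \<partial>lborel)"
    using AE_good AE_space
  proof eventually_elim
    case (elim \<omega>)
    show ?case
      using marginal_profit_mono[OF elim(2,1), of _ "\<lambda>\<omega>. time_change (\<lambda>t. N t \<omega>) u"]
      by (intro nn_integral_mono) (auto simp: indicator_def)
  qed
qed simp

text \<open>
  The inequality before is an equality as soon as suprema since \<open>0\<close> and since \<open>C\<^sub>u\<close> agree after \<open>C\<^sub>u\<close>. The
  assumption is strict in \<open>t\<close>: at \<open>C\<^sub>u\<close> itself the two may differ, but a single time is negligible.
\<close>

lemma expectation_gain_eq:
  assumes flat: "AE \<omega> in P. \<forall>u\<ge>0. \<forall>t\<ge>0. time_change (\<lambda>t. N t \<omega>) u < ennreal t \<longrightarrow>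
      running_sup lam0 l 0 t \<omega> = running_sup lam0 l (enn2real (time_change (\<lambda>t. N t \<omega>) u)) t \<omega>"
  shows "(\<integral>\<^sup>+\<omega>. gain N \<omega> \<partial>P) = (\<integral>\<^sup>+\<omega>. cost N \<omega> \<partial>P)"
  unfolding expectation_gain expectation_cost tail_def
proof (rule nn_integral_cong)
  fix u :: real
  let ?C = "\<lambda>\<omega>. time_change (\<lambda>t. N t \<omega>) u"
  show "(\<integral>\<^sup>+\<omega>. (\<integral>\<^sup>+t\<in>{t. 0 \<le> t \<and> ?C \<omega> \<le> ennreal t}. marginal_profit (\<lambda>_. 0) \<omega> t \<partial>lborel) \<partial>P) * indicator {0..} u
      = (\<integral>\<^sup>+\<omega>. (\<integral>\<^sup>+t\<in>{t. 0 \<le> t \<and> ?C \<omega> \<le> ennreal t}. marginal_profit ?C \<omega> t \<partial>lborel) \<partial>P) * indicator {0..} u"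
  proof (cases "0 \<le> u")
    case True
    have "(\<integral>\<^sup>+\<omega>. (\<integral>\<^sup>+t\<in>{t. 0 \<le> t \<and> ?C \<omega> \<le> ennreal t}. marginal_profit (\<lambda>_. 0) \<omega> t \<partial>lborel) \<partial>P)
      = (\<integral>\<^sup>+\<omega>. (\<integral>\<^sup>+t\<in>{t. 0 \<le> t \<and> ?C \<omega> \<le> ennreal t}. marginal_profit ?C \<omega> t \<partial>lborel) \<partial>P)"
    proof (rule nn_integral_cong_AE)
      show "AE \<omega> in P. (\<integral>\<^sup>+t\<in>{t. 0 \<le> t \<and> ?C \<omega> \<le> ennreal t}. marginal_profit (\<lambda>_. 0) \<omega> t \<partial>lborel)
          = (\<integral>\<^sup>+t\<in>{t. 0 \<le> t \<and> ?C \<omega> \<le> ennreal t}. marginal_profit ?C \<omega> t \<partial>lborel)"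
        using AE_good AE_space flat
      proof eventually_elim
        case (elim \<omega>)
        have eq: "marginal_profit (\<lambda>_. 0) \<omega> t = marginal_profit ?C \<omega> t" if t: "0 \<le> t" "?C \<omega> < ennreal t" for t
        proof -
          have "sup_since (\<lambda>_. 0) t \<omega> = sup_since ?C t \<omega>"
            using sup_since_eq[OF elim(2,1) t(1), of "\<lambda>_. 0"] sup_since_eq[OF elim(2,1) t(1), of ?C] t elim(3) True
            by simp
          then show ?thesis using t(1) by (simp add: marginal_profit_def)
        qed
        have "AE t in lborel. t \<noteq> enn2real (?C \<omega>)" by (rule AE_lborel_singleton)
        then have "AE t in lborel. marginal_profit (\<lambda>_. 0) \<omega> t * indicator {t. 0 \<le> t \<and> ?C \<omega> \<le> ennreal t} t =
              marginal_profit ?C \<omega> t * indicator {t. 0 \<le> t \<and> ?C \<omega> \<le> ennreal t} t"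
        proof eventually_elim
          case t: (elim t)
          show ?case
          proof (cases "0 \<le> t \<and> ?C \<omega> \<le> ennreal t")
            case True
            then have "?C \<omega> < ennreal t" using t by (auto simp: less_le)
            then show ?thesis using eq True by simp
          qed simp
        qed
        then show ?case by (rule nn_integral_cong_AE)
      qed
    qed
    then show ?thesis by simp
  qed simp
qed

end

end

section \<open>Controls that are constant in space up to a shift\<close>

lemma measurable_integral_Lp_borel:
  assumes mu: "finite_measure \<mu>" "1 < p"
  shows "(\<lambda>f. \<integral>x. f x \<partial>\<mu>) \<in> borel_measurable (Lp_borel \<mu> p)"
proof (rule borel_measurableI)
  have sub: "{G. Lp_open \<mu> p G} \<subseteq> Pow (Lp_space \<mu> p)" by (auto simp: Lp_open_def)
  fix B :: "real set" assume B: "open B"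
  define C where "C = measure \<mu> (space \<mu>) + 1"
  have C: "C > 0" by (simp add: C_def add_nonneg_pos)
  have "Lp_open \<mu> p {f \<in> Lp_space \<mu> p. (\<integral>x. f x \<partial>\<mu>) \<in> B}"
    unfolding Lp_open_def
  proof (intro conjI ballI)
    fix f assume f: "f \<in> {f \<in> Lp_space \<mu> p. (\<integral>x. f x \<partial>\<mu>) \<in> B}"
    then obtain e where e: "e > 0" "\<And>y. \<bar>y - (\<integral>x. f x \<partial>\<mu>)\<bar> < e \<Longrightarrow> y \<in> B"
      using B unfolding open_dist dist_real_def by blast
    have "(\<integral>x. g x \<partial>\<mu>) \<in> B" if g: "g \<in> Lp_space \<mu> p" "Lp_dist \<mu> p g f < e / C" for g
    proof (rule e(2))
      have "\<bar>(\<integral>x. g x \<partial>\<mu>) - (\<integral>x. f x \<partial>\<mu>)\<bar> \<le> C * Lp_dist \<mu> p g f"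
        unfolding C_def using f g by (intro integral_Lp_dist_bound[OF mu]) auto
      also have "\<dots> < e" using g(2) C by (simp add: field_simps)
      finally show "\<bar>(\<integral>x. g x \<partial>\<mu>) - (\<integral>x. f x \<partial>\<mu>)\<bar> < e" .
    qed
    then show "\<exists>e>0. \<forall>g\<in>Lp_space \<mu> p. Lp_dist \<mu> p g f < e \<longrightarrow> g \<in> {f \<in> Lp_space \<mu> p. (\<integral>x. f x \<partial>\<mu>) \<in> B}"
      using e(1) C by (intro exI[of _ "e / C"]) auto
  qed auto
  then have "{f \<in> Lp_space \<mu> p. (\<integral>x. f x \<partial>\<mu>) \<in> B} \<in> sets (Lp_borel \<mu> p)"
    unfolding Lp_borel_def using sub by (auto intro: sigma_sets.Basic simp: sets_measure_of)
  moreover have "(\<lambda>f. \<integral>x. f x \<partial>\<mu>) -` B \<inter> space (Lp_borel \<mu> p) = {f \<in> Lp_space \<mu> p. (\<integral>x. f x \<partial>\<mu>) \<in> B}"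
    unfolding Lp_borel_def using sub by (auto simp: space_measure_of)
  ultimately show "(\<lambda>f. \<integral>x. f x \<partial>\<mu>) -` B \<inter> space (Lp_borel \<mu> p) \<in> sets (Lp_borel \<mu> p)" by simp
qed

lemma (in finite_measure) Lp_norm_const:
  assumes "0 < p"
  shows "Lp_norm M p (\<lambda>x. c) = \<bar>c\<bar> * measure M (space M) powr (1 / p)"
  using assms by (simp add: Lp_norm_def powr_mult powr_powr mult.commute)

text \<open>
  Controls of the form \<open>L t - y\<close> with \<open>L t\<close> constant in space, such as the candidate. They move along one
  line in \<open>L\<^sup>p\<close>, so their variation and density are explicit.
\<close>

locale shifted_path =
  fixes \<mu> :: "'d measure" and p :: real and y :: "'d \<Rightarrow> real"
  assumes finite_mu: "finite_measure \<mu>" and p: "1 < p" and mu_pos: "0 < measure \<mu> (space \<mu>)"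
    and y: "y \<in> Lp_space \<mu> p"
begin

sublocale finite_measure \<mu> by (rule finite_mu)

definition \<kappa> :: real where "\<kappa> = measure \<mu> (space \<mu>) powr (1 / p)"

lemma kappa_pos: "0 < \<kappa>" using mu_pos by (simp add: \<kappa>_def)

definition shift :: "real \<Rightarrow> 'd \<Rightarrow> real" where "shift c = (\<lambda>x. c - y x)"

lemma shift_Lp: "shift c \<in> Lp_space \<mu> p"
  unfolding shift_def using p
  by (intro Lp_space_diff[OF _ _ y] Lp_space_bounded[OF finite_mu, where B = "\<bar>c\<bar>"]) auto

lemma Lp_dist_shift: "Lp_dist \<mu> p (shift c) (shift d) = \<bar>c - d\<bar> * \<kappa>"
  using Lp_norm_const[of p "c - d"] p by (simp add: Lp_dist_def shift_def \<kappa>_def)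

lemma measurable_shift:
  assumes [measurable]: "g \<in> borel_measurable M"
  shows "(\<lambda>\<omega>. shift (g \<omega>)) \<in> measurable M (Lp_borel \<mu> p)"
  unfolding Lp_borel_def
proof (rule measurable_measure_of)
  fix G assume "G \<in> {G. Lp_open \<mu> p G}"
  then have G: "Lp_open \<mu> p G" by simp
  have "open {c. shift c \<in> G}"
    unfolding open_dist
  proof safe
    fix c assume "shift c \<in> G"
    then obtain e where e: "e > 0" "\<And>g. g \<in> Lp_space \<mu> p \<Longrightarrow> Lp_dist \<mu> p g (shift c) < e \<Longrightarrow> g \<in> G"
      using G unfolding Lp_open_def by blast
    have "shift d \<in> G" if "dist d c < e / \<kappa>" for d
      using that kappa_pos by (intro e(2) shift_Lp) (simp add: Lp_dist_shift dist_real_def field_simps)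
    then show "\<exists>e>0. \<forall>d. dist d c < e \<longrightarrow> d \<in> {c. shift c \<in> G}"
      using e(1) kappa_pos by (intro exI[of _ "e / \<kappa>"]) auto
  qed
  then have "g -` {c. shift c \<in> G} \<inter> space M \<in> sets M" by (intro measurable_sets[OF assms]) auto
  then show "(\<lambda>\<omega>. shift (g \<omega>)) -` G \<inter> space M \<in> sets M" by (simp add: vimage_def)
qed (auto simp: Lp_open_def shift_Lp)

context
  fixes L :: "real \<Rightarrow> real"
  assumes mono: "\<And>s t. 0 \<le> s \<Longrightarrow> s \<le> t \<Longrightarrow> L s \<le> L t"
    and rc: "\<And>t. 0 \<le> t \<Longrightarrow> (L \<longlongrightarrow> L t) (at_right t)"
    and y_le: "AE x in \<mu>. y x \<le> L 0"
begin

text \<open>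
  The candidate starts with a jump of this norm from \<open>0\<close>, an atom of the variation measure at time \<open>0\<close>.
\<close>

definition a0 :: real where "a0 = Lp_norm \<mu> p (shift (L 0))"

lemma a0_nonneg: "0 \<le> a0" by (simp add: a0_def Lp_norm_nonneg)

lemma variation_sums_shift:
  assumes t: "0 \<le> t"
  shows "variation_sums \<mu> p (\<lambda>t. shift (L t)) t = {a0 + (L t - L 0) * \<kappa>}"
proof -
  have sum: "(\<Sum>i<k. Lp_dist \<mu> p (shift (L (c (Suc i)))) (shift (L (c i)))) = (L (c k) - L (c 0)) * \<kappa>"
    if c: "incseq c" "c 0 = 0" for c :: "nat \<Rightarrow> real" and k
  proof -
    have "0 \<le> c i" "c i \<le> c (Suc i)" for i
      using incseqD[OF c(1), of 0 i] incseqD[OF c(1), of i "Suc i"] c(2) by auto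
    then have "Lp_dist \<mu> p (shift (L (c (Suc i)))) (shift (L (c i))) = (L (c (Suc i)) - L (c i)) * \<kappa>" for i
      unfolding Lp_dist_shift using mono[of "c i" "c (Suc i)"] by simp
    then have "(\<Sum>i<k. Lp_dist \<mu> p (shift (L (c (Suc i)))) (shift (L (c i)))) = (\<Sum>i<k. L (c (Suc i)) - L (c i)) * \<kappa>"
      by (simp add: sum_distrib_right)
    then show ?thesis using sum_lessThan_telescope[of "\<lambda>i. L (c i)" k] by simp
  qed
  let ?c = "\<lambda>i::nat. if i = 0 then 0 else t"
  have c: "incseq ?c" using t by (auto simp: incseq_def)
  have "variation_sums \<mu> p (\<lambda>t. shift (L t)) t \<subseteq> {a0 + (L t - L 0) * \<kappa>}"
    unfolding variation_sums_def a0_def by (auto simp: sum)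
  moreover have "a0 + (L t - L 0) * \<kappa> \<in> variation_sums \<mu> p (\<lambda>t. shift (L t)) t"
    unfolding variation_sums_def a0_def
    using c sum[OF c, of 1] by (intro CollectI exI[of _ 1] exI[of _ ?c]) simp
  ultimately show ?thesis by blast
qed

definition W :: "real \<Rightarrow> real" where
  "W t = (if t < 0 then 0 else a0 + (L t - L 0) * \<kappa>)"

definition m :: "real measure" where "m = interval_measure W"

lemma variation_measure_shift: "variation_measure \<mu> p (\<lambda>t. shift (L t)) = m"
proof -
  have "(\<lambda>t. if t < 0 then 0 else Sup (variation_sums \<mu> p (\<lambda>t. shift (L t)) t)) = W"
    by (auto simp: W_def variation_sums_shift)
  then show ?thesis by (simp add: variation_measure_def m_def)
qed

lemma emeasure_m_Ioc:
  assumes "s \<le> t"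
  shows "emeasure m {s<..t} = ennreal (W t - W s)"
  unfolding m_def
proof (rule emeasure_interval_measure_Ioc[OF assms])
  fix x z :: real assume "x \<le> z"
  moreover have "0 \<le> (L z - L 0) * \<kappa>" if "0 \<le> z"
    using mono[of 0 z] that kappa_pos by simp
  moreover have "(L x - L 0) * \<kappa> \<le> (L z - L 0) * \<kappa>" if "0 \<le> x" "x \<le> z"
    using mono[OF that] kappa_pos by simp
  ultimately show "W x \<le> W z"
    using a0_nonneg by (auto simp: W_def add_nonneg_nonneg)
next
  fix x :: real
  show "continuous (at_right x) W"
    unfolding continuous_within
  proof (cases "x < 0")
    case True
    then have "\<forall>\<^sub>F z in at_right x. W z = W x"
      unfolding eventually_at_right_field by (intro exI[of _ 0]) (auto simp: W_def)
    then show "(W \<longlongrightarrow> W x) (at_right x)" by (rule tendsto_eventually)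
  next
    case False
    have "((\<lambda>z. a0 + (L z - L 0) * \<kappa>) \<longlongrightarrow> a0 + (L x - L 0) * \<kappa>) (at_right x)"
      using rc[of x] False by (intro tendsto_intros) auto
    moreover have "\<forall>\<^sub>F z in at_right x. a0 + (L z - L 0) * \<kappa> = W z"
      using False unfolding eventually_at_right_field by (intro exI[of _ "x + 1"]) (auto simp: W_def)
    ultimately show "(W \<longlongrightarrow> W x) (at_right x)"
      using False by (auto simp: W_def intro: Lim_transform_eventually)
  qed
qed

lemma sets_m [measurable_cong, simp]: "sets m = sets borel" by (simp add: m_def)
lemma space_m [simp]: "space m = UNIV" by (simp add: m_def)

text \<open>
  The half-open interval \<open>(-1, 0]\<close> has mass \<open>a0\<close> and \<open>(-1, 0)\<close> has none, as \<open>W\<close> vanishes before \<open>0\<close>.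
\<close>

lemma emeasure_m_0: "emeasure m {0} = ennreal a0"
proof -
  have "emeasure m (\<Union>i. {-1<..- 1 / real (Suc i)}) = 0"
  proof (rule emeasure_UN_eq_0)
    show "emeasure m {-1<..- 1 / real (Suc i)} = 0" for i
      by (subst emeasure_m_Ioc) (auto simp: W_def)
  qed auto
  moreover have "(\<Union>i. {-1<..- 1 / real (Suc i)}) = {-1<..<0}"
  proof (intro equalityI subsetI)
    fix s :: real assume s: "s \<in> {-1<..<0}"
    then obtain i where "1 / real (Suc i) < - s" using nat_approx_posE[of "- s"] by auto
    then show "s \<in> (\<Union>i. {-1<..- 1 / real (Suc i)})" using s by (auto intro!: exI[of _ i])
  next
    fix s :: real assume "s \<in> (\<Union>i. {-1<..- 1 / real (Suc i)})"
    then obtain i where s: "-1 < s" "s \<le> - 1 / real (Suc i)" by auto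
    have "- 1 / real (Suc i) < 0" by simp
    with s(2) have "s < 0" by (rule le_less_trans)
    with s(1) show "s \<in> {-1<..<0}" by simp
  qed
  ultimately have "{-1<..<0} \<in> null_sets m" by (simp add: null_sets_def)
  then have "emeasure m ({-1<..0} - {-1<..<0}) = emeasure m {-1<..0}"
    by (rule emeasure_Diff_null_set) simp
  moreover have "{-1<..0} - {-1<..<0} = {0::real}" by auto
  ultimately show ?thesis by (simp add: emeasure_m_Ioc W_def)
qed

text \<open>
  The initial jump has direction \<open>L 0 - y\<close>, all later increments are multiples of the constant function
  \<open>1\<close>. If \<open>a0 = 0\<close>, the quotient is \<open>0\<close>, which is right because the atom is empty.
\<close>

definition \<rho> :: "real \<Rightarrow> 'd \<Rightarrow> real" where
  "\<rho> s = (if s = 0 then (\<lambda>x. shift (L 0) x / a0) else (\<lambda>x. 1 / \<kappa>))"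

lemma shift_cone: "0 \<le> t \<Longrightarrow> shift (L t) \<in> Lp_cone \<mu> p"
  using shift_Lp y_le mono[of 0 t] by (auto simp: Lp_cone_def shift_def)

lemma rho_cone: "\<rho> s \<in> Lp_cone \<mu> p"
proof (cases "s = 0")
  case True
  have "(\<lambda>x. (1 / a0) * shift (L 0) x) \<in> Lp_space \<mu> p" by (intro Lp_space_cmult shift_Lp)
  then show ?thesis
    using True y_le a0_nonneg by (auto simp: Lp_cone_def \<rho>_def shift_def)
next
  case False
  then show ?thesis
    using p kappa_pos Lp_space_bounded[OF finite_mu, of p "\<lambda>x. 1 / \<kappa>" "1 / \<kappa>"] by (auto simp: Lp_cone_def \<rho>_def)
qed

text \<open>
  The restriction of \<open>\<rho>\<close> to \<open>[0, T]\<close> is a simple function, so it serves as its own approximation. Its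
  values at \<open>0\<close> and on \<open>(0, T]\<close> may coincide; the sum over the range is therefore evaluated as a Bochner integral at
  each point of the space.
\<close>

lemma is_density_shift: "is_density \<mu> p (\<lambda>t. shift (L t)) \<rho>"
  unfolding is_density_def variation_measure_shift
proof (intro conjI allI impI rho_cone)
  fix T :: real assume T: "0 \<le> T"
  define f :: "real \<Rightarrow> 'd \<Rightarrow> real" where "f = (\<lambda>s x. indicator {0..T} s * \<rho> s x)"
  have f_cases: "f s = (if s = 0 then \<rho> 0 else if s \<in> {0<..T} then \<rho> 1 else (\<lambda>x. 0))" for s
    using T by (auto simp: f_def \<rho>_def indicator_def)
  have f_Lp: "f s \<in> Lp_space \<mu> p" for s
    unfolding f_def using rho_cone Lp_cone_subset by (intro Lp_space_cmult) blast
  have range: "range f \<subseteq> {\<rho> 0, \<rho> 1, (\<lambda>x. 0)}" by (auto simp: f_cases)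
  then have fin: "finite (range f)" by (rule finite_subset) simp
  have level: "{s. f s = v} \<in> sets m" for v
  proof -
    have "{s. f s = v} = {s. if s = 0 then \<rho> 0 = v else if s \<in> {0<..T} then \<rho> 1 = v else (\<lambda>x. 0) = v}"
      by (auto simp: f_cases)
    also have "\<dots> \<in> sets m" by simp
    finally show ?thesis .
  qed
  have simple_f: "simple_function m f"
    unfolding simple_function_def using fin level by (auto simp: vimage_def)
  have supp: "emeasure m B < \<infinity>" if "B \<subseteq> {0..T}" for B
  proof -
    have "emeasure m B \<le> emeasure m {-1<..T}" using that by (intro emeasure_mono) force+
    also have "\<dots> < \<infinity>" using T by (simp add: emeasure_m_Ioc)
    finally show ?thesis .
  qed
  have sum: "(\<Sum>v\<in>range f. measure m {s. f s = v} * v x) = a0 * (shift (L 0) x / a0) + (L T - L 0)" for x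
  proof -
    have simple: "simple_function m (\<lambda>s. f s x)"
      using simple_function_compose2[OF simple_f simple_f, of "\<lambda>v _. v x"] by simp
    have int: "Bochner_Integration.simple_bochner_integrable m (\<lambda>s. f s x)"
    proof -
      have "{s. f s x \<noteq> 0} \<subseteq> {0..T}" by (auto simp: f_def split: split_indicator_asm)
      from supp[OF this] simple show ?thesis
        by (simp add: Bochner_Integration.simple_bochner_integrable.simps less_top)
    qed
    have "(\<Sum>v\<in>f ` space m. measure m {s\<in>space m. f s = v} *\<^sub>R v x) = Bochner_Integration.simple_bochner_integral m (\<lambda>s. f s x)"
      by (rule simple_bochner_integral_partition[OF int simple_f, symmetric]) auto
    also have "\<dots> = (\<integral>s. f s x \<partial>m)"
      by (rule simple_bochner_integrable_eq_integral[OF int])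
    also have "\<dots> = (\<integral>s. indicator {0} s * \<rho> 0 x + indicator {0<..T} s * \<rho> 1 x \<partial>m)"
      by (intro Bochner_Integration.integral_cong) (auto simp: f_cases indicator_def)
    also have "\<dots> = measure m {0} * \<rho> 0 x + measure m {0<..T} * \<rho> 1 x"
    proof -
      have "integrable m (\<lambda>s. indicator {0} s * \<rho> 0 x)" "integrable m (\<lambda>s. indicator {0<..T} s * \<rho> 1 x)"
        using T by (auto intro!: integrable_mult_left integrable_real_indicator simp: emeasure_m_0 emeasure_m_Ioc)
      then show ?thesis by simp
    qed
    also have "measure m {0} = a0" using a0_nonneg by (simp add: measure_def emeasure_m_0)
    also have "measure m {0<..T} = (L T - L 0) * \<kappa>"
      using T mono[of 0 T] kappa_pos by (simp add: measure_def emeasure_m_Ioc W_def)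
    finally show ?thesis using kappa_pos by (simp add: \<rho>_def)
  qed
  have "Lp_dist \<mu> p (\<lambda>x. \<Sum>v\<in>range f. measure m {s. f s = v} * v x) (shift (L T)) = 0"
  proof -
    have "AE x in \<mu>. a0 * (shift (L 0) x / a0) = shift (L 0) x"
    proof (cases "a0 = 0")
      case True
      have "(\<integral>x. \<bar>shift (L 0) x\<bar> \<partial>\<mu>) \<le> 0"
        using Lp_L1_bound(2)[OF finite_mu p shift_Lp[of "L 0"]] True by (simp add: a0_def)
      then have "(\<integral>x. \<bar>shift (L 0) x\<bar> \<partial>\<mu>) = 0"
        by (intro antisym integral_nonneg_AE) auto
      then have "AE x in \<mu>. \<bar>shift (L 0) x\<bar> = 0"
        using Lp_L1_bound(1)[OF finite_mu p shift_Lp[of "L 0"]]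
        by (subst (asm) integral_nonneg_eq_0_iff_AE) auto
      then show ?thesis by eventually_elim simp
    qed simp
    then have "AE x in \<mu>. (a0 * (shift (L 0) x / a0) + (L T - L 0)) - shift (L T) x = 0"
      by eventually_elim (simp add: shift_def)
    moreover have [measurable]: "shift c \<in> borel_measurable \<mu>" for c by (rule Lp_spaceD(1)[OF shift_Lp])
    ultimately have "Lp_dist \<mu> p (\<lambda>x. a0 * (shift (L 0) x / a0) + (L T - L 0)) (shift (L T)) = Lp_norm \<mu> p (\<lambda>x. 0)"
      unfolding Lp_dist_def by (intro Lp_norm_cong_AE) auto
    then show ?thesis using p by (simp add: sum Lp_norm_const)
  qed
  moreover have "Lp_dist \<mu> p (f s) (f s) = 0" for s
    using Lp_norm_const[of p 0] p by (simp add: Lp_dist_def)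
  moreover have "emeasure m {s. f s \<noteq> (\<lambda>x. 0)} < \<infinity>"
    by (rule supp) (auto simp: f_def)
  ultimately have "Lp_has_integral \<mu> p m f (shift (L T))"
    unfolding Lp_has_integral_def space_m using f_Lp fin level shift_Lp
    by (intro conjI exI[of _ "\<lambda>_. f"]) auto
  then show "Lp_has_integral \<mu> p m (\<lambda>s x. indicator {0..T} s * \<rho> s x) (shift (L T))"
    by (simp add: f_def)
qed

lemma control_path_shift: "control_path \<mu> p (\<lambda>t. shift (L t))"
  unfolding control_path_def
proof (intro conjI allI impI)
  show "\<exists>\<rho>. is_density \<mu> p (\<lambda>t. shift (L t)) \<rho>" using is_density_shift by blast
  fix t :: real assume t: "0 \<le> t"
  then show "shift (L t) \<in> Lp_cone \<mu> p" by (rule shift_cone)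
  have "((\<lambda>s. \<bar>L s - L t\<bar> * \<kappa>) \<longlongrightarrow> \<bar>L t - L t\<bar> * \<kappa>) (at_right t)"
    by (intro tendsto_intros rc t)
  then show "((\<lambda>s. Lp_dist \<mu> p (shift (L s)) (shift (L t))) \<longlongrightarrow> 0) (at_right t)"
    by (simp add: Lp_dist_shift)
next
  fix s t :: real assume "0 \<le> s \<and> s \<le> t"
  then show "AE x in \<mu>. shift (L s) x \<le> shift (L t) x" using mono by (auto simp: shift_def)
qed

lemma finite_variation_shift: "finite_variation \<mu> p (\<lambda>t. shift (L t))"
  by (simp add: finite_variation_def variation_sums_shift)

end

lemma mass_shift: "mass \<mu> (\<lambda>t. shift (L t)) t = L t * measure \<mu> (space \<mu>) - (\<integral>x. y x \<partial>\<mu>)"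
  using Lp_L1_bound(1)[OF finite_mu p y] by (simp add: mass_def shift_def mult.commute)

end

text \<open>
  Before \<open>C\<^sub>u\<close> the path stays below the level \<open>(u + Y) / D\<close>, and by any time after \<open>C\<^sub>u\<close> it has exceeded that
  level; so the values before \<open>C\<^sub>u\<close> do not count. This fails for \<open>t = C\<^sub>u\<close> when the level is approached
  from the left without being attained.
\<close>

lemma running_sup_after_time_change:
  assumes x: "base_path x" and D: "0 < D" and t: "0 \<le> t"
    and n: "\<And>s. n s = (SUP u\<in>{0..s}. x u) * D - Y" "nondecreasing_rc n"
    and C: "time_change n u < ennreal t"
  shows "(SUP w\<in>{0..t}. x w) = (SUP w\<in>{enn2real (time_change n u)..t}. x w)"
proof -
  define c where "c = enn2real (time_change n u)"
  have c: "time_change n u = ennreal c" "0 \<le> c"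
    unfolding c_def using C by (auto simp: less_top[symmetric] top_unique intro: ennreal_enn2real[symmetric] order.strict_trans2[OF _ top_greatest])
  have ct: "c < t" using C c by (simp add: ennreal_less_iff)
  have bdd: "bdd_above (x ` {a..b})" if "0 \<le> a" "0 \<le> b" for a b
    using x that by (auto simp: base_path_def intro: bdd_above_mono[of "x ` {0..b}"])
  have below: "x w \<le> (u + Y) / D" if w: "0 \<le> w" "w < c" for w
  proof -
    have "\<not> u < n w" using time_change_le[OF n(2) w(1), of u] w c by (auto simp: ennreal_le_iff)
    moreover have "x w \<le> (SUP u\<in>{0..w}. x u)" using w by (intro cSUP_upper bdd) auto
    then have "x w * D \<le> (SUP u\<in>{0..w}. x u) * D" using D by simp
    ultimately have "x w * D \<le> u + Y" using n(1)[of w] by linarith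
    then show ?thesis using D by (simp add: field_simps)
  qed
  obtain q where q: "0 \<le> q" "u < n q" "q < t"
    using C unfolding time_change_less_iff by (auto simp: ennreal_less_iff)
  then have "(u + Y) / D < (SUP u\<in>{0..q}. x u)" using D by (simp add: n(1) field_simps)
  then obtain v where v: "v \<in> {0..q}" "(u + Y) / D < x v"
    using q by (subst (asm) less_cSUP_iff) (auto intro: bdd)
  then have v': "v \<in> {c..t}" using below[of v] q by (cases "v < c") auto
  have "(SUP w\<in>{0..t}. x w) \<le> (SUP w\<in>{c..t}. x w)"
  proof (rule cSUP_least)
    fix w assume w: "w \<in> {0..t}"
    show "x w \<le> (SUP w\<in>{c..t}. x w)"
    proof (cases "w < c")
      case True
      then have "x w < x v" using below[of w] w v by simp
      also have "\<dots> \<le> (SUP w\<in>{c..t}. x w)" using v' c t by (intro cSUP_upper bdd) auto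
      finally show ?thesis by simp
    next
      case False
      then show ?thesis using w c t by (intro cSUP_upper bdd) auto
    qed
  qed (use t in auto)
  moreover have "(SUP w\<in>{c..t}. x w) \<le> (SUP w\<in>{0..t}. x w)"
    using c ct by (intro cSUP_subset_mono bdd) auto
  ultimately show ?thesis by (simp add: c_def)
qed

section \<open>Extended expectations\<close>

text \<open>
  One summand may be non-measurable. This spares a proof that the profit of an arbitrary control is measurable.
\<close>

lemma nn_integral_superadditive:
  assumes g [measurable]: "g \<in> borel_measurable M"
  shows "(\<integral>\<^sup>+x. f x \<partial>M) + (\<integral>\<^sup>+x. g x \<partial>M) \<le> (\<integral>\<^sup>+x. f x + g x \<partial>M)"
proof -
  let ?A = "{h. simple_function M h \<and> h \<le> f}"
  have ne: "?A \<noteq> {}" by (auto intro!: exI[of _ "\<lambda>_. 0"] simp: le_fun_def)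
  have "(\<integral>\<^sup>+x. f x \<partial>M) + (\<integral>\<^sup>+x. g x \<partial>M) = (SUP h\<in>?A. integral\<^sup>S M h + (\<integral>\<^sup>+x. g x \<partial>M))"
    unfolding nn_integral_def[of M f] using ne by (rule ennreal_SUP_add_left[symmetric])
  also have "\<dots> \<le> (\<integral>\<^sup>+x. f x + g x \<partial>M)"
  proof (rule SUP_least)
    fix h assume "h \<in> ?A"
    then have h: "simple_function M h" "\<And>x. h x \<le> f x" by (auto simp: le_fun_def)
    have [measurable]: "h \<in> borel_measurable M" by (rule borel_measurable_simple_function[OF h(1)])
    have "integral\<^sup>S M h + (\<integral>\<^sup>+x. g x \<partial>M) = (\<integral>\<^sup>+x. h x + g x \<partial>M)"
      using h(1) by (simp add: nn_integral_add nn_integral_eq_simple_integral)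
    also have "\<dots> \<le> (\<integral>\<^sup>+x. f x + g x \<partial>M)"
      by (intro nn_integral_mono add_mono h(2)) simp
    finally show "integral\<^sup>S M h + (\<integral>\<^sup>+x. g x \<partial>M) \<le> (\<integral>\<^sup>+x. f x + g x \<partial>M)" .
  qed
  finally show ?thesis .
qed

lemma ext_expectation_mono:
  assumes "AE \<omega> in P. X \<omega> \<le> Y \<omega>"
  shows "ext_expectation P X \<le> ext_expectation P Y"
  unfolding ext_expectation_def
proof (rule ereal_minus_mono)
  show "enn2ereal (\<integral>\<^sup>+\<omega>. e2ennreal (X \<omega>) \<partial>P) \<le> enn2ereal (\<integral>\<^sup>+\<omega>. e2ennreal (Y \<omega>) \<partial>P)"
    using assms by (auto simp: less_eq_ennreal.rep_eq[symmetric] intro!: nn_integral_mono_AE elim!: eventually_mono intro: e2ennreal_mono)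
  show "enn2ereal (\<integral>\<^sup>+\<omega>. e2ennreal (- Y \<omega>) \<partial>P) \<le> enn2ereal (\<integral>\<^sup>+\<omega>. e2ennreal (- X \<omega>) \<partial>P)"
    using assms by (auto simp: less_eq_ennreal.rep_eq[symmetric] intro!: nn_integral_mono_AE elim!: eventually_mono intro: e2ennreal_mono)
qed

lemma ext_expectation_cong:
  assumes "AE \<omega> in P. X \<omega> = Y \<omega>"
  shows "ext_expectation P X = ext_expectation P Y"
  using assms by (intro antisym ext_expectation_mono) (auto elim: eventually_mono)

text \<open>
  The positive part of \<open>f - g\<close> plus \<open>g\<close> equals the negative part plus \<open>f\<close>; all integrals being finite,
  they may be rearranged.
\<close>

lemma ext_expectation_diff:
  assumes [measurable]: "f \<in> borel_measurable P" "g \<in> borel_measurable P"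
    and fin: "(\<integral>\<^sup>+\<omega>. f \<omega> \<partial>P) < \<infinity>" "(\<integral>\<^sup>+\<omega>. g \<omega> \<partial>P) < \<infinity>"
  shows "ext_expectation P (\<lambda>\<omega>. enn2ereal (f \<omega>) - enn2ereal (g \<omega>)) =
    enn2ereal (\<integral>\<^sup>+\<omega>. f \<omega> \<partial>P) - enn2ereal (\<integral>\<^sup>+\<omega>. g \<omega> \<partial>P)"
proof -
  let ?u = "\<lambda>\<omega>. e2ennreal (enn2ereal (f \<omega>) - enn2ereal (g \<omega>))"
  let ?v = "\<lambda>\<omega>. e2ennreal (- (enn2ereal (f \<omega>) - enn2ereal (g \<omega>)))"
  have "AE \<omega> in P. f \<omega> \<noteq> \<infinity>" "AE \<omega> in P. g \<omega> \<noteq> \<infinity>"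
    using fin by (intro nn_integral_PInf_AE; simp add: less_top)+
  then have pt: "AE \<omega> in P. ?u \<omega> + g \<omega> = ?v \<omega> + f \<omega> \<and> ?u \<omega> \<le> f \<omega> \<and> ?v \<omega> \<le> g \<omega>"
  proof eventually_elim
    case (elim \<omega>)
    then obtain a b where ab: "f \<omega> = ennreal a" "0 \<le> a" "g \<omega> = ennreal b" "0 \<le> b"
      by (cases "f \<omega>"; cases "g \<omega>") auto
    have "?u \<omega> = ennreal (a - b)" "?v \<omega> = ennreal (b - a)"
      using ab by (simp_all add: enn2ereal_ennreal ennreal.abs_eq[symmetric] e2ennreal_ereal)
    then show ?case
      using ab by (cases "a \<le> b") (auto simp: ennreal_plus[symmetric] ennreal_neg simp del: ennreal_plus intro!: ennreal_leI)
  qed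
  have meas [measurable]: "?u \<in> borel_measurable P" "?v \<in> borel_measurable P" by measurable
  have "(\<integral>\<^sup>+\<omega>. ?u \<omega> \<partial>P) + (\<integral>\<^sup>+\<omega>. g \<omega> \<partial>P) = (\<integral>\<^sup>+\<omega>. ?u \<omega> + g \<omega> \<partial>P)"
    by (rule nn_integral_add[symmetric]) measurable
  also have "\<dots> = (\<integral>\<^sup>+\<omega>. ?v \<omega> + f \<omega> \<partial>P)"
    by (rule nn_integral_cong_AE) (use pt in \<open>auto elim: eventually_mono\<close>)
  also have "\<dots> = (\<integral>\<^sup>+\<omega>. ?v \<omega> \<partial>P) + (\<integral>\<^sup>+\<omega>. f \<omega> \<partial>P)"
    by (rule nn_integral_add) measurable
  finally have eq: "(\<integral>\<^sup>+\<omega>. ?u \<omega> \<partial>P) + (\<integral>\<^sup>+\<omega>. g \<omega> \<partial>P) = (\<integral>\<^sup>+\<omega>. ?v \<omega> \<partial>P) + (\<integral>\<^sup>+\<omega>. f \<omega> \<partial>P)" .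
  have "(\<integral>\<^sup>+\<omega>. ?u \<omega> \<partial>P) \<le> (\<integral>\<^sup>+\<omega>. f \<omega> \<partial>P)" "(\<integral>\<^sup>+\<omega>. ?v \<omega> \<partial>P) \<le> (\<integral>\<^sup>+\<omega>. g \<omega> \<partial>P)"
    using pt by (auto intro!: nn_integral_mono_AE elim: eventually_mono)
  then have "(\<integral>\<^sup>+\<omega>. ?u \<omega> \<partial>P) < \<infinity>" "(\<integral>\<^sup>+\<omega>. ?v \<omega> \<partial>P) < \<infinity>"
    using fin le_less_trans by blast+
  then obtain a b where ab: "(\<integral>\<^sup>+\<omega>. ?u \<omega> \<partial>P) = ennreal a" "0 \<le> a" "(\<integral>\<^sup>+\<omega>. ?v \<omega> \<partial>P) = ennreal b" "0 \<le> b"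
    by (cases "\<integral>\<^sup>+\<omega>. ?u \<omega> \<partial>P"; cases "\<integral>\<^sup>+\<omega>. ?v \<omega> \<partial>P") auto
  obtain c d where cd: "(\<integral>\<^sup>+\<omega>. f \<omega> \<partial>P) = ennreal c" "0 \<le> c" "(\<integral>\<^sup>+\<omega>. g \<omega> \<partial>P) = ennreal d" "0 \<le> d"
    using fin by (cases "\<integral>\<^sup>+\<omega>. f \<omega> \<partial>P"; cases "\<integral>\<^sup>+\<omega>. g \<omega> \<partial>P") auto
  from eq ab cd have "a + d = b + c"
    by (simp add: ennreal_plus[symmetric] del: ennreal_plus)
  with ab cd show ?thesis
    by (simp add: ext_expectation_def enn2ereal_ennreal)
qed

lemma ereal_diff_le_of_ennreal_add_le:
  fixes a b c d e :: ennreal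
  assumes "a + b \<le> c + d" "b \<noteq> \<infinity>" "c \<noteq> \<infinity>" "d \<noteq> \<infinity>" "e \<noteq> \<infinity>"
  shows "enn2ereal a - enn2ereal e \<le> enn2ereal (c + d) - enn2ereal (e + b)"
proof -
  have "a \<noteq> \<infinity>" using assms by (auto simp: top_unique)
  then obtain a' b' c' d' e' where *: "a = ennreal a'" "0 \<le> a'" "b = ennreal b'" "0 \<le> b'"
      "c = ennreal c'" "0 \<le> c'" "d = ennreal d'" "0 \<le> d'" "e = ennreal e'" "0 \<le> e'"
    using assms by (cases a; cases b; cases c; cases d; cases e) auto
  then have "a' + b' \<le> c' + d'" using assms(1) by (simp add: ennreal_plus[symmetric] del: ennreal_plus)
  with * show ?thesis by (simp add: ennreal_plus[symmetric] enn2ereal_ennreal del: ennreal_plus)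
qed

section \<open>The first-order inequality\<close>

text \<open>
  Divided by \<open>k0\<^bsup>1-\<alpha>\<^esup>\<close>, this is Young's inequality \<open>w\<^bsup>1-\<alpha>\<^esup> \<le> (1 - \<alpha>) w + \<alpha>\<close> for \<open>w = k / k0\<close>.
\<close>

lemma powr_tangent:
  fixes k k0 \<alpha> :: real
  assumes "0 < \<alpha>" "\<alpha> < 1" "0 \<le> k" "0 < k0"
  shows "k powr (1 - \<alpha>) \<le> k0 powr (1 - \<alpha>) + (1 - \<alpha>) * k0 powr (- \<alpha>) * (k - k0)"
proof (cases "k = 0")
  case True
  have "k0 powr (1 - \<alpha>) = k0 powr (- \<alpha>) * k0"
    using assms by (simp add: powr_diff powr_minus divide_inverse)
  then have "k0 powr (1 - \<alpha>) + (1 - \<alpha>) * k0 powr (- \<alpha>) * (0 - k0) = \<alpha> * (k0 powr (- \<alpha>) * k0)"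
    by (simp add: algebra_simps)
  moreover have "0 \<le> \<alpha> * (k0 powr (- \<alpha>) * k0)" using assms by simp
  ultimately show ?thesis using True by simp
next
  case False
  then have k: "k > 0" using assms by simp
  define w where "w = k / k0"
  have w: "w > 0" "k = w * k0" using k assms by (auto simp: w_def)
  have "w powr (1 - \<alpha>) * 1 powr \<alpha> \<le> (1 - \<alpha>) * w + \<alpha> * 1"
    using Youngs_inequality_0[of "1 - \<alpha>" \<alpha> w 1] assms w by simp
  then have "k0 powr (1 - \<alpha>) * w powr (1 - \<alpha>) \<le> k0 powr (1 - \<alpha>) * (1 + (1 - \<alpha>) * (w - 1))"
    by (intro mult_left_mono) (auto simp: algebra_simps)
  moreover have "k0 powr (1 - \<alpha>) = k0 powr (- \<alpha>) * k0"
    using assms by (simp add: powr_diff powr_minus divide_inverse)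
  ultimately show ?thesis
    using w assms by (simp add: powr_mult algebra_simps)
qed

lemma integral_powr_tangent:
  assumes "finite_measure \<mu>" "1 < p" "0 < \<alpha>" "\<alpha> < 1" and k: "k \<in> Lp_cone \<mu> p" and k0: "0 < k0"
  shows "(\<integral>x. k x powr (1 - \<alpha>) \<partial>\<mu>) \<le> k0 powr (1 - \<alpha>) * measure \<mu> (space \<mu>)
     + (1 - \<alpha>) * k0 powr (- \<alpha>) * ((\<integral>x. k x \<partial>\<mu>) - k0 * measure \<mu> (space \<mu>))"
proof -
  interpret finite_measure \<mu> by fact
  have kL: "k \<in> Lp_space \<mu> p" and k_nn: "AE x in \<mu>. 0 \<le> k x" using k by (auto simp: Lp_cone_def)
  note [measurable] = Lp_spaceD(1)[OF kL]
  note int = Lp_L1_bound(1)[OF assms(1,2) kL]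
  let ?g = "\<lambda>x. k0 powr (1 - \<alpha>) + (1 - \<alpha>) * k0 powr (- \<alpha>) * (k x - k0)"
  have g: "integrable \<mu> ?g" using int by simp
  have le: "AE x in \<mu>. k x powr (1 - \<alpha>) \<le> ?g x"
    using k_nn by eventually_elim (intro powr_tangent assms)
  have "(\<integral>x. k x powr (1 - \<alpha>) \<partial>\<mu>) \<le> (\<integral>x. ?g x \<partial>\<mu>)"
  proof (rule integral_mono_AE[OF _ g le])
    show "integrable \<mu> (\<lambda>x. k x powr (1 - \<alpha>))"
      by (rule Bochner_Integration.integrable_bound[OF g]) (use le in \<open>auto elim!: eventually_mono\<close>)
  qed
  also have "\<dots> = k0 powr (1 - \<alpha>) * measure \<mu> (space \<mu>)
     + (1 - \<alpha>) * k0 powr (- \<alpha>) * ((\<integral>x. k x \<partial>\<mu>) - k0 * measure \<mu> (space \<mu>))"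
    using int by (simp add: algebra_simps)
  finally show ?thesis .
qed

text \<open>
  The tangent inequality is taken at the constant state \<open>exp (lam0 * t) * L\<close>. The increment on the right
  involves only the integral of the state, which the group multiplies by \<open>exp (lam0 * t)\<close>; with the
  discount factor this gives the factor \<open>g\<close>. As the two eigenvalues agree, the profit of the constant
  state is itself a multiple of \<open>g\<close>.
\<close>

lemma (in constant_eigenvector_group) profit_first_order:
  fixes L z t r \<alpha> :: real
  assumes alpha: "0 < \<alpha>" "\<alpha> < 1" and pos: "\<And>t. positivity_preserving \<mu> p (U t)"
    and L: "0 < L" and k: "(\<lambda>x. y x + n x) \<in> Lp_cone \<mu> p" and y: "y \<in> Lp_space \<mu> p" and n: "n \<in> Lp_space \<mu> p"
  defines "g \<equiv> exp (- (r - lam0s) * t) * z powr \<alpha> * (exp (lam0 * t) * L) powr (- \<alpha>)"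
  defines "prof k \<equiv> 1 / (1 - \<alpha>) * z powr \<alpha> * pairing \<mu> (\<lambda>x. 1) (\<lambda>x. k x powr (1 - \<alpha>)) * exp (- r * t)"
  shows "prof (U t (\<lambda>x. y x + (L - y x))) = 1 / (1 - \<alpha>) * g * (L * measure \<mu> (space \<mu>))"
    and "prof (U t (\<lambda>x. y x + n x)) \<le> prof (U t (\<lambda>x. y x + (L - y x)))
      + g * ((\<integral>x. n x \<partial>\<mu>) - (L * measure \<mu> (space \<mu>) - (\<integral>x. y x \<partial>\<mu>)))"
proof -
  define D where "D = measure \<mu> (space \<mu>)"
  define k0 where "k0 = exp (lam0 * t) * L"
  have k0: "0 < k0" using L by (simp add: k0_def)
  have g: "g * L = z powr \<alpha> * exp (- r * t) * k0 powr (1 - \<alpha>)" "g = z powr \<alpha> * exp (- r * t) * (k0 powr (- \<alpha>) * exp (lam0 * t))"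
  proof -
    have e: "exp (- (r - lam0s) * t) = exp (- r * t) * exp (lam0 * t)"
      by (simp add: eigenvalues_eq algebra_simps flip: exp_add)
    then show g: "g = z powr \<alpha> * exp (- r * t) * (k0 powr (- \<alpha>) * exp (lam0 * t))"
      by (simp add: g_def k0_def)
    have "k0 powr (1 - \<alpha>) = k0 powr (- \<alpha>) * k0"
      using k0 by (simp add: powr_diff powr_minus divide_inverse)
    then show "g * L = z powr \<alpha> * exp (- r * t) * k0 powr (1 - \<alpha>)"
      unfolding g by (simp add: k0_def)
  qed
  have "pairing \<mu> (\<lambda>x. 1) (\<lambda>x. U t (\<lambda>x. y x + (L - y x)) x powr (1 - \<alpha>)) = k0 powr (1 - \<alpha>) * D"
  proof -
    have "(\<integral>x. U t (\<lambda>x. L) x powr (1 - \<alpha>) \<partial>\<mu>) = (\<integral>x. k0 powr (1 - \<alpha>) \<partial>\<mu>)"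
    proof (rule integral_cong_AE)
      show "AE x in \<mu>. U t (\<lambda>x. L) x powr (1 - \<alpha>) = k0 powr (1 - \<alpha>)"
        using U_const[of t L] by eventually_elim (simp add: k0_def)
    qed (use U_measurable[OF const_Lp] in auto)
    then show ?thesis by (simp add: pairing_def D_def mult.commute)
  qed
  then have star: "prof (U t (\<lambda>x. y x + (L - y x))) = 1 / (1 - \<alpha>) * z powr \<alpha> * (k0 powr (1 - \<alpha>) * D) * exp (- r * t)"
    by (simp add: prof_def)
  also have "\<dots> = 1 / (1 - \<alpha>) * (z powr \<alpha> * exp (- r * t) * k0 powr (1 - \<alpha>)) * D"
    by (simp only: mult_ac)
  also have "\<dots> = 1 / (1 - \<alpha>) * g * (L * measure \<mu> (space \<mu>))"
    unfolding g(1)[symmetric] D_def by (simp only: mult_ac)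
  finally show "prof (U t (\<lambda>x. y x + (L - y x))) = 1 / (1 - \<alpha>) * g * (L * measure \<mu> (space \<mu>))" .
  let ?K = "U t (\<lambda>x. y x + n x)"
  have K: "?K \<in> Lp_cone \<mu> p" using pos k by (simp add: positivity_preserving_def)
  have intK: "(\<integral>x. ?K x \<partial>\<mu>) = exp (lam0 * t) * ((\<integral>x. y x \<partial>\<mu>) + (\<integral>x. n x \<partial>\<mu>))"
    using integral_U[OF Lp_space_add[OF p_nonneg y n]] Lp_L1_bound(1)[OF finite_mu p y] Lp_L1_bound(1)[OF finite_mu p n]
    by (simp add: eigenvalues_eq)
  define c where "c = 1 / (1 - \<alpha>) * z powr \<alpha> * exp (- r * t)"
  have c: "0 \<le> c" "c * (1 - \<alpha>) = z powr \<alpha> * exp (- r * t)" using alpha by (simp_all add: c_def)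
  have "prof ?K = c * (\<integral>x. ?K x powr (1 - \<alpha>) \<partial>\<mu>)"
    by (simp add: prof_def pairing_def c_def)
  also have "\<dots> \<le> c * (k0 powr (1 - \<alpha>) * D + (1 - \<alpha>) * k0 powr (- \<alpha>) * ((\<integral>x. ?K x \<partial>\<mu>) - k0 * D))"
    unfolding D_def by (intro mult_left_mono integral_powr_tangent[OF finite_mu p alpha K k0] c)
  also have "\<dots> = c * (k0 powr (1 - \<alpha>) * D) + (c * (1 - \<alpha>)) * k0 powr (- \<alpha>) * ((\<integral>x. ?K x \<partial>\<mu>) - k0 * D)"
    by (simp only: distrib_left mult.assoc)
  also have "c * (k0 powr (1 - \<alpha>) * D) = prof (U t (\<lambda>x. y x + (L - y x)))"
    unfolding star c_def by (simp only: mult_ac)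
  also have "(\<integral>x. ?K x \<partial>\<mu>) - k0 * D = exp (lam0 * t) * ((\<integral>x. n x \<partial>\<mu>) - (L * D - (\<integral>x. y x \<partial>\<mu>)))"
    unfolding intK k0_def by (simp add: algebra_simps)
  also have "(c * (1 - \<alpha>)) * k0 powr (- \<alpha>) * (exp (lam0 * t) * ((\<integral>x. n x \<partial>\<mu>) - (L * D - (\<integral>x. y x \<partial>\<mu>))))
     = g * ((\<integral>x. n x \<partial>\<mu>) - (L * D - (\<integral>x. y x \<partial>\<mu>)))"
    unfolding c(2) g(2) by simp
  finally show "prof ?K \<le> prof (U t (\<lambda>x. y x + (L - y x)))
      + g * ((\<integral>x. n x \<partial>\<mu>) - (L * measure \<mu> (space \<mu>) - (\<integral>x. y x \<partial>\<mu>)))"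
    unfolding D_def .
qed

lemma borel_measurable_nondecreasing_max:
  fixes f :: "real \<Rightarrow> real"
  assumes "\<And>s t. 0 \<le> s \<Longrightarrow> s \<le> t \<Longrightarrow> f s \<le> f t"
  shows "(\<lambda>t. f (max 0 t)) \<in> borel_measurable borel"
  by (rule borel_measurable_mono) (auto intro!: monoI assms)

text \<open>
  Integrates the first-order inequality over time. The terms are arranged as sums, so that no
  difference of infinite quantities occurs. The first claim shows that the profit of the candidate has
  finite expectation once its gain has.
\<close>

lemma (in constant_eigenvector_group) path_comparison:
  fixes L z :: "real \<Rightarrow> real" and g :: "real \<Rightarrow> ennreal"
  assumes alpha: "0 < \<alpha>" "\<alpha> < 1" and pos: "\<And>t. positivity_preserving \<mu> p (U t)"
    and L_pos: "\<And>t. 0 \<le> t \<Longrightarrow> 0 < L t" and L_mono: "\<And>s t. 0 \<le> s \<Longrightarrow> s \<le> t \<Longrightarrow> L s \<le> L t"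
    and y: "y \<in> Lp_cone \<mu> p" "AE x in \<mu>. y x \<le> L 0"
    and g_meas: "g \<in> borel_measurable borel"
    and g: "\<And>t. 0 \<le> t \<Longrightarrow> g t = ennreal (exp (- (r - lam0s) * t) * z t powr \<alpha> * (exp (lam0 * t) * L t) powr (- \<alpha>))"
  defines "prof t k \<equiv> 1 / (1 - \<alpha>) * z t powr \<alpha> * pairing \<mu> (\<lambda>x. 1) (\<lambda>x. k x powr (1 - \<alpha>)) * exp (- r * t)"
    and "M t \<equiv> L t * measure \<mu> (space \<mu>) - (\<integral>x. y x \<partial>\<mu>)"
  shows "(\<integral>\<^sup>+t\<in>{0..}. ennreal (prof t (U t (\<lambda>x. y x + (L t - y x)))) \<partial>lborel) =
      ennreal (1 / (1 - \<alpha>)) * ((\<integral>\<^sup>+t\<in>{0..}. g t * ennreal (M t) \<partial>lborel) + ennreal (\<integral>x. y x \<partial>\<mu>) * (\<integral>\<^sup>+t\<in>{0..}. g t \<partial>lborel))"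
    and "control_path \<mu> p n \<Longrightarrow>
      (\<integral>\<^sup>+t\<in>{0..}. ennreal (prof t (U t (\<lambda>x. y x + n t x))) \<partial>lborel) + (\<integral>\<^sup>+t\<in>{0..}. g t * ennreal (M t) \<partial>lborel)
      \<le> (\<integral>\<^sup>+t\<in>{0..}. ennreal (prof t (U t (\<lambda>x. y x + (L t - y x)))) \<partial>lborel)
        + (\<integral>\<^sup>+t\<in>{0..}. g t * ennreal (mass \<mu> n t) \<partial>lborel)"
proof -
  let ?star = "\<integral>\<^sup>+t\<in>{0..}. ennreal (prof t (U t (\<lambda>x. y x + (L t - y x)))) \<partial>lborel"
  define D where "D = measure \<mu> (space \<mu>)"
  define Y where "Y = (\<integral>x. y x \<partial>\<mu>)"
  have yL: "y \<in> Lp_space \<mu> p" using y(1) Lp_cone_subset by blast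
  have Y0: "0 \<le> Y" unfolding Y_def using y(1) by (intro integral_nonneg_AE) (auto simp: Lp_cone_def)
  have "Y \<le> (\<integral>x. L 0 \<partial>\<mu>)"
    unfolding Y_def using y(2) by (intro integral_mono_AE Lp_L1_bound(1)[OF finite_mu p yL]) auto
  then have Y_le: "Y \<le> L 0 * D" by (simp add: D_def mult.commute)
  have M0: "0 \<le> M t" if "0 \<le> t" for t
    using Y_le mult_right_mono[OF L_mono[OF order_refl that], of D] by (simp add: M_def D_def Y_def)
  have M_eq: "L t * D = M t + Y" for t by (simp add: M_def D_def Y_def)
  define G where "G t = exp (- (r - lam0s) * t) * z t powr \<alpha> * (exp (lam0 * t) * L t) powr (- \<alpha>)" for t
  have G0: "0 \<le> G t" for t by (simp add: G_def)
  have gG: "g t = ennreal (G t)" if "0 \<le> t" for t unfolding g[OF that] G_def ..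
  note [measurable] = g_meas
  have [measurable]: "(\<lambda>t. M (max 0 t)) \<in> borel_measurable borel"
    using L_mono by (intro borel_measurable_nondecreasing_max) (simp add: M_def mult_right_mono)
  have prof0: "0 \<le> prof t k" for t k
    using alpha by (simp add: prof_def pairing_def integral_nonneg_AE)
  note first = profit_first_order[OF alpha pos L_pos, where y = y and r = r, folded D_def Y_def]
  have star: "ennreal (prof t (U t (\<lambda>x. y x + (L t - y x)))) = ennreal (1 / (1 - \<alpha>)) * (g t * ennreal (M t) + ennreal Y * g t)"
    if t: "0 \<le> t" for t
  proof -
    have "(\<lambda>x. y x + y x) \<in> Lp_cone \<mu> p"
      using y(1) Lp_space_add[OF p_nonneg yL yL] by (auto simp: Lp_cone_def)
    from first(1)[OF t this yL yL, of "z t" t]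
    have "prof t (U t (\<lambda>x. y x + (L t - y x))) = 1 / (1 - \<alpha>) * G t * (L t * D)"
      unfolding prof_def G_def .
    also have "\<dots> = 1 / (1 - \<alpha>) * (G t * M t + Y * G t)"
      unfolding M_eq by (simp add: algebra_simps add_divide_distrib)
    finally have prof: "prof t (U t (\<lambda>x. y x + (L t - y x))) = 1 / (1 - \<alpha>) * (G t * M t + Y * G t)" .
    have "0 \<le> G t * M t" "0 \<le> Y * G t" "0 \<le> 1 / (1 - \<alpha>)" using G0 M0[OF t] Y0 alpha by simp_all
    then show ?thesis
      unfolding prof gG[OF t] using G0 M0[OF t] Y0
      by (simp only: ennreal_mult[symmetric] ennreal_plus[symmetric] add_nonneg_nonneg)
  qed
  have "?star = (\<integral>\<^sup>+t. ennreal (1 / (1 - \<alpha>)) * (g t * ennreal (M (max 0 t)) * indicator {0..} t + ennreal Y * (g t * indicator {0..} t)) \<partial>lborel)"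
    by (intro nn_integral_cong) (use star in \<open>auto simp: indicator_def\<close>)
  also have "\<dots> = ennreal (1 / (1 - \<alpha>)) * ((\<integral>\<^sup>+t. g t * ennreal (M (max 0 t)) * indicator {0..} t \<partial>lborel) + ennreal Y * (\<integral>\<^sup>+t\<in>{0..}. g t \<partial>lborel))"
    by (simp add: nn_integral_cmult nn_integral_add)
  also have "(\<integral>\<^sup>+t. g t * ennreal (M (max 0 t)) * indicator {0..} t \<partial>lborel) = (\<integral>\<^sup>+t\<in>{0..}. g t * ennreal (M t) \<partial>lborel)"
    by (intro nn_integral_cong) (auto simp: indicator_def)
  finally show "?star = ennreal (1 / (1 - \<alpha>)) * ((\<integral>\<^sup>+t\<in>{0..}. g t * ennreal (M t) \<partial>lborel) + ennreal (\<integral>x. y x \<partial>\<mu>) * (\<integral>\<^sup>+t\<in>{0..}. g t \<partial>lborel))"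
    by (simp add: Y_def)
  assume n: "control_path \<mu> p n"
  have nC: "n t \<in> Lp_cone \<mu> p" "n t \<in> Lp_space \<mu> p" if "0 \<le> t" for t
    using n that Lp_cone_subset by (auto simp: control_path_def)
  have mass: "nondecreasing_rc (mass \<mu> n)" by (rule nondecreasing_rc_mass[OF finite_mu p n])
  have mass0: "0 \<le> mass \<mu> n t" if "0 \<le> t" for t
    using mass that unfolding nondecreasing_rc_def by (meson order_refl order_trans)
  have [measurable]: "(\<lambda>t. mass \<mu> n (max 0 t)) \<in> borel_measurable borel"
    using mass by (intro borel_measurable_nondecreasing_max) (simp add: nondecreasing_rc_def)
  have le: "ennreal (prof t (U t (\<lambda>x. y x + n t x))) + g t * ennreal (M t)
      \<le> ennreal (prof t (U t (\<lambda>x. y x + (L t - y x)))) + g t * ennreal (mass \<mu> n t)" if t: "0 \<le> t" for t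
  proof -
    have "(\<lambda>x. y x + n t x) \<in> Lp_cone \<mu> p"
      using y(1) nC[OF t] Lp_space_add[OF p_nonneg yL nC(2)[OF t]] by (auto simp: Lp_cone_def)
    from first(2)[OF t this yL nC(2)[OF t], of "z t" t]
    have "prof t (U t (\<lambda>x. y x + n t x)) \<le> prof t (U t (\<lambda>x. y x + (L t - y x))) + G t * (mass \<mu> n t - (L t * D - Y))"
      unfolding prof_def G_def mass_def .
    moreover have "G t * (mass \<mu> n t - (L t * D - Y)) = G t * mass \<mu> n t - G t * M t"
      unfolding M_eq by (simp add: algebra_simps)
    ultimately have "prof t (U t (\<lambda>x. y x + n t x)) + G t * M t \<le> prof t (U t (\<lambda>x. y x + (L t - y x))) + G t * mass \<mu> n t"
      by linarith
    then have "ennreal (prof t (U t (\<lambda>x. y x + n t x)) + G t * M t) \<le> ennreal (prof t (U t (\<lambda>x. y x + (L t - y x))) + G t * mass \<mu> n t)"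
      by (rule ennreal_leI)
    then show ?thesis
      using prof0 G0 M0[OF t] mass0[OF t] by (simp add: gG[OF t] ennreal_mult)
  qed
  let ?a = "\<lambda>t. g t * ennreal (M (max 0 t)) * indicator {0..} t"
  let ?b = "\<lambda>t. g t * ennreal (mass \<mu> n (max 0 t)) * indicator {0..} t"
  let ?s = "\<lambda>t. ennreal (1 / (1 - \<alpha>)) * (?a t + ennreal Y * (g t * indicator {0..} t))"
  have eqs: "(\<integral>\<^sup>+t\<in>{0..}. g t * ennreal (M t) \<partial>lborel) = (\<integral>\<^sup>+t. ?a t \<partial>lborel)"
    "(\<integral>\<^sup>+t\<in>{0..}. g t * ennreal (mass \<mu> n t) \<partial>lborel) = (\<integral>\<^sup>+t. ?b t \<partial>lborel)"
    "?star = (\<integral>\<^sup>+t. ?s t \<partial>lborel)"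
    by (intro nn_integral_cong; use star in \<open>auto simp: indicator_def\<close>)+
  have "(\<integral>\<^sup>+t\<in>{0..}. ennreal (prof t (U t (\<lambda>x. y x + n t x))) \<partial>lborel) + (\<integral>\<^sup>+t. ?a t \<partial>lborel)
      \<le> (\<integral>\<^sup>+t. ennreal (prof t (U t (\<lambda>x. y x + n t x))) * indicator {0..} t + ?a t \<partial>lborel)"
    by (rule nn_integral_superadditive) measurable
  also have "\<dots> \<le> (\<integral>\<^sup>+t. ?s t + ?b t \<partial>lborel)"
    using le star by (intro nn_integral_mono) (auto simp: indicator_def)
  also have "\<dots> = (\<integral>\<^sup>+t. ?s t \<partial>lborel) + (\<integral>\<^sup>+t. ?b t \<partial>lborel)"
    by (rule nn_integral_add) measurable
  finally show "(\<integral>\<^sup>+t\<in>{0..}. ennreal (prof t (U t (\<lambda>x. y x + n t x))) \<partial>lborel) + (\<integral>\<^sup>+t\<in>{0..}. g t * ennreal (M t) \<partial>lborel)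
      \<le> ?star + (\<integral>\<^sup>+t\<in>{0..}. g t * ennreal (mass \<mu> n t) \<partial>lborel)"
    unfolding eqs .
qed

section \<open>Optimality of the candidate\<close>

theorem proposition4p9:
  fixes \<mu> :: "'d measure" and p :: real
    and P :: "'w measure" and F :: "ennreal \<Rightarrow> 'w measure"
    and A :: "(('d \<Rightarrow> real) \<times> ('d \<Rightarrow> real)) set"
    and U V :: "real \<Rightarrow> ('d \<Rightarrow> real) \<Rightarrow> ('d \<Rightarrow> real)"
    and r lam0 lam0s \<alpha> :: real
    and z \<phi> l :: "real \<Rightarrow> 'w \<Rightarrow> real"
    and y :: "'d \<Rightarrow> real"
  assumes "finite_measure \<mu>" and "1 < p"
    and "usual_conditions P F"
    \<comment> \<open>the generator, the group \<open>U t = e\<^bsup>tA\<^esup>\<close> and its adjoint \<open>V t\<close>\<close>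
    and "closed_operator \<mu> p A" and "densely_defined \<mu> p A"
    and "C0_group \<mu> p U" and "A = generator \<mu> p U"
    and "\<And>t. positivity_preserving \<mu> p (U t)"
    and "\<And>t. is_adjoint \<mu> p (U t) (V t)"
    and "eigenvector \<mu> A lam0 (\<lambda>x. 1)"
    and "eigenvector \<mu> (adjoint_graph \<mu> p A) lam0s (\<lambda>x. 1)"
    and "r > max lam0s 0"
    and "0 < \<alpha>" and "\<alpha> < 1"
    \<comment> \<open>the processes entering the profit and the marginal cost\<close>
    and "progressive F z" and "AE \<omega> in P. \<forall>t\<ge>0. 0 \<le> z t \<omega>"
    and "progressive F \<phi>" and "AE \<omega> in P. (\<forall>t\<ge>0. 0 \<le> \<phi> t \<omega>) \<and> cadlag (\<lambda>t. \<phi> t \<omega>)"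
    and "class_D P F (discounted r lam0s \<phi>)" and "lsc_in_expectation P F (discounted r lam0s \<phi>)"
    and "AE \<omega> in P. Limsup at_top (\<lambda>t. ereal (discounted r lam0s \<phi> t \<omega>)) = 0"
    and "(\<integral>\<^sup>+\<omega>. (\<integral>\<^sup>+t\<in>{0..}. ennreal (exp (- min r (r - lam0s) * t) * z t \<omega> powr \<alpha>) \<partial>lborel) \<partial>P) < \<infinity>"
    and "\<exists>m>0. \<forall>s\<ge>0. AE \<omega> in P.
           nn_cond_exp P (F (ennreal s))
             (\<lambda>\<omega>. \<integral>\<^sup>+t\<in>{s..}. ennreal (exp (- (r - lam0s) * t) * z t \<omega> powr \<alpha>) \<partial>lborel) \<omega>
           \<le> ennreal (m * discounted r lam0s \<phi> s \<omega>)"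
    \<comment> \<open>the process \<open>l\<close>; its running supremum is finite since the control is \<open>K\<^sub>+\<close>-valued\<close>
    and "optional_process P F l"
    and "AE \<omega> in P. (\<forall>t\<ge>0. 0 < l t \<omega>) \<and> upper_right_continuous (\<lambda>t. l t \<omega>)"
    and "AE \<omega> in P. \<forall>t\<ge>0. bdd_above ((\<lambda>u. exp (- lam0 * u) * l u \<omega>) ` {0..t})"
    and "\<And>s. 0 \<le> s \<Longrightarrow> integrable (P \<Otimes>\<^sub>M lborel)
           (\<lambda>(\<omega>, t). indicator {s..} t * backward_integrand r lam0 lam0s \<alpha> z l s t \<omega>)"
    and "solves_backward_equation P F r lam0 lam0s \<alpha> z \<phi> l"
    \<comment> \<open>the initial state, and finiteness of the cost of the candidate\<close>
    and "y \<in> Lp_cone \<mu> p" and "AE \<omega> in P. AE x in \<mu>. y x \<le> l 0 \<omega>"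
    and "(\<integral>\<^sup>+\<omega>. total_cost \<mu> p V r \<phi> (optimal_control lam0 l y) \<omega> \<partial>P) < \<infinity>"
  shows "optimal_control lam0 l y \<in> admissible \<mu> p P F V r \<phi> \<and>
    payoff \<mu> p P U V r \<alpha> z \<phi> y (optimal_control lam0 l y)
      = (SUP \<nu>\<in>admissible \<mu> p P F V r \<phi>. payoff \<mu> p P U V r \<alpha> z \<phi> y \<nu>)"
proof -
  have A: "A = generator \<mu> p U" by (rule assms(7))
  interpret G: constant_eigenvector_group \<mu> p U lam0 lam0s
    by (rule constant_eigenvector_group.intro) (use assms(1,2,5,6,10,11) in \<open>simp_all add: A\<close>)
  interpret B: base_capacity P F r lam0 lam0s \<alpha> z \<phi> l
    by unfold_locales (fact assms)+
  have yL: "y \<in> Lp_space \<mu> p" using assms(29) Lp_cone_subset by blast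
  interpret Sh: shifted_path \<mu> p y
    by (rule shifted_path.intro) (fact assms G.measure_pos yL)+
  define D where "D = measure \<mu> (space \<mu>)"
  define Y where "Y = (\<integral>x. y x \<partial>\<mu>)"
  define L where "L = (\<lambda>t \<omega>. running_sup lam0 l 0 t \<omega>)"
  define nu where "nu = optimal_control lam0 l y"
  have nu: "nu t \<omega> = Sh.shift (L t \<omega>)" for t \<omega>
    by (simp add: nu_def L_def optimal_control_def Sh.shift_def)
  define M where "M = (\<lambda>t \<omega>. L t \<omega> * D - Y)"
  have mass_nu: "mass \<mu> (\<lambda>t. nu t \<omega>) t = M t \<omega>" for t \<omega>
    unfolding nu by (simp add: Sh.mass_shift M_def D_def Y_def)
  have L_path: "(0 < L t \<omega>) \<and> (\<forall>s\<in>{0..t}. L s \<omega> \<le> L t \<omega>) \<and> ((\<lambda>s. L s \<omega>) \<longlongrightarrow> L t \<omega>) (at_right t) \<and> L 0 \<omega> = l 0 \<omega>"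
    if path: "base_path (\<lambda>t. B.X t \<omega>)" and t: "0 \<le> t" for t \<omega>
  proof (intro conjI ballI)
    show "0 < L t \<omega>"
      unfolding L_def running_sup_eq by (rule base_path_running_sup_mono(2)[OF path, of 0 0 t t]) (use t in auto)
    show "L s \<omega> \<le> L t \<omega>" if "s \<in> {0..t}" for s
      unfolding L_def running_sup_eq by (rule base_path_running_sup_mono(1)[OF path]) (use that in auto)
    show "((\<lambda>s. L s \<omega>) \<longlongrightarrow> L t \<omega>) (at_right t)"
      unfolding L_def running_sup_eq
      by (rule running_sup_right_continuous) (use path t in \<open>auto simp: base_path_def\<close>)
    show "L 0 \<omega> = l 0 \<omega>" by (simp add: L_def running_sup_eq base_process_def)
  qed
  have shift_path: "control_path \<mu> p (\<lambda>t. nu t \<omega>) \<and> finite_variation \<mu> p (\<lambda>t. nu t \<omega>)"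
    if path: "base_path (\<lambda>t. B.X t \<omega>)" and y_le: "AE x in \<mu>. y x \<le> l 0 \<omega>" for \<omega>
  proof -
    have "AE x in \<mu>. y x \<le> L 0 \<omega>" using y_le L_path[OF path, of 0] by simp
    then show ?thesis
      unfolding nu
      by (intro conjI Sh.control_path_shift Sh.finite_variation_shift) (use L_path[OF path] in auto)
  qed
  have regular: "AE \<omega> in P. base_path (\<lambda>t. B.X t \<omega>) \<and> (AE x in \<mu>. y x \<le> l 0 \<omega>)"
    using B.AE_base_path assms(30) by eventually_elim simp
  have nu_controls: "nu \<in> controls \<mu> p P F"
  proof -
    have "nu t \<in> F (ennreal t) \<rightarrow>\<^sub>M Lp_borel \<mu> p" if "0 \<le> t" for t
      using Sh.measurable_shift[OF B.running_sup_adapted[OF that]] by (simp add: nu[abs_def] L_def)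
    moreover have "AE \<omega> in P. control_path \<mu> p (\<lambda>t. nu t \<omega>) \<and> finite_variation \<mu> p (\<lambda>t. nu t \<omega>)"
      using regular by eventually_elim (use shift_path in blast)
    ultimately show ?thesis
      unfolding controls_def control_path_def by (auto elim!: eventually_mono)
  qed
  have nu_adm: "nu \<in> admissible \<mu> p P F V r \<phi>"
    using nu_controls assms(31) by (simp add: admissible_def nu_def)
  define N where "N = (\<lambda>\<nu> t (\<omega>::'w). mass \<mu> (\<lambda>t. \<nu> t \<omega>) t)"
  have control: "AE \<omega> in P. control_path \<mu> p (\<lambda>t. \<nu> t \<omega>)" if "\<nu> \<in> controls \<mu> p P F" for \<nu>
    using that unfolding controls_def control_path_def by (auto elim!: eventually_mono)
  have N_adapted: "N \<nu> t \<in> borel_measurable (F (ennreal t))" if "\<nu> \<in> controls \<mu> p P F" "0 \<le> t" for \<nu> t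
    using measurable_compose[OF _ measurable_integral_Lp_borel[OF assms(1,2)], of "\<nu> t"] that
    by (simp add: N_def mass_def[abs_def] controls_def)
  have N_path: "AE \<omega> in P. nondecreasing_rc (\<lambda>t. N \<nu> t \<omega>)" if "\<nu> \<in> controls \<mu> p P F" for \<nu>
    using control[OF that] by eventually_elim (simp add: N_def nondecreasing_rc_mass[OF assms(1,2)])
  have cost: "AE \<omega> in P. total_cost \<mu> p V r \<phi> \<nu> \<omega> = B.cost (N \<nu>) \<omega>" if "\<nu> \<in> controls \<mu> p P F" for \<nu>
    using control[OF that] assms(18) AE_space
  proof eventually_elim
    case (elim \<omega>)
    have "(\<lambda>s. \<phi> (max 0 s) \<omega>) \<in> borel_measurable borel"
      using measurable_compose[OF measurable_Pair2'[OF elim(3)] progressive_jointly_measurable[OF assms(17) B.subalg_F]]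
      by simp
    from G.path_integral_eq_time_change[OF assms(9) elim(1) this, of r] elim(2)
    show ?case
      by (simp add: total_cost_def marginal_cost_def B.cost_def discounted_def N_def)
  qed
  have N_nu: "N nu = M" by (intro ext) (simp add: N_def mass_nu)
  note adapted_nu = N_adapted[OF nu_controls, unfolded N_nu] and path_nu = N_path[OF nu_controls, unfolded N_nu]
  \<comment> \<open>the mass of the candidate grows only when the running supremum reaches a new level\<close>
  have flat: "AE \<omega> in P. \<forall>u\<ge>0. \<forall>t\<ge>0. time_change (\<lambda>t. M t \<omega>) u < ennreal t \<longrightarrow>
      running_sup lam0 l 0 t \<omega> = running_sup lam0 l (enn2real (time_change (\<lambda>t. M t \<omega>) u)) t \<omega>"
    using regular path_nu
  proof eventually_elim
    case (elim \<omega>)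
    then show ?case
      using running_sup_after_time_change[of "\<lambda>t. B.X t \<omega>" D _ "\<lambda>t. M t \<omega>" Y] G.measure_pos
      by (simp add: running_sup_eq M_def L_def D_def)
  qed
  have gain_nu: "(\<integral>\<^sup>+\<omega>. B.gain M \<omega> \<partial>P) = (\<integral>\<^sup>+\<omega>. B.cost M \<omega> \<partial>P)"
    by (rule B.expectation_gain_eq[OF adapted_nu path_nu flat])
  have fin_cost: "(\<integral>\<^sup>+\<omega>. B.cost (N \<nu>) \<omega> \<partial>P) < \<infinity>" if "\<nu> \<in> admissible \<mu> p P F V r \<phi>" for \<nu>
    using that nn_integral_cong_AE[OF cost, of \<nu>] by (simp add: admissible_def)
  note fin_cost_nu = fin_cost[OF nu_adm, unfolded N_nu]
  let ?g = "B.marginal_profit (\<lambda>_. 0)"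
  define \<Gamma> where "\<Gamma> \<omega> = (\<integral>\<^sup>+t\<in>{0..}. ?g \<omega> t \<partial>lborel)" for \<omega>
  have g_meas: "(\<lambda>x. ?g (fst x) (snd x)) \<in> borel_measurable (P \<Otimes>\<^sub>M borel)"
    using B.marginal_profit_measurable[of "\<lambda>_. 0"] by (simp add: split_beta')
  have \<Gamma>_meas: "\<Gamma> \<in> borel_measurable P"
    unfolding \<Gamma>_def
  proof (rule lborel.borel_measurable_nn_integral)
    note [measurable] = g_meas
    show "(\<lambda>(\<omega>, t). ?g \<omega> t * indicator {0..} t) \<in> borel_measurable (P \<Otimes>\<^sub>M lborel)"
      unfolding split_beta' by measurable
  qed
  have \<Gamma>_fin: "(\<integral>\<^sup>+\<omega>. \<Gamma> \<omega> \<partial>P) < \<infinity>"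
  proof -
    let ?f = "\<lambda>(\<omega>, t). indicator {0..} t * backward_integrand r lam0 lam0s \<alpha> z l 0 t \<omega>"
    have int: "integrable (P \<Otimes>\<^sub>M lborel) ?f" by (rule assms(27)) simp
    have "(\<integral>\<^sup>+\<omega>. \<Gamma> \<omega> \<partial>P) \<le> (\<integral>\<^sup>+\<omega>. (\<integral>\<^sup>+t. ennreal (norm (?f (\<omega>, t))) \<partial>lborel) \<partial>P)"
    proof (rule nn_integral_mono_AE)
      show "AE \<omega> in P. \<Gamma> \<omega> \<le> (\<integral>\<^sup>+t. ennreal (norm (?f (\<omega>, t))) \<partial>lborel)"
        using B.AE_good AE_space
      proof eventually_elim
        case (elim \<omega>)
        show ?case
          unfolding \<Gamma>_def using B.marginal_profit_eq[OF elim(2,1), of _ "\<lambda>_. 0"]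
          by (intro nn_integral_mono) (auto simp: indicator_def intro!: ennreal_leI)
      qed
    qed
    also have "\<dots> = (\<integral>\<^sup>+x. ennreal (norm (?f x)) \<partial>(P \<Otimes>\<^sub>M lborel))"
      using int by (intro lborel.nn_integral_fst) auto
    also have "\<dots> < \<infinity>" using int by (simp add: integrable_iff_bounded)
    finally show ?thesis .
  qed
  \<comment> \<open>a measurable expression for the profit of the candidate\<close>
  define T where "T \<omega> = ennreal (1 / (1 - \<alpha>)) * (B.gain M \<omega> + ennreal Y * \<Gamma> \<omega>)" for \<omega>
  have comparison: "total_profit \<mu> U r \<alpha> z y nu \<omega> = T \<omega> \<and>
      (control_path \<mu> p (\<lambda>t. \<nu> t \<omega>) \<longrightarrow>
        total_profit \<mu> U r \<alpha> z y \<nu> \<omega> + B.gain M \<omega> \<le> T \<omega> + B.gain (N \<nu>) \<omega>)"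
    if path: "base_path (\<lambda>t. B.X t \<omega>)" and y_le: "AE x in \<mu>. y x \<le> l 0 \<omega>" and \<omega>: "\<omega> \<in> space P" for \<omega> \<nu>
  proof -
    have good: "\<omega> \<notin> B.bad_paths" using path by (simp add: B.bad_paths_def)
    have L_pos: "0 < L t \<omega>" if "0 \<le> t" for t using L_path[OF path that] by blast
    have L_mono: "L s \<omega> \<le> L t \<omega>" if "0 \<le> s" "s \<le> t" for s t using L_path[OF path, of t] that by auto
    have y_le': "AE x in \<mu>. y x \<le> L 0 \<omega>" using y_le L_path[OF path, of 0] by simp
    have g_borel: "?g \<omega> \<in> borel_measurable borel"
      using measurable_compose[OF measurable_Pair1'[OF \<omega>] g_meas] by simp
    have g_eq: "?g \<omega> t = ennreal (exp (- (r - lam0s) * t) * z t \<omega> powr \<alpha> * (exp (lam0 * t) * L t \<omega>) powr (- \<alpha>))"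
      if "0 \<le> t" for t
      using B.marginal_profit_eq[OF \<omega> good that, of "\<lambda>_. 0"] by (simp add: backward_integrand_def L_def)
    note comp = G.path_comparison[OF assms(13,14,8) L_pos L_mono assms(29) y_le' g_borel g_eq, folded D_def Y_def]
    have T: "total_profit \<mu> U r \<alpha> z y nu \<omega> = T \<omega>"
      using comp(1) by (simp add: total_profit_def profit_def nu Sh.shift_def T_def B.gain_def M_def \<Gamma>_def)
    show ?thesis
    proof (intro conjI impI T)
      assume n: "control_path \<mu> p (\<lambda>t. \<nu> t \<omega>)"
      show "total_profit \<mu> U r \<alpha> z y \<nu> \<omega> + B.gain M \<omega> \<le> T \<omega> + B.gain (N \<nu>) \<omega>"
        unfolding T[symmetric]
        using comp(2)[of "\<lambda>t. \<nu> t \<omega>"] n by (simp add: total_profit_def profit_def nu Sh.shift_def B.gain_def M_def N_def)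
    qed
  qed
  note gain_meas_nu = B.gain_measurable[OF adapted_nu path_nu]
    and cost_meas_nu = B.cost_measurable[OF adapted_nu path_nu]
  have gain_fin_nu: "(\<integral>\<^sup>+\<omega>. B.gain M \<omega> \<partial>P) < \<infinity>" using gain_nu fin_cost_nu by simp
  note [measurable] = gain_meas_nu cost_meas_nu \<Gamma>_meas
  have T_meas [measurable]: "T \<in> borel_measurable P" unfolding T_def by measurable
  have T_fin: "(\<integral>\<^sup>+\<omega>. T \<omega> \<partial>P) < \<infinity>"
    using gain_fin_nu \<Gamma>_fin unfolding T_def
    by (simp add: nn_integral_cmult nn_integral_add ennreal_mult_less_top)
  have payoff_nu: "payoff \<mu> p P U V r \<alpha> z \<phi> y nu = enn2ereal (\<integral>\<^sup>+\<omega>. T \<omega> \<partial>P) - enn2ereal (\<integral>\<^sup>+\<omega>. B.cost M \<omega> \<partial>P)"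
  proof -
    have "payoff \<mu> p P U V r \<alpha> z \<phi> y nu = ext_expectation P (\<lambda>\<omega>. enn2ereal (T \<omega>) - enn2ereal (B.cost M \<omega>))"
      unfolding payoff_def
    proof (rule ext_expectation_cong)
      show "AE \<omega> in P. enn2ereal (total_profit \<mu> U r \<alpha> z y nu \<omega>) - enn2ereal (total_cost \<mu> p V r \<phi> nu \<omega>) =
          enn2ereal (T \<omega>) - enn2ereal (B.cost M \<omega>)"
        using regular cost[OF nu_controls] AE_space by eventually_elim (simp add: comparison N_nu)
    qed
    also have "\<dots> = enn2ereal (\<integral>\<^sup>+\<omega>. T \<omega> \<partial>P) - enn2ereal (\<integral>\<^sup>+\<omega>. B.cost M \<omega> \<partial>P)"
      by (rule ext_expectation_diff[OF T_meas cost_meas_nu T_fin fin_cost_nu])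
    finally show ?thesis .
  qed
  have optimal: "payoff \<mu> p P U V r \<alpha> z \<phi> y \<nu> \<le> payoff \<mu> p P U V r \<alpha> z \<phi> y nu"
    if \<nu>: "\<nu> \<in> admissible \<mu> p P F V r \<phi>" for \<nu>
  proof -
    have ctl: "\<nu> \<in> controls \<mu> p P F" using \<nu> by (simp add: admissible_def)
    note ad = N_adapted[OF ctl] and pa = N_path[OF ctl]
    have [measurable]: "B.gain (N \<nu>) \<in> borel_measurable P" by (rule B.gain_measurable[OF ad pa])
    have [measurable]: "B.cost (N \<nu>) \<in> borel_measurable P" by (rule B.cost_measurable[OF ad pa])
    have gain_le: "(\<integral>\<^sup>+\<omega>. B.gain (N \<nu>) \<omega> \<partial>P) \<le> (\<integral>\<^sup>+\<omega>. B.cost (N \<nu>) \<omega> \<partial>P)"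
      by (rule B.expectation_gain_le[OF ad pa])
    then have gain_fin: "(\<integral>\<^sup>+\<omega>. B.gain (N \<nu>) \<omega> \<partial>P) < \<infinity>" using fin_cost[OF \<nu>] by (rule le_less_trans)
    have finite_AE: "AE \<omega> in P. f \<omega> \<noteq> \<infinity>"
      if "f \<in> borel_measurable P" "(\<integral>\<^sup>+\<omega>. f \<omega> \<partial>P) < \<infinity>" for f :: "'w \<Rightarrow> ennreal"
      using that by (intro nn_integral_PInf_AE) auto
    have "payoff \<mu> p P U V r \<alpha> z \<phi> y \<nu> \<le> ext_expectation P (\<lambda>\<omega>. enn2ereal (T \<omega> + B.gain (N \<nu>) \<omega>)
        - enn2ereal (B.cost (N \<nu>) \<omega> + B.gain M \<omega>))"
      unfolding payoff_def
    proof (rule ext_expectation_mono)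
      have fin: "AE \<omega> in P. T \<omega> \<noteq> \<infinity>" "AE \<omega> in P. B.gain (N \<nu>) \<omega> \<noteq> \<infinity>"
          "AE \<omega> in P. B.cost (N \<nu>) \<omega> \<noteq> \<infinity>" "AE \<omega> in P. B.gain M \<omega> \<noteq> \<infinity>"
        using T_fin gain_fin fin_cost[OF \<nu>] gain_fin_nu by (intro finite_AE; measurable)+
      show "AE \<omega> in P. enn2ereal (total_profit \<mu> U r \<alpha> z y \<nu> \<omega>) - enn2ereal (total_cost \<mu> p V r \<phi> \<nu> \<omega>)
          \<le> enn2ereal (T \<omega> + B.gain (N \<nu>) \<omega>) - enn2ereal (B.cost (N \<nu>) \<omega> + B.gain M \<omega>)"
        using regular cost[OF ctl] control[OF ctl] AE_space fin
      proof eventually_elim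
        case (elim \<omega>)
        have "total_profit \<mu> U r \<alpha> z y \<nu> \<omega> + B.gain M \<omega> \<le> T \<omega> + B.gain (N \<nu>) \<omega>"
          using comparison[of \<omega> \<nu>] elim by blast
        then show ?case
          unfolding elim(2) by (rule ereal_diff_le_of_ennreal_add_le) (fact elim)+
      qed
    qed
    also have "\<dots> = enn2ereal (\<integral>\<^sup>+\<omega>. T \<omega> + B.gain (N \<nu>) \<omega> \<partial>P) - enn2ereal (\<integral>\<^sup>+\<omega>. B.cost (N \<nu>) \<omega> + B.gain M \<omega> \<partial>P)"
      using T_fin gain_fin fin_cost[OF \<nu>] gain_fin_nu
      by (intro ext_expectation_diff) (auto simp: nn_integral_add)
    also have "\<dots> = enn2ereal ((\<integral>\<^sup>+\<omega>. T \<omega> \<partial>P) + (\<integral>\<^sup>+\<omega>. B.gain (N \<nu>) \<omega> \<partial>P))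
        - enn2ereal ((\<integral>\<^sup>+\<omega>. B.cost (N \<nu>) \<omega> \<partial>P) + (\<integral>\<^sup>+\<omega>. B.cost M \<omega> \<partial>P))"
      by (simp add: nn_integral_add gain_nu)
    also have "\<dots> \<le> enn2ereal (\<integral>\<^sup>+\<omega>. T \<omega> \<partial>P) - enn2ereal (\<integral>\<^sup>+\<omega>. B.cost M \<omega> \<partial>P)"
    proof -
      obtain a b c d where *: "(\<integral>\<^sup>+\<omega>. T \<omega> \<partial>P) = ennreal a" "0 \<le> a" "(\<integral>\<^sup>+\<omega>. B.gain (N \<nu>) \<omega> \<partial>P) = ennreal b" "0 \<le> b"
        "(\<integral>\<^sup>+\<omega>. B.cost (N \<nu>) \<omega> \<partial>P) = ennreal c" "0 \<le> c" "(\<integral>\<^sup>+\<omega>. B.cost M \<omega> \<partial>P) = ennreal d" "0 \<le> d"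
        using T_fin gain_fin fin_cost[OF \<nu>] fin_cost_nu
        by (cases "\<integral>\<^sup>+\<omega>. T \<omega> \<partial>P"; cases "\<integral>\<^sup>+\<omega>. B.gain (N \<nu>) \<omega> \<partial>P";
            cases "\<integral>\<^sup>+\<omega>. B.cost (N \<nu>) \<omega> \<partial>P"; cases "\<integral>\<^sup>+\<omega>. B.cost M \<omega> \<partial>P") auto
      then have "b \<le> c" using gain_le by simp
      with * show ?thesis by (simp add: ennreal_plus[symmetric] enn2ereal_ennreal del: ennreal_plus)
    qed
    finally show ?thesis unfolding payoff_nu .
  qed
  have "payoff \<mu> p P U V r \<alpha> z \<phi> y nu = (SUP \<nu>\<in>admissible \<mu> p P F V r \<phi>. payoff \<mu> p P U V r \<alpha> z \<phi> y \<nu>)"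
    using nu_adm optimal by (intro antisym SUP_upper SUP_least)
  with nu_adm show ?thesis unfolding nu_def by blast
qed

end
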